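(* Let $\varphi$ be a geometric functional and let $u>0$ be fixed. Assume the first order moment condition $\int_{\mathbb{M}} V_i(K_m)\,\mathbb{Q}(\mathrm{d}m)<\infty$ for all $i\in\{1,\dots,d\}$. Then $$\lim_{r\to\infty}\frac{\mathbb{E}[\varphi(Z_u\cap W_r)]}{V_d(W_r)}=\mathbb{E}[\varphi(Z_u\cap C_0^d)],$$ where $C_0^d=[0,1)^d$ is the half-open $d$-dimensional unit cube and $\varphi(Z_u\cap C_0^d)=\varphi(Z_u\cap C^d)-\varphi(Z_u\cap\partial^+C^d)$ with $C^d=[0,1]^d$ and $\partial^+C^d=C^d\setminus C_0^d$.
   Context: Sets and functionals. $\mathcal{K}^d$ is the set of compact convex subsets of $\mathbb{R}^d$; $\mathcal{R}^d$ (the convex ring) is the set of all finite unions of compact convex sets (polyconvex sets). $\mathcal{F}^d$ is the space of closed subsets of $\mathbb{R}^d$ with the Fell topology and Borel $\sigma$-algebra $\mathcal{B}(\mathcal{F}^d)$. $V_0,\dots,V_d$ are the intrinsic volumes ($V_d$ is the volume); $\lambda_d$ is Lebesgue measure. A geometric functional is a measurable (with respect to $\mathcal{B}(\mathcal{F}^d)$ and $\mathcal{B}(\mathbb{R})$) function $\varphi:\mathcal{R}^d\to\mathbb{R}$ that is translation invariant ($\varphi(A+x)=\varphi(A)$ for $A\in\mathcal{R}^d$, $x\in\mathbb{R}^d$), additive ($\varphi(\emptyset)=0$ and $\varphi(A_1\cup A_2)=\varphi(A_1)+\varphi(A_2)-\varphi(A_1\cap A_2)$ for $A_1,A_2\in\mathcal{R}^d$)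 and locally bounded (there is $M_\varphi$ depending only on $\varphi$ with $|\varphi(A)|\le M_\varphi$ for all $A\in\mathcal{K}^d$ with $A\subseteq[0,1]^d$). Model. $d\in\mathbb{N}$, $(\mathbb{M},\mathcal{F}_{\mathbb{M}},\mathbb{Q})$ is a probability space (mark space), $\gamma>0$, and $\eta$ is a Poisson process on $\mathbb{R}^d\times\mathbb{M}$ with intensity measure $\lambda=\gamma\lambda_d\otimes\mathbb{Q}$. $\widetilde L^1(\mathbb{R}^d)$ is the space of integrable functions on $\mathbb{R}^d$ with compact convex closed support $K$ whose restriction to $K$ is continuous, equipped with the Borel $\sigma$-algebra $\mathcal{L}_1$ induced by the $L^1$-norm. $(g_m)_{m\in\mathbb{M}}$ is a family of measurable functions $g_m:\mathbb{R}^d\to[0,\infty)$ in $\widetilde L^1(\mathbb{R}^d)$, each concave on its non-empty compact convex closed support $K_m=\overline{\{x:g_m(x)>0\}}$, with $\lambda_d(K_m)>0$, and such that $m\mapsto g_m$ is $\mathcal{F}_{\mathbb{M}}$-$\mathcal{L}_1$-measurable. The Poisson shot noise process is $f_\eta(y)=\sum_{(x,m)\in\eta}g_m(y-x)$, $y\in\mathbb{R}^d$, and its excursion set is $Z_u=\{y\in\mathbb{R}^d:f_\eta(y)\ge u\}$. We consider an increasing sequence of observation windows $(W_r)_{r\ge1}$ with $W_r=rW$ for a compact convex set $W\subset\mathbb{R}^d$ with $\lambda_d(W)>0$. Under the first order moment condition, the intersection of $Z_u$ with any compact convex set is almost surely polyconvex, so the quantities in the claim are defined. *)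

theory Defs
  imports "HOL-Probability.Probability" "HOL-Computational_Algebra.Polynomial"
begin

section \<open>Polyconvex sets and the Fell topology\<close>

definition polyconvex :: "'a::euclidean_space set \<Rightarrow> bool" where
  "polyconvex A \<longleftrightarrow> (\<exists>\<K>. finite \<K> \<and> (\<forall>K\<in>\<K>. compact K \<and> convex K) \<and> A = \<Union>\<K>)"

text \<open>Taking the empty compact set in the second family shows that the carrier consists of all
  closed sets, including the empty one.\<close>

definition fell_topology :: "'a::euclidean_space set topology" where
  "fell_topology = topology_generated_by
     ({{F. closed F \<and> F \<inter> G \<noteq> {}} | G. open G} \<union>
      {{F. closed F \<and> F \<inter> K = {}} | K. compact K})"

definition fell_borel :: "'a::euclidean_space set measure" where
  "fell_borel = sigma {F. closed F} {\<U>. openin fell_topology \<U>}"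


section \<open>Intrinsic volumes\<close>

text \<open>By Steiner's formula, the volume of the parallel body of a compact convex set \<open>K\<close> in dimension
  \<open>d\<close> at distance \<open>r \<ge> 0\<close> is the polynomial \<open>\<Sum>j\<le>d. \<kappa>(d - j) * V j K * r ^ (d - j)\<close>, where \<open>\<kappa> n\<close>
  is the volume of the \<open>n\<close>-dimensional unit ball. The intrinsic volumes are read off from its
  coefficients; they are meaningful for compact convex \<open>K\<close> and \<open>j \<le> d\<close> only.\<close>

definition steiner_poly :: "'a::euclidean_space set \<Rightarrow> real poly" where
  "steiner_poly K = (THE p. \<forall>r\<ge>0. measure lborel (\<Union>x\<in>K. cball x r) = poly p r)"

definition intrinsic_volume :: "nat \<Rightarrow> 'a::euclidean_space set \<Rightarrow> real" where
  "intrinsic_volume j (K :: 'a set) =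
     coeff (steiner_poly K) (DIM('a) - j) / unit_ball_vol (real (DIM('a) - j))"


section \<open>Geometric functionals\<close>

definition unit_cube :: "(real ^ 'n) set" where
  "unit_cube = {x. \<forall>i. 0 \<le> x $ i \<and> x $ i \<le> 1}"

text \<open>A functional is a total function on sets; its values outside the polyconvex sets are
  unconstrained.\<close>

definition geometric_functional :: "((real ^ 'n) set \<Rightarrow> real) \<Rightarrow> bool" where
  "geometric_functional \<phi> \<longleftrightarrow>
     \<phi> \<in> borel_measurable (restrict_space fell_borel {A. polyconvex A}) \<and>
     (\<forall>A x. polyconvex A \<longrightarrow> \<phi> ((\<lambda>y. y + x) ` A) = \<phi> A) \<and>
     \<phi> {} = 0 \<and>
     (\<forall>A B. polyconvex A \<and> polyconvex B \<longrightarrow> \<phi> (A \<union> B) = \<phi> A + \<phi> B - \<phi> (A \<inter> B)) \<and>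
     (\<exists>M. \<forall>A. compact A \<and> convex A \<and> A \<subseteq> unit_cube \<longrightarrow> \<bar>\<phi> A\<bar> \<le> M)"


section \<open>Poisson processes\<close>

text \<open>A point measure is a countable sum of Dirac measures, that is, the counting measure of the
  family \<open>(X i)\<close> with index set \<open>I\<close>; points may be repeated. Integrals with respect to it are
  sums over its points.\<close>

definition point_measure_on :: "'a measure \<Rightarrow> 'a measure \<Rightarrow> bool" where
  "point_measure_on S \<mu> \<longleftrightarrow>
     (\<exists>(I :: nat set) X. X ` I \<subseteq> space S \<and> \<mu> = distr (count_space I) S X)"

definition poisson_process :: "'w measure \<Rightarrow> 'a measure \<Rightarrow> ('w \<Rightarrow> 'a measure) \<Rightarrow> bool" where
  "poisson_process P \<Lambda> \<eta> \<longleftrightarrow>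
     (\<forall>\<omega>\<in>space P. point_measure_on \<Lambda> (\<eta> \<omega>)) \<and>
     (\<forall>B\<in>sets \<Lambda>. (\<lambda>\<omega>. emeasure (\<eta> \<omega>) B) \<in> borel_measurable P) \<and>
     (\<forall>B\<in>sets \<Lambda>. emeasure \<Lambda> B < \<infinity> \<longrightarrow>
        (\<forall>k::nat. measure P {\<omega>\<in>space P. emeasure (\<eta> \<omega>) B = of_nat k} =
           measure \<Lambda> B ^ k / fact k * exp (- measure \<Lambda> B))) \<and>
     (\<forall>B\<in>sets \<Lambda>. emeasure \<Lambda> B = \<infinity> \<longrightarrow> (AE \<omega> in P. emeasure (\<eta> \<omega>) B = \<infinity>)) \<and>
     (\<forall>(n::nat) B. B ` {..<n} \<subseteq> sets \<Lambda> \<and> disjoint_family_on B {..<n} \<longrightarrow>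
        prob_space.indep_vars P (\<lambda>_. borel) (\<lambda>i \<omega>. emeasure (\<eta> \<omega>) (B i)) {..<n})"


section \<open>Shot noise\<close>

definition L1_tilde :: "('a::euclidean_space \<Rightarrow> real) set" where
  "L1_tilde = {f. integrable lborel f \<and> compact (closure {x. f x \<noteq> 0}) \<and>
     convex (closure {x. f x \<noteq> 0}) \<and> continuous_on (closure {x. f x \<noteq> 0}) f}"

text \<open>The Borel sigma-algebra of the topology induced by the \<open>L\<^sup>1\<close> (semi)norm.\<close>

definition L1_tilde_borel :: "('a::euclidean_space \<Rightarrow> real) measure" where
  "L1_tilde_borel = sigma L1_tilde
     {U. U \<subseteq> L1_tilde \<and>
         (\<forall>f\<in>U. \<exists>\<epsilon>>0. \<forall>h\<in>L1_tilde. (\<integral>x. \<bar>h x - f x\<bar> \<partial>lborel) < \<epsilon> \<longrightarrow> h \<in> U)}"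

definition grain :: "('m \<Rightarrow> 'a::euclidean_space \<Rightarrow> real) \<Rightarrow> 'm \<Rightarrow> 'a set" where
  "grain g m = closure {x. g m x > 0}"

text \<open>The sum over the points of a realization \<open>\<mu>\<close> of the process, possibly infinite.\<close>

definition shot_noise ::
    "('m \<Rightarrow> 'a::euclidean_space \<Rightarrow> real) \<Rightarrow> ('a \<times> 'm) measure \<Rightarrow> 'a \<Rightarrow> ennreal" where
  "shot_noise g \<mu> y = (\<integral>\<^sup>+(x, m). ennreal (g m (y - x)) \<partial>\<mu>)"

definition excursion_set ::
    "('m \<Rightarrow> 'a::euclidean_space \<Rightarrow> real) \<Rightarrow> real \<Rightarrow> ('a \<times> 'm) measure \<Rightarrow> 'a set" where
  "excursion_set g u \<mu> = {y. shot_noise g \<mu> y \<ge> ennreal u}"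


section \<open>Half-open cube and windows\<close>

definition half_open_cube :: "(real ^ 'n) set" where
  "half_open_cube = {x. \<forall>i. 0 \<le> x $ i \<and> x $ i < 1}"

definition upper_boundary :: "(real ^ 'n) set" where
  "upper_boundary = unit_cube - half_open_cube"

text \<open>The value of \<open>\<phi>\<close> on the intersection of \<open>Z\<close> with the half-open unit cube, which is in general
  not polyconvex.\<close>

definition on_half_open_cube :: "((real ^ 'n) set \<Rightarrow> real) \<Rightarrow> (real ^ 'n) set \<Rightarrow> real" where
  "on_half_open_cube \<phi> Z = \<phi> (Z \<inter> unit_cube) - \<phi> (Z \<inter> upper_boundary)"

definition window :: "'a::real_vector set \<Rightarrow> real \<Rightarrow> 'a set" where
  "window W r = (\<lambda>x. r *\<^sub>R x) ` W"

text \<open>Excursion sets are polyconvex on compact windows only almost surely, and \<open>\<phi>\<close> is unconstrained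
  elsewhere. Expectations are therefore taken with respect to the completion, so that modifications
  on a null set do not affect measurability.\<close>

definition expect :: "'w measure \<Rightarrow> ('w \<Rightarrow> real) \<Rightarrow> real" where
  "expect P X = (\<integral>\<omega>. X \<omega> \<partial>completion P)"

end

theory Submission
  imports Defs
begin

text \<open>The window \<open>W\<^sub>r\<close> is cut into half-open cubes of the integer lattice. An additive functional is
  linear in indicator functions (\<open>valuation_linear_relation\<close>), so \<open>\<phi> (Z \<inter> W\<^sub>r)\<close> is the sum of the
  contributions of the single cubes (\<open>functional_lattice_decomposition\<close>). The Poisson process is
  stationary; therefore every cube inside \<open>W\<^sub>r\<close> has the same mean contribution, namely the claimed
  limit, and there are as many of them as the volume of \<open>W\<^sub>r\<close>, up to the number of cubes that meet
  \<open>W\<^sub>r\<close> without lying in it. The latter cubes lie in a neighbourhood of bounded width of the frontier of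
  \<open>W\<^sub>r\<close>; after rescaling by \<open>r\<close> this is a shrinking neighbourhood of the null set \<open>frontier W\<close>, so their
  number is of smaller order than \<open>r\<close> to the power of the dimension (\<open>boundary_cubes_card\<close>,
  \<open>frontier_parallel_volume_tendsto_0\<close>). As their mean contributions are bounded uniformly, they
  disappear in the limit (\<open>window_expectation_estimate\<close>).

  The uniform bound rests on the number \<open>N\<close> of grains that hit a ball around the cube. Adding one
  grain replaces a superlevel set on a convex set by the union of two sets of the same kind whose
  intersection is again of that kind. By induction the excursion set is polyconvex in the cube and
  \<open>\<bar>\<phi>\<bar> \<le> 3 ^ N * M\<close> on it (\<open>valuation_superlevel_bound\<close>). Inclusion and exclusion over all convex pieces,
  of which there may be \<open>2 ^ N\<close>, would only give a bound that is doubly exponential in \<open>N\<close>, and that has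
  infinite mean for a Poisson variable of positive mean; \<open>3 ^ N\<close> has finite mean (\<open>integrable_weight\<close>) once \<open>N\<close> has.

  The mean of \<open>N\<close> is at most \<open>\<gamma>\<close> times the integral of the volumes of parallel bodies of the grains. The
  moment condition controls this integral through Steiner's formula. The formula itself has to be established,
  since the intrinsic volumes are defined as coefficients of a polynomial whose existence is not evident. The sum
  of a convex body and a segment has a volume that is affine in the length of the segment
  (\<open>measure_sweep\<close>); so the sum with a scaled zonotope has a volume that is polynomial in the scaling
  factor; and balls are limits of zonotopes (\<open>zonotope_approximates_ball\<close>).

  Stationarity holds since the intensity measure is invariant under translations and determines the law
  of a Poisson process on the space of point configurations (\<open>poisson_process_law_unique\<close>). To transfer it to excursion sets,
  and for the expectations to make sense, the excursion set has to be a measurable function of the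
  configuration with respect to the Fell topology. It suffices that the configurations whose excursion
  set hits a given compact set form a measurable set (\<open>measurable_fell_borelI\<close>). As the shot
  noise is only upper semicontinuous, this cannot be tested on a countable dense set of
  points; it is instead tested on local suprema of the grains at such points
  (\<open>excursion_hits_iff\<close>).\<close>

section \<open>Additive functionals on a lattice of sets\<close>

text \<open>A set \<open>T\<close> of indices stands for the atom of all points that lie in \<open>A j\<close> for the indices \<open>j\<close>
  in \<open>T\<close> and for no other index. Atoms need not belong to the lattice, so their value is expressed
  as a difference. In the induction, one more set splits each atom in two, and additivity says
  that the values of the two parts add up.\<close>

lemma valuation_atoms:
  fixes \<phi> :: "'a set \<Rightarrow> real"
  assumes Un: "\<And>A B. A \<in> L \<Longrightarrow> B \<in> L \<Longrightarrow> A \<union> B \<in> L"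
    and Int: "\<And>A B. A \<in> L \<Longrightarrow> B \<in> L \<Longrightarrow> A \<inter> B \<in> L"
    and empty: "{} \<in> L" "\<phi> {} = 0"
    and add: "\<And>A B. A \<in> L \<Longrightarrow> B \<in> L \<Longrightarrow> \<phi> (A \<union> B) = \<phi> A + \<phi> B - \<phi> (A \<inter> B)"
    and "finite J" "B \<in> L" "\<And>j. j \<in> J \<Longrightarrow> A j \<in> L"
  shows "\<phi> B = (\<Sum>T\<in>Pow J. \<phi> (B \<inter> \<Inter> (A ` T)) - \<phi> (B \<inter> \<Inter> (A ` T) \<inter> \<Union> (A ` (J - T))))"
  using \<open>finite J\<close> assms(8)
proof (induction J rule: finite_induct)
  case empty
  then show ?case using assms(4) by simp
next
  case (insert j J)
  let ?w = "\<lambda>J T. \<phi> (B \<inter> \<Inter> (A ` T)) - \<phi> (B \<inter> \<Inter> (A ` T) \<inter> \<Union> (A ` (J - T)))"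
  have AT: "B \<inter> \<Inter> (A ` T) \<in> L" if "T \<subseteq> J" for T
  proof -
    have "finite T" using that insert.hyps(1) finite_subset by blast
    then show ?thesis using that
    proof (induction T rule: finite_induct)
      case empty
      then show ?case using \<open>B \<in> L\<close> by simp
    next
      case (insert t T)
      have "B \<inter> \<Inter> (A ` insert t T) = A t \<inter> (B \<inter> \<Inter> (A ` T))" by auto
      then show ?case using insert \<open>\<And>i. i \<in> Set.insert j J \<Longrightarrow> A i \<in> L\<close> Int by auto
    qed
  qed
  have UT: "\<Union> (A ` S) \<in> L" if "S \<subseteq> J" for S
  proof -
    have "finite S" using that insert.hyps(1) finite_subset by blast
    then show ?thesis using that
      by (induction S rule: finite_induct) (use insert.prems empty Un in auto)
  qed
  have split: "?w J T = ?w (insert j J) T + ?w (insert j J) (insert j T)" if T: "T \<in> Pow J" for T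
  proof -
    let ?C = "B \<inter> \<Inter> (A ` T)" and ?U = "\<Union> (A ` (J - T))"
    have C: "?C \<in> L" using AT T by blast
    have U: "?U \<in> L" using UT[of "J - T"] by blast
    have Aj: "A j \<in> L" using insert.prems by auto
    have "j \<notin> T" using T insert.hyps by auto
    then have *: "insert j J - T = insert j (J - T)" "insert j J - insert j T = J - T"
      using insert.hyps by auto
    have "?C \<inter> \<Union> (A ` (insert j J - T)) = (?C \<inter> ?U) \<union> (?C \<inter> A j)"
      unfolding * by auto
    moreover have "\<phi> ((?C \<inter> ?U) \<union> (?C \<inter> A j))
        = \<phi> (?C \<inter> ?U) + \<phi> (?C \<inter> A j) - \<phi> ((?C \<inter> ?U) \<inter> (?C \<inter> A j))"
      by (rule add) (use C U Aj Int in auto)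
    moreover have "(?C \<inter> ?U) \<inter> (?C \<inter> A j) = ?C \<inter> A j \<inter> ?U" by auto
    moreover have "B \<inter> \<Inter> (A ` insert j T) = ?C \<inter> A j" by auto
    ultimately show ?thesis unfolding * by simp
  qed
  have "\<phi> B = (\<Sum>T\<in>Pow J. ?w J T)"
    using insert by blast
  also have "\<dots> = (\<Sum>T\<in>Pow J. ?w (insert j J) T + ?w (insert j J) (insert j T))"
    by (rule sum.cong) (use split in auto)
  also have "\<dots> = (\<Sum>T\<in>Pow J. ?w (insert j J) T) + (\<Sum>T\<in>insert j ` Pow J. ?w (insert j J) T)"
  proof -
    have inj: "inj_on (insert j) (Pow J)"
      unfolding inj_on_def by (metis Pow_iff insert.hyps(2) insert_ident subsetD)
    show ?thesis by (simp add: sum.distrib sum.reindex[OF inj])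
  qed
  also have "\<dots> = (\<Sum>T\<in>Pow (insert j J). ?w (insert j J) T)"
    unfolding Pow_insert
    by (rule sum.union_disjoint[symmetric]) (use insert.hyps in auto)
  finally show ?case .
qed

text \<open>Groemer's observation that an additive functional descends to indicator functions. Evaluated
  on the atoms, the left-hand side is a combination of atom values; the coefficient of an atom is
  the value of the given combination of indicators at any of its points, and an empty atom has
  value 0.\<close>

theorem valuation_linear_relation:
  fixes \<phi> :: "'a set \<Rightarrow> real" and a :: "'i \<Rightarrow> real"
  assumes Un: "\<And>A B. A \<in> L \<Longrightarrow> B \<in> L \<Longrightarrow> A \<union> B \<in> L"
    and Int: "\<And>A B. A \<in> L \<Longrightarrow> B \<in> L \<Longrightarrow> A \<inter> B \<in> L"
    and empty: "{} \<in> L" "\<phi> {} = 0"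
    and add: "\<And>A B. A \<in> L \<Longrightarrow> B \<in> L \<Longrightarrow> \<phi> (A \<union> B) = \<phi> A + \<phi> B - \<phi> (A \<inter> B)"
    and fin: "finite I" and A: "\<And>i. i \<in> I \<Longrightarrow> A i \<in> L"
    and rel: "\<And>x. (\<Sum>i\<in>I. a i * indicator (A i) x) = 0"
  shows "(\<Sum>i\<in>I. a i * \<phi> (A i)) = 0"
proof -
  define w where "w T = \<phi> (\<Inter> (A ` T)) - \<phi> (\<Inter> (A ` T) \<inter> \<Union> (A ` (I - T)))" for T
  have w: "\<phi> (A i \<inter> \<Inter> (A ` T)) - \<phi> (A i \<inter> \<Inter> (A ` T) \<inter> \<Union> (A ` (I - T))) = (if i \<in> T then w T else 0)"
    if "i \<in> I" for i T
  proof (cases "i \<in> T")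
    case True
    then have "A i \<inter> \<Inter> (A ` T) = \<Inter> (A ` T)" by auto
    then show ?thesis using True by (simp add: w_def)
  next
    case False
    then have "A i \<inter> \<Inter> (A ` T) \<inter> \<Union> (A ` (I - T)) = A i \<inter> \<Inter> (A ` T)" using that by auto
    then show ?thesis using False by simp
  qed
  have "(\<Sum>i\<in>I. a i * \<phi> (A i)) = (\<Sum>i\<in>I. a i * (\<Sum>T\<in>Pow I. if i \<in> T then w T else 0))"
  proof (rule sum.cong[OF refl])
    fix i assume i: "i \<in> I"
    show "a i * \<phi> (A i) = a i * (\<Sum>T\<in>Pow I. if i \<in> T then w T else 0)"
      using valuation_atoms[where L=L and \<phi>=\<phi> and J=I and A=A and B="A i", OF Un Int empty add fin A[OF i] A]
      by (simp add: w[OF i])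
  qed
  also have "\<dots> = (\<Sum>T\<in>Pow I. \<Sum>i\<in>I. a i * (if i \<in> T then w T else 0))"
    unfolding sum_distrib_left by (rule sum.swap)
  also have "\<dots> = 0"
  proof (rule sum.neutral, safe)
    fix T assume T: "T \<subseteq> I"
    have "(\<Sum>i\<in>I. a i * (if i \<in> T then w T else 0)) = (\<Sum>i\<in>T. a i) * w T"
    proof -
      have "(\<Sum>i\<in>I. a i * (if i \<in> T then w T else 0)) = (\<Sum>i\<in>T. a i * w T)"
        by (rule sum.mono_neutral_cong_right) (use T fin in auto)
      then show ?thesis by (simp add: sum_distrib_right)
    qed
    also have "\<dots> = 0"
    proof (cases "\<Inter> (A ` T) \<subseteq> \<Union> (A ` (I - T))")
      case True
      then have "\<Inter> (A ` T) \<inter> \<Union> (A ` (I - T)) = \<Inter> (A ` T)" by auto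
      then show ?thesis by (simp add: w_def)
    next
      case False
      then obtain x where x: "x \<in> \<Inter> (A ` T)" "x \<notin> \<Union> (A ` (I - T))" by blast
      have "(\<Sum>i\<in>I. a i * indicator (A i) x) = (\<Sum>i\<in>T. a i)"
        by (rule sum.mono_neutral_cong_right) (use T fin x in auto)
      then show ?thesis using rel[of x] by simp
    qed
    finally show "(\<Sum>i\<in>I. a i * (if i \<in> T then w T else 0)) = 0" .
  qed
  finally show ?thesis .
qed

section \<open>Polyconvex sets\<close>

lemma polyconvex_empty [simp]: "polyconvex {}"
  unfolding polyconvex_def by (rule exI[of _ "{}"]) auto

lemma polyconvexI: "compact K \<Longrightarrow> convex K \<Longrightarrow> polyconvex K"
  unfolding polyconvex_def by (rule exI[of _ "{K}"]) auto

lemma polyconvex_Un: "polyconvex A \<Longrightarrow> polyconvex B \<Longrightarrow> polyconvex (A \<union> B)"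
  unfolding polyconvex_def
  by (metis Union_Un_distrib Un_iff finite_Un)

lemma polyconvex_UN: "finite I \<Longrightarrow> (\<And>i. i \<in> I \<Longrightarrow> polyconvex (A i)) \<Longrightarrow> polyconvex (\<Union>i\<in>I. A i)"
  by (induction I rule: finite_induct) (auto intro: polyconvex_Un)

lemma polyconvex_Int_closed_convex:
  assumes "polyconvex A" "closed D" "convex D" shows "polyconvex (A \<inter> D)"
proof -
  obtain \<K> where K: "finite \<K>" "\<forall>K\<in>\<K>. compact K \<and> convex K" "A = \<Union>\<K>"
    using assms unfolding polyconvex_def by blast
  have "A \<inter> D = (\<Union>K\<in>\<K>. K \<inter> D)" using K by auto
  moreover have "polyconvex (\<Union>K\<in>\<K>. K \<inter> D)"
    by (rule polyconvex_UN) (use K assms in \<open>auto intro!: polyconvexI compact_Int_closed convex_Int\<close>)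
  ultimately show ?thesis by simp
qed

lemma polyconvex_Int: assumes "polyconvex A" "polyconvex B" shows "polyconvex (A \<inter> B)"
proof -
  obtain \<K> where K: "finite \<K>" "\<forall>K\<in>\<K>. compact K \<and> convex K" "B = \<Union>\<K>"
    using assms unfolding polyconvex_def by blast
  have "A \<inter> B = (\<Union>K\<in>\<K>. A \<inter> K)" using K by auto
  moreover have "polyconvex (\<Union>K\<in>\<K>. A \<inter> K)"
    by (rule polyconvex_UN) (use K assms in \<open>auto intro!: polyconvex_Int_closed_convex compact_imp_closed\<close>)
  ultimately show ?thesis by simp
qed

lemma polyconvex_compact: "polyconvex A \<Longrightarrow> compact A"
  unfolding polyconvex_def by (auto intro: compact_Union)

lemma polyconvex_translation:
  assumes "polyconvex A" shows "polyconvex ((+) z ` A)"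
proof -
  obtain \<K> where K: "finite \<K>" "\<forall>K\<in>\<K>. compact K \<and> convex K" "A = \<Union>\<K>"
    using assms unfolding polyconvex_def by blast
  have "(+) z ` A = (\<Union>K\<in>\<K>. (+) z ` K)" using K by auto
  moreover have "polyconvex (\<Union>K\<in>\<K>. (+) z ` K)"
    by (rule polyconvex_UN) (use K in \<open>auto intro!: polyconvexI compact_translation convex_translation\<close>)
  ultimately show ?thesis by simp
qed

section \<open>Superlevel sets of finite sums of concave functions on convex supports\<close>

lemma compact_convex_superlevel:
  fixes h :: "'a::euclidean_space \<Rightarrow> real"
  assumes "compact C" "convex C" "continuous_on C h" "concave_on C h"
  shows "compact {y\<in>C. u \<le> h y}" "convex {y\<in>C. u \<le> h y}"
proof -
  have "{y\<in>C. u \<le> h y} = C \<inter> h -` {u..}" by auto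
  moreover have "closed (C \<inter> h -` {u..})"
    by (rule continuous_closed_preimage) (use assms compact_imp_closed in auto)
  moreover have "C \<inter> (C \<inter> h -` {u..}) = C \<inter> h -` {u..}" by auto
  ultimately show "compact {y\<in>C. u \<le> h y}"
    using compact_Int_closed[OF assms(1), of "C \<inter> h -` {u..}"] by simp
  show "convex {y\<in>C. u \<le> h y}"
  proof (rule convexI)
    fix x y and a b :: real
    assume xy: "x \<in> {y\<in>C. u \<le> h y}" "y \<in> {y\<in>C. u \<le> h y}" and ab: "0 \<le> a" "0 \<le> b" "a + b = 1"
    have "a *\<^sub>R x + b *\<^sub>R y \<in> C" using assms(2) xy ab by (auto intro: convexD)
    moreover have "a * h x + b * h y \<le> h (a *\<^sub>R x + b *\<^sub>R y)"
      using assms(4) xy ab unfolding concave_on_iff by blast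
    moreover have "u \<le> a * h x + b * h y"
    proof -
      have "a * u + b * u \<le> a * h x + b * h y"
        using xy ab by (intro add_mono mult_left_mono) auto
      moreover have "a * u + b * u = u" using ab by (metis distrib_right mult_1)
      ultimately show ?thesis by simp
    qed
    ultimately show "a *\<^sub>R x + b *\<^sub>R y \<in> {y\<in>C. u \<le> h y}" by simp
  qed
qed

text \<open>Concave functions with different supports: their sum is in general neither concave nor
  continuous, but its superlevel sets can be built up one function at a time.\<close>

locale concave_grains =
  fixes J :: "'i set" and K :: "'i \<Rightarrow> 'a::euclidean_space set" and k :: "'i \<Rightarrow> 'a \<Rightarrow> real"
  assumes fin: "finite J"
    and closed: "\<And>j. j \<in> J \<Longrightarrow> closed (K j)" and convex: "\<And>j. j \<in> J \<Longrightarrow> convex (K j)"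
    and cont: "\<And>j. j \<in> J \<Longrightarrow> continuous_on (K j) (k j)"
    and concave: "\<And>j. j \<in> J \<Longrightarrow> concave_on (K j) (k j)"
    and nonneg: "\<And>j y. j \<in> J \<Longrightarrow> 0 \<le> k j y"
    and outside: "\<And>j y. j \<in> J \<Longrightarrow> y \<notin> K j \<Longrightarrow> k j y = 0"
begin

text \<open>The recursion behind \<open>polyconvex_superlevel\<close> and \<open>valuation_superlevel_bound\<close>. Since \<open>k j\<close> is nonnegative and vanishes outside
  \<open>K j\<close>, adding it to the sum enlarges the superlevel set only within \<open>K j\<close>, where it can be
  absorbed into the concave base function \<open>h\<close>.\<close>

lemma superlevel_insert:
  assumes "j \<in> J" "S \<subseteq> J" "j \<notin> S"
  shows "{y\<in>C. u \<le> h y + (\<Sum>i\<in>insert j S. k i y)} =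
      {y\<in>C. u \<le> h y + (\<Sum>i\<in>S. k i y)} \<union> {y\<in>C \<inter> K j. u \<le> (h y + k j y) + (\<Sum>i\<in>S. k i y)}"
    and "{y\<in>C. u \<le> h y + (\<Sum>i\<in>S. k i y)} \<inter> {y\<in>C \<inter> K j. u \<le> (h y + k j y) + (\<Sum>i\<in>S. k i y)} =
      {y\<in>C \<inter> K j. u \<le> h y + (\<Sum>i\<in>S. k i y)}"
proof -
  have "finite S" using assms fin finite_subset by blast
  then have *: "(\<Sum>i\<in>insert j S. k i y) = k j y + (\<Sum>i\<in>S. k i y)" for y
    using assms by simp
  have **: "0 \<le> k j y" "y \<notin> K j \<Longrightarrow> k j y = 0" for y using assms nonneg outside by auto
  have mono: "u \<le> s \<Longrightarrow> u \<le> s + k j y" for s y using **(1)[of y] by linarith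
  show "{y\<in>C. u \<le> h y + (\<Sum>i\<in>insert j S. k i y)} =
      {y\<in>C. u \<le> h y + (\<Sum>i\<in>S. k i y)} \<union> {y\<in>C \<inter> K j. u \<le> (h y + k j y) + (\<Sum>i\<in>S. k i y)}"
  proof (rule set_eqI)
    fix y
    have "h y + (\<Sum>i\<in>insert j S. k i y) = (h y + (\<Sum>i\<in>S. k i y)) + k j y"
      "(h y + k j y) + (\<Sum>i\<in>S. k i y) = (h y + (\<Sum>i\<in>S. k i y)) + k j y"
      unfolding * by simp_all
    then show "y \<in> {y\<in>C. u \<le> h y + (\<Sum>i\<in>insert j S. k i y)} \<longleftrightarrow> y \<in>
      {y\<in>C. u \<le> h y + (\<Sum>i\<in>S. k i y)} \<union> {y\<in>C \<inter> K j. u \<le> (h y + k j y) + (\<Sum>i\<in>S. k i y)}"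
      using **(2)[of y] mono[of "h y + (\<Sum>i\<in>S. k i y)" y] by (cases "y \<in> K j") auto
  qed
  show "{y\<in>C. u \<le> h y + (\<Sum>i\<in>S. k i y)} \<inter> {y\<in>C \<inter> K j. u \<le> (h y + k j y) + (\<Sum>i\<in>S. k i y)} =
      {y\<in>C \<inter> K j. u \<le> h y + (\<Sum>i\<in>S. k i y)}"
  proof (rule set_eqI)
    fix y
    have "(h y + k j y) + (\<Sum>i\<in>S. k i y) = (h y + (\<Sum>i\<in>S. k i y)) + k j y" by simp
    then show "y \<in> {y\<in>C. u \<le> h y + (\<Sum>i\<in>S. k i y)} \<inter> {y\<in>C \<inter> K j. u \<le> (h y + k j y) + (\<Sum>i\<in>S. k i y)}
      \<longleftrightarrow> y \<in> {y\<in>C \<inter> K j. u \<le> h y + (\<Sum>i\<in>S. k i y)}"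
      using mono[of "h y + (\<Sum>i\<in>S. k i y)" y] by auto
  qed
qed

lemma restrict_to_grain:
  assumes "j \<in> J" "compact C" "convex C" "continuous_on C h" "concave_on C h"
  shows "compact (C \<inter> K j)" "convex (C \<inter> K j)"
    "continuous_on (C \<inter> K j) h" "concave_on (C \<inter> K j) h"
    "continuous_on (C \<inter> K j) (\<lambda>y. h y + k j y)" "concave_on (C \<inter> K j) (\<lambda>y. h y + k j y)"
proof -
  show co: "compact (C \<inter> K j)" using assms closed by (auto intro: compact_Int_closed)
  show cv: "convex (C \<inter> K j)" using assms convex by (auto intro: convex_Int)
  show c1: "continuous_on (C \<inter> K j) h" using assms by (auto intro: continuous_on_subset)
  have c2: "continuous_on (C \<inter> K j) (k j)" using assms cont by (meson Int_lower2 continuous_on_subset)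
  show "continuous_on (C \<inter> K j) (\<lambda>y. h y + k j y)" by (intro continuous_on_add c1 c2)
  show v1: "concave_on (C \<inter> K j) h" using assms(5) cv by (auto simp: concave_on_iff)
  have v2: "concave_on (C \<inter> K j) (k j)" using concave[OF assms(1)] cv by (auto simp: concave_on_iff)
  show "concave_on (C \<inter> K j) (\<lambda>y. h y + k j y)" by (intro concave_on_add v1 v2)
qed

lemma polyconvex_superlevel:
  assumes "S \<subseteq> J" "compact C" "convex C" "continuous_on C h" "concave_on C h"
  shows "polyconvex {y\<in>C. u \<le> h y + (\<Sum>i\<in>S. k i y)}"
proof -
  have "finite S" using assms fin finite_subset by blast
  then show ?thesis using assms
  proof (induction S arbitrary: C h rule: finite_induct)
    case empty
    then show ?case by (auto intro!: polyconvexI compact_convex_superlevel)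
  next
    case (insert j S)
    have j: "j \<in> J" "S \<subseteq> J" "j \<notin> S" using insert by auto
    note b = restrict_to_grain[OF j(1) insert.prems(2-5)]
    show ?case unfolding superlevel_insert(1)[OF j]
      by (rule polyconvex_Un[OF insert.IH[OF j(2) insert.prems(2-5)] insert.IH[OF j(2) b(1,2,5,6)]])
  qed
qed

text \<open>By \<open>superlevel_insert\<close>, the value for one more function is a signed sum of three values with
  the smaller family; this is where the factor 3 comes from.\<close>

lemma valuation_superlevel_bound:
  fixes \<phi> :: "'a set \<Rightarrow> real"
  assumes add: "\<And>A B. polyconvex A \<Longrightarrow> polyconvex B \<Longrightarrow> \<phi> (A \<union> B) = \<phi> A + \<phi> B - \<phi> (A \<inter> B)"
    and bound: "\<And>A. compact A \<Longrightarrow> convex A \<Longrightarrow> A \<subseteq> C0 \<Longrightarrow> \<bar>\<phi> A\<bar> \<le> M"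
    and "S \<subseteq> J" "compact C" "convex C" "C \<subseteq> C0" "continuous_on C h" "concave_on C h"
  shows "\<bar>\<phi> {y\<in>C. u \<le> h y + (\<Sum>i\<in>S. k i y)}\<bar> \<le> 3 ^ card S * M"
proof -
  have "finite S" using assms(3) fin finite_subset by blast
  then show ?thesis using assms(3-)
  proof (induction S arbitrary: C h rule: finite_induct)
    case empty
    then show ?case using compact_convex_superlevel[of C h] by (auto intro!: bound)
  next
    case (insert j S)
    have j: "j \<in> J" "S \<subseteq> J" "j \<notin> S" using insert by auto
    note b = restrict_to_grain[OF j(1) insert.prems(2,3,5,6)]
    let ?E = "\<lambda>C h. {y\<in>C. u \<le> h y + (\<Sum>i\<in>S. k i y)}"
    have CK: "C \<inter> K j \<subseteq> C0" using insert by auto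
    have 1: "\<bar>\<phi> (?E C h)\<bar> \<le> 3 ^ card S * M" by (rule insert.IH[OF j(2) insert.prems(2-6)])
    have 2: "\<bar>\<phi> (?E (C \<inter> K j) h)\<bar> \<le> 3 ^ card S * M" by (rule insert.IH[OF j(2) b(1,2) CK b(3,4)])
    have 3: "\<bar>\<phi> (?E (C \<inter> K j) (\<lambda>y. h y + k j y))\<bar> \<le> 3 ^ card S * M"
      by (rule insert.IH[OF j(2) b(1,2) CK b(5,6)])
    have "\<phi> {y\<in>C. u \<le> h y + (\<Sum>i\<in>insert j S. k i y)}
        = \<phi> (?E C h) + \<phi> (?E (C \<inter> K j) (\<lambda>y. h y + k j y)) - \<phi> (?E (C \<inter> K j) h)"
      using add[OF polyconvex_superlevel[OF j(2) insert.prems(2,3,5,6)]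
          polyconvex_superlevel[OF j(2) b(1,2,5,6)], of u u]
      by (simp only: superlevel_insert[OF j])
    with 1 2 3 have "\<bar>\<phi> {y\<in>C. u \<le> h y + (\<Sum>i\<in>insert j S. k i y)}\<bar> \<le> 3 * (3 ^ card S * M)"
      by linarith
    then show ?case using insert.hyps by simp
  qed
qed

end

section \<open>Invariance of Lebesgue measure under reflections\<close>

lemma lborel_translate: "distr lborel borel (\<lambda>x::'a::euclidean_space. x + a) = lborel"
proof -
  have "(\<lambda>x. x + a) = (+) a" by (auto simp: add.commute)
  then show ?thesis using lborel_distr_plus[of a] by simp
qed

text \<open>Uniqueness of Haar measure: the double integral of \<open>f x * g (y + x)\<close>, with \<open>f\<close> and \<open>g\<close> the
  indicators of \<open>A\<close> and of the unit ball, is evaluated in both orders, using the invariance of one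
  measure in each of them.\<close>

lemma translation_invariant_eq_lborel:
  fixes \<mu> :: "'a::euclidean_space measure"
  assumes sets: "sets \<mu> = sets borel" and fin: "sigma_finite_measure \<mu>"
    and inv: "\<And>a. distr \<mu> borel (\<lambda>x. x + a) = \<mu>"
    and ball: "emeasure \<mu> (cball 0 1) = emeasure lborel (cball (0::'a) 1)"
  shows "\<mu> = lborel"
proof (rule measure_eqI)
  show "sets \<mu> = sets lborel" by (simp add: sets)
  fix A assume "A \<in> sets \<mu>"
  then have [measurable]: "A \<in> sets borel" by (simp add: sets)
  interpret m: sigma_finite_measure \<mu> by fact
  interpret pair_sigma_finite \<mu> lborel ..
  have [measurable_cong]: "sets \<mu> = sets borel" by fact
  define B where "B = cball (0::'a) 1"
  have [measurable]: "B \<in> sets borel" by (simp add: B_def)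
  let ?f = "indicator A :: 'a \<Rightarrow> ennreal" and ?g = "indicator B :: 'a \<Rightarrow> ennreal"
  have tl: "(\<integral>\<^sup>+y. h (y + a) \<partial>lborel) = (\<integral>\<^sup>+y. h y \<partial>lborel)"
    if [measurable]: "h \<in> borel_measurable borel" for h a
    by (subst (2) lborel_translate[of a, symmetric], subst nn_integral_distr) auto
  have tm: "(\<integral>\<^sup>+y. h (y + a) \<partial>\<mu>) = (\<integral>\<^sup>+y. h y \<partial>\<mu>)"
    if [measurable]: "h \<in> borel_measurable borel" for h a
    by (subst (2) inv[of a, symmetric], subst nn_integral_distr) auto
  have refl: "(\<integral>\<^sup>+y. ?f (x - y) \<partial>lborel) = emeasure lborel A" for x
  proof -
    have eq: "lborel = density (distr lborel borel (\<lambda>y::'a. x + (-1) *\<^sub>R y)) (\<lambda>_. \<bar>-1::real\<bar>^DIM('a))"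
      by (rule lborel_affine) simp
    have "emeasure lborel A = (\<integral>\<^sup>+y. ?f y \<partial>lborel)" by simp
    also have "\<dots> = (\<integral>\<^sup>+y. ?f y \<partial>distr lborel borel (\<lambda>y::'a. x + (-1) *\<^sub>R y))"
      by (subst eq) (simp add: density_1)
    also have "\<dots> = (\<integral>\<^sup>+y. ?f (x - y) \<partial>lborel)"
      by (subst nn_integral_distr) auto
    finally show ?thesis by simp
  qed
  have "emeasure \<mu> A * emeasure lborel B = (\<integral>\<^sup>+x. ?f x * (\<integral>\<^sup>+y. ?g y \<partial>lborel) \<partial>\<mu>)"
    by (subst nn_integral_multc) (auto simp: sets)
  also have "\<dots> = (\<integral>\<^sup>+x. (\<integral>\<^sup>+y. ?f x * ?g (y + x) \<partial>lborel) \<partial>\<mu>)"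
  proof (rule nn_integral_cong)
    fix x
    have "(\<integral>\<^sup>+y. ?f x * ?g (y + x) \<partial>lborel) = ?f x * (\<integral>\<^sup>+y. ?g (y + x) \<partial>lborel)"
      by (rule nn_integral_cmult) measurable
    then show "?f x * (\<integral>\<^sup>+y. ?g y \<partial>lborel) = (\<integral>\<^sup>+y. ?f x * ?g (y + x) \<partial>lborel)"
      using tl[of ?g x] by simp
  qed
  also have "\<dots> = (\<integral>\<^sup>+y. (\<integral>\<^sup>+x. ?f x * ?g (y + x) \<partial>\<mu>) \<partial>lborel)"
    by (rule Fubini'[symmetric]) simp
  also have "\<dots> = (\<integral>\<^sup>+y. (\<integral>\<^sup>+x. ?f (x - y) * ?g x \<partial>\<mu>) \<partial>lborel)"
  proof (rule nn_integral_cong)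
    fix y
    show "(\<integral>\<^sup>+x. ?f x * ?g (y + x) \<partial>\<mu>) = (\<integral>\<^sup>+x. ?f (x - y) * ?g x \<partial>\<mu>)"
      using tm[of "\<lambda>x. ?f (x - y) * ?g x" y] by (simp add: add.commute)
  qed
  also have "\<dots> = (\<integral>\<^sup>+x. (\<integral>\<^sup>+y. ?f (x - y) * ?g x \<partial>lborel) \<partial>\<mu>)"
    by (rule Fubini') simp
  also have "\<dots> = (\<integral>\<^sup>+x. emeasure lborel A * ?g x \<partial>\<mu>)"
    by (intro nn_integral_cong) (simp add: nn_integral_multc refl)
  also have "\<dots> = emeasure lborel A * emeasure lborel B"
    using ball by (subst nn_integral_cmult) (measurable, simp add: sets B_def)
  finally have "emeasure \<mu> A * emeasure lborel B = emeasure lborel A * emeasure lborel B" .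
  moreover have "emeasure lborel B \<noteq> 0" "emeasure lborel B \<noteq> \<infinity>"
    by (auto simp: B_def emeasure_cball ennreal_eq_0_iff unit_ball_vol_pos not_le)
  ultimately show "emeasure \<mu> A = emeasure lborel A"
    by (simp add: mult.commute[of _ "emeasure lborel B"] ennreal_mult_cancel_left)
qed

text \<open>Reflections are used in place of general orthogonal maps because they suffice to exchange
  any two vectors of equal norm.\<close>

definition reflection :: "'a::euclidean_space \<Rightarrow> 'a \<Rightarrow> 'a" where
  "reflection w x = x - (2 * (x \<bullet> w) / (w \<bullet> w)) *\<^sub>R w"

lemma linear_reflection: "linear (reflection w)"
proof (rule linearI)
  fix x y and c :: real
  show "reflection w (x + y) = reflection w x + reflection w y"
    unfolding reflection_def
    by (simp add: inner_add_left distrib_left add_divide_distrib scaleR_add_left)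
  show "reflection w (c *\<^sub>R x) = c *\<^sub>R reflection w x"
    unfolding reflection_def by (simp add: scaleR_diff_right)
qed

lemma reflection_reflection [simp]: "reflection w (reflection w x) = x"
proof (cases "w = 0")
  case False
  then have "w \<bullet> w \<noteq> 0" by simp
  then have *: "reflection w x \<bullet> w = - (x \<bullet> w)"
    by (simp add: reflection_def inner_diff_left)
  have "reflection w (reflection w x) = reflection w x + (2 * (x \<bullet> w) / (w \<bullet> w)) *\<^sub>R w"
    unfolding reflection_def[of w "reflection w x"] * by simp
  also have "\<dots> = x"
    unfolding reflection_def by simp
  finally show ?thesis .
qed (simp add: reflection_def)

lemma inner_reflection: "reflection w x \<bullet> y = x \<bullet> reflection w y"
  by (simp add: reflection_def inner_diff_left inner_diff_right inner_commute[of w y])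

lemma norm_reflection [simp]: "norm (reflection w x) = norm x"
  by (simp add: norm_eq_sqrt_inner inner_reflection)

lemma reflection_swap:
  assumes "norm u = norm v" shows "reflection (u - v) u = v"
proof (cases "u = v")
  case False
  have "u \<bullet> u = v \<bullet> v" using assms by (metis norm_eq_sqrt_inner power2_norm_eq_inner)
  then have "(u - v) \<bullet> (u - v) = 2 * (u \<bullet> (u - v))"
    by (simp add: inner_diff_left inner_diff_right inner_commute)
  moreover have "(u - v) \<bullet> (u - v) \<noteq> 0" using False by simp
  ultimately show ?thesis by (simp add: reflection_def)
qed (simp add: reflection_def)

lemma lborel_reflection: "distr lborel borel (reflection (w::'a::euclidean_space)) = lborel"
proof (rule translation_invariant_eq_lborel)
  have [measurable]: "reflection w \<in> borel_measurable borel"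
    by (intro borel_measurable_continuous_onI linear_continuous_on linear_linear[THEN iffD2] linear_reflection)
  show "sets (distr lborel borel (reflection w)) = sets borel" by simp
  have vimage: "reflection w -` cball 0 r = cball 0 r" for r by auto
  show "emeasure (distr lborel borel (reflection w)) (cball 0 1) = emeasure lborel (cball (0::'a) 1)"
    by (simp add: emeasure_distr vimage)
  show "sigma_finite_measure (distr lborel borel (reflection w))"
  proof
    show "\<exists>A. countable A \<and> A \<subseteq> sets (distr lborel borel (reflection w)) \<and>
        \<Union>A = space (distr lborel borel (reflection w)) \<and>
        (\<forall>a\<in>A. emeasure (distr lborel borel (reflection w)) a \<noteq> \<infinity>)"
    proof (intro exI[of _ "range (\<lambda>n::nat. cball 0 (real n))"] conjI ballI)
      show "\<Union> (range (\<lambda>n::nat. cball 0 (real n))) = space (distr lborel borel (reflection w))"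
        using real_arch_simple by (fastforce simp: cball_def)
      fix a assume "a \<in> range (\<lambda>n::nat. cball (0::'a) (real n))"
      then show "emeasure (distr lborel borel (reflection w)) a \<noteq> \<infinity>"
        by (auto simp: emeasure_distr vimage emeasure_cball)
    qed auto
  qed
  fix a
  show "distr (distr lborel borel (reflection w)) borel (\<lambda>x. x + a) = distr lborel borel (reflection w)"
  proof -
    have "distr (distr lborel borel (reflection w)) borel (\<lambda>x. x + a)
        = distr lborel borel (\<lambda>x. reflection w x + a)"
      by (subst distr_distr) (auto simp: o_def)
    also have "(\<lambda>x. reflection w x + a) = (\<lambda>x. reflection w (x + reflection w a))"
      by (auto simp: linear_add[OF linear_reflection])
    also have "distr lborel borel (\<lambda>x. reflection w (x + reflection w a))
        = distr (distr lborel borel (\<lambda>x. x + reflection w a)) borel (reflection w)"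
      by (subst distr_distr) (auto simp: o_def)
    finally show ?thesis by (simp add: lborel_translate)
  qed
qed

section \<open>The ball as a limit of zonotopes\<close>

lemma integrable_abs_inner_cball:
  "integrable lborel (\<lambda>v::'a::euclidean_space. indicator (cball 0 1) v * \<bar>u \<bullet> v\<bar>)"
proof -
  have "integrable lborel (\<lambda>v::'a. indicator (cball 0 1) v *\<^sub>R \<bar>u \<bullet> v\<bar>)"
    by (rule borel_integrable_compact) (auto intro!: continuous_intros)
  then show ?thesis by simp
qed

text \<open>The left-hand side is invariant under reflections of \<open>u\<close>, because Lebesgue measure and the
  ball are; hence it depends on \<open>norm u\<close> only, and it is positively homogeneous. It is the support
  function of an integral of segments, so a multiple of the ball is a continuous sum of segments.\<close>

lemma ball_is_zonoid:
  obtains c where "c > 0"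
    "\<And>u::'a::euclidean_space. (LINT v|lborel. indicator (cball 0 1) v * \<bar>u \<bullet> v\<bar>) = c * norm u"
proof -
  define h where "h u = (LINT v|lborel. indicator (cball 0 1) v * \<bar>u \<bullet> v\<bar>)" for u :: 'a
  have meas [measurable]: "reflection w \<in> borel_measurable borel" for w :: 'a
    by (intro borel_measurable_continuous_onI linear_continuous_on linear_linear[THEN iffD2] linear_reflection)
  have refl: "h (reflection w u) = h u" for w u
  proof -
    have "h u = (LINT v|distr lborel borel (reflection w). indicator (cball 0 1) v * \<bar>u \<bullet> v\<bar>)"
      by (simp add: h_def lborel_reflection)
    also have "\<dots> = (LINT v|lborel. indicator (cball 0 1) (reflection w v) * \<bar>u \<bullet> reflection w v\<bar>)"
      by (rule integral_distr) (auto intro!: borel_measurable_times borel_measurable_indicator)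
    also have "\<dots> = h (reflection w u)"
      by (simp add: h_def inner_reflection indicator_def)
    finally show ?thesis by simp
  qed
  have same: "h u = h v" if "norm u = norm v" for u v
    using refl[of "u - v" u] reflection_swap[OF that] by simp
  obtain e :: 'a where e: "norm e = 1" using vector_choose_size[of 1] by auto
  have hom: "h (t *\<^sub>R u) = \<bar>t\<bar> * h u" for t u
  proof -
    have "(\<lambda>v. indicator (cball 0 1) v * \<bar>(t *\<^sub>R u) \<bullet> v\<bar>) = (\<lambda>v. \<bar>t\<bar> * (indicator (cball 0 1) v * \<bar>u \<bullet> v\<bar>))"
      by (auto simp: abs_mult)
    then show ?thesis by (simp add: h_def)
  qed
  have "h u = h e * norm u" for u
  proof -
    have "h u = h (norm u *\<^sub>R e)" by (rule same) (simp add: e)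
    then show ?thesis by (simp add: hom)
  qed
  moreover have "h e > 0"
  proof -
    have "h e \<ge> 0" unfolding h_def by (rule integral_nonneg_AE) auto
    moreover have "h e \<noteq> 0"
    proof
      assume "h e = 0"
      then have "AE v in lborel. indicator (cball 0 1) v * \<bar>e \<bullet> v\<bar> = 0"
        unfolding h_def using integral_nonneg_eq_0_iff_AE[OF integrable_abs_inner_cball[of e]] by auto
      \<comment> \<open>the ball with diameter from \<open>0\<close> to \<open>e\<close> lies in the unit ball and in the open half-space of positive inner product with \<open>e\<close>\<close>
      then have ae: "AE v in lborel. v \<notin> ball ((1/2) *\<^sub>R e) (1/2)"
      proof eventually_elim
        case (elim v)
        show ?case
        proof
          assume v: "v \<in> ball ((1/2) *\<^sub>R e) (1/2)"
          then have d: "norm (v - (1/2) *\<^sub>R e) < 1/2" by (simp add: dist_norm norm_minus_commute)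
          have "norm v \<le> norm (v - (1/2) *\<^sub>R e) + norm ((1/2) *\<^sub>R e)"
            by (metis diff_add_cancel norm_triangle_ineq)
          then have "norm v \<le> 1" using d e by simp
          then have "e \<bullet> v = 0" using elim by auto
          then have "e \<bullet> (v - (1/2) *\<^sub>R e) = - (1/2)"
            using e by (simp add: inner_diff_right power2_norm_eq_inner[symmetric])
          moreover have "\<bar>e \<bullet> (v - (1/2) *\<^sub>R e)\<bar> \<le> norm (v - (1/2) *\<^sub>R e)"
            using Cauchy_Schwarz_ineq2[of e] e by (metis mult_1)
          ultimately show False using d by simp
        qed
      qed
      have "emeasure lborel (ball ((1/2) *\<^sub>R e) (1/2) :: 'a set) = 0"
        using ae by (subst (asm) AE_iff_measurable[where N = "ball ((1/2) *\<^sub>R e) (1/2)"]) auto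
      moreover have "unit_ball_vol (real DIM('a)) * (1/2) ^ DIM('a) > 0"
        by (intro mult_pos_pos) auto
      ultimately show False
        by (simp add: emeasure_ball ennreal_eq_0_iff not_le)
    qed
    ultimately show ?thesis by simp
  qed
  ultimately show ?thesis using that unfolding h_def by blast
qed

text \<open>A Riemann sum for \<open>ball_is_zonoid\<close>: the ball is partitioned into small pieces, and each
  piece contributes one segment, weighted by the measure of the piece.\<close>

lemma abs_inner_finite_approx:
  fixes \<delta> :: real assumes "\<delta> > 0"
  obtains n :: nat and T :: "nat \<Rightarrow> 'a::euclidean_space"
  where "\<And>u. \<bar>(\<Sum>i<n. \<bar>u \<bullet> T i\<bar>) - norm u\<bar> \<le> \<delta> * norm u"
proof -
  obtain c where c: "c > 0"
    "\<And>u::'a. (LINT v|lborel. indicator (cball 0 1) v * \<bar>u \<bullet> v\<bar>) = c * norm u"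
    using ball_is_zonoid[where 'a='a] by blast
  let ?B = "cball (0::'a) 1"
  define V where "V = measure lborel ?B"
  have V: "V > 0" unfolding V_def by (simp add: content_cball unit_ball_vol_pos)
  define \<epsilon> where "\<epsilon> = \<delta> * c / V"
  have \<epsilon>: "\<epsilon> > 0" using assms c V by (simp add: \<epsilon>_def)
  have "?B \<subseteq> (\<Union>x\<in>?B. ball x \<epsilon>)" using \<epsilon> by auto
  then obtain F where F: "finite F" "F \<subseteq> ?B" "?B \<subseteq> (\<Union>x\<in>F. ball x \<epsilon>)"
    using compactE_image[OF compact_cball, of ?B "\<lambda>x. ball x \<epsilon>" 0 1] by (metis open_ball)
  obtain n :: nat and f where f: "F = f ` {..<n}"
    using F(1) by (metis finite_imp_nat_seg_image_inj_on lessThan_def)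
  define P where "P = disjointed (\<lambda>i. if i < n then ?B \<inter> ball (f i) \<epsilon> else {})"
  have dis: "disjoint_family P" unfolding P_def by (rule disjoint_family_disjointed)
  have Psub: "P i \<subseteq> ?B \<inter> ball (f i) \<epsilon>" if "i < n" for i
    using that disjointed_subset[of "\<lambda>i. if i < n then ?B \<inter> ball (f i) \<epsilon> else {}" i] by (simp add: P_def)
  have Pempty: "P i = {}" if "\<not> i < n" for i
    using that disjointed_subset[of "\<lambda>i. if i < n then ?B \<inter> ball (f i) \<epsilon> else {}" i] by (simp add: P_def)
  have "(\<Union>i. P i) = (\<Union>i. if i < n then ?B \<inter> ball (f i) \<epsilon> else {})"
    unfolding P_def by (rule UN_disjointed_eq)
  also have "\<dots> = ?B" using F(3) unfolding f by auto
  finally have PU: "(\<Union>i. P i) = ?B" .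
  have "range (\<lambda>i. if i < n then ?B \<inter> ball (f i) \<epsilon> else {}) \<subseteq> sets borel" by auto
  from sets.range_disjointed_sets'[OF this]
  have Pm [measurable]: "P i \<in> sets borel" for i
    unfolding P_def by (rule subsetD) (rule rangeI)
  define T where "T i = (measure lborel (P i) / c) *\<^sub>R f i" for i
  have Pfin: "emeasure lborel (P i) < \<infinity>" for i
  proof -
    have "P i \<subseteq> ?B" using PU by auto
    then have "emeasure lborel (P i) \<le> emeasure lborel ?B" by (intro emeasure_mono) auto
    also have "\<dots> < \<infinity>" by (simp add: emeasure_cball)
    finally show ?thesis .
  qed
  show ?thesis
  proof (rule that[of T n])
    fix u :: 'a
    let ?f = "\<lambda>v::'a. indicator ?B v * \<bar>u \<bullet> v\<bar>"
    let ?g = "\<lambda>v::'a. \<Sum>i<n. indicator (P i) v * \<bar>u \<bullet> f i\<bar>"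
    have gi: "integrable lborel (\<lambda>v::'a. indicator (P i) v * \<bar>u \<bullet> f i\<bar>)" for i
      using Pfin[of i] by (auto intro!: integrable_real_indicator)
    have gI: "integrable lborel ?g" by (rule Bochner_Integration.integrable_sum) (rule gi)
    note fI = integrable_abs_inner_cball[of u]
    have close: "\<bar>?g v - ?f v\<bar> \<le> \<epsilon> * norm u * indicator ?B v" for v
    proof (cases "v \<in> ?B")
      case False
      then have "v \<notin> P i" for i using PU by auto
      then show ?thesis using False by simp
    next
      case True
      then have "v \<in> (\<Union>i. P i)" by (simp only: PU)
      then obtain i where i: "v \<in> P i" by blast
      then have "i < n" using Pempty by blast
      have "indicator (P j) v = (if j = i then 1 else (0::real))" for j
        using i dis unfolding disjoint_family_on_def by (auto simp: indicator_def)
      then have "?g v = \<bar>u \<bullet> f i\<bar>" using \<open>i < n\<close> by (simp add: if_distrib[of "\<lambda>x. x * _"] cong: if_cong)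
      then have "\<bar>?g v - ?f v\<bar> = \<bar>\<bar>u \<bullet> f i\<bar> - \<bar>u \<bullet> v\<bar>\<bar>" using True by simp
      also have "\<dots> \<le> \<bar>u \<bullet> f i - u \<bullet> v\<bar>" by (rule abs_triangle_ineq3)
      also have "\<dots> = \<bar>u \<bullet> (f i - v)\<bar>" by (simp add: inner_diff_right)
      also have "\<dots> \<le> norm u * norm (f i - v)" by (rule Cauchy_Schwarz_ineq2)
      also have "\<dots> \<le> norm u * \<epsilon>"
        using Psub[OF \<open>i < n\<close>] i by (intro mult_left_mono) (auto simp: dist_norm)
      finally show ?thesis using True by (simp add: mult.commute)
    qed
    have Bi: "integrable lborel (\<lambda>v::'a. \<epsilon> * norm u * indicator ?B v)"
      by (intro integrable_mult_right integrable_real_indicator) (auto simp: emeasure_cball)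
    have "(LINT v|lborel. ?g v) = (\<Sum>i<n. measure lborel (P i) * \<bar>u \<bullet> f i\<bar>)"
      using gi by (subst Bochner_Integration.integral_sum) auto
    also have "\<dots> = c * (\<Sum>i<n. \<bar>u \<bullet> T i\<bar>)"
      using c(1) by (simp add: T_def sum_distrib_left abs_mult)
    finally have "\<bar>c * (\<Sum>i<n. \<bar>u \<bullet> T i\<bar>) - c * norm u\<bar> = \<bar>(LINT v|lborel. ?g v) - (LINT v|lborel. ?f v)\<bar>"
      by (simp add: c(2))
    also have "\<dots> = \<bar>LINT v|lborel. ?g v - ?f v\<bar>"
      by (simp only: Bochner_Integration.integral_diff[OF gI fI])
    also have "\<dots> \<le> (LINT v|lborel. \<bar>?g v - ?f v\<bar>)"
      by (rule integral_abs_bound)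
    also have "\<dots> \<le> (LINT v|lborel. \<epsilon> * norm u * indicator ?B v)"
      by (rule integral_mono[OF integrable_abs[OF Bochner_Integration.integrable_diff[OF gI fI]] Bi close])
    also have "\<dots> = c * (\<delta> * norm u)"
      using V by (simp add: V_def[symmetric] \<epsilon>_def)
    finally have "c * \<bar>(\<Sum>i<n. \<bar>u \<bullet> T i\<bar>) - norm u\<bar> \<le> c * (\<delta> * norm u)"
      using c(1) by (simp add: abs_mult right_diff_distrib[symmetric])
    then show "\<bar>(\<Sum>i<n. \<bar>u \<bullet> T i\<bar>) - norm u\<bar> \<le> \<delta> * norm u"
      using c(1) by simp
  qed
qed


section \<open>Volumes of sums of a convex body and a segment\<close>

text \<open>The sum of \<open>A\<close> and the segment from \<open>0\<close> to \<open>t *\<^sub>R s\<close>. The volume is computed for this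
  one-sided version; its symmetric counterpart \<open>sweep\<close> is a translate of it.\<close>

definition ray_sweep :: "'a::euclidean_space set \<Rightarrow> 'a \<Rightarrow> real \<Rightarrow> 'a set" where
  "ray_sweep A s t = {x + c *\<^sub>R s | x c. x \<in> A \<and> 0 \<le> c \<and> c \<le> t}"

definition sweep :: "'a::euclidean_space set \<Rightarrow> 'a \<Rightarrow> real \<Rightarrow> 'a set" where
  "sweep A s t = {x + c *\<^sub>R s | x c. x \<in> A \<and> \<bar>c\<bar> \<le> t}"

lemma ray_sweep_sums: "ray_sweep A s t = {x + y | x y. x \<in> A \<and> y \<in> (\<lambda>c. c *\<^sub>R s) ` {0..t}}"
  unfolding ray_sweep_def by force

lemma ray_sweep_compact: "compact A \<Longrightarrow> compact (ray_sweep A s t)"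
  unfolding ray_sweep_sums
  by (intro compact_sums compact_continuous_image continuous_intros) auto

lemma ray_sweep_convex: assumes "convex A" shows "convex (ray_sweep A s t)"
proof -
  have "convex ((\<lambda>c. c *\<^sub>R s) ` {0..t})"
    by (intro convex_linear_image linearI) (auto simp: algebra_simps)
  from convex_sums[OF assms this] show ?thesis
    unfolding ray_sweep_sums by (rule back_subst[where P=convex]) auto
qed

lemma sweep_eq_ray_sweep: "sweep A s t = (+) (- t *\<^sub>R s) ` ray_sweep A s (2 * t)"
proof (intro set_eqI iffI)
  fix y assume "y \<in> sweep A s t"
  then obtain x c where "x \<in> A" "\<bar>c\<bar> \<le> t" "y = x + c *\<^sub>R s" unfolding sweep_def by blast
  then have "x + (c + t) *\<^sub>R s \<in> ray_sweep A s (2 * t)" "y = - t *\<^sub>R s + (x + (c + t) *\<^sub>R s)"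
    unfolding ray_sweep_def by (auto simp: algebra_simps) (rule exI[of _ x], rule exI[of _ "c + t"], auto simp: algebra_simps)
  then show "y \<in> (+) (- t *\<^sub>R s) ` ray_sweep A s (2 * t)" by blast
next
  fix y assume "y \<in> (+) (- t *\<^sub>R s) ` ray_sweep A s (2 * t)"
  then obtain x c where "x \<in> A" "0 \<le> c" "c \<le> 2 * t" "y = x + (c - t) *\<^sub>R s"
    unfolding ray_sweep_def by (auto simp: algebra_simps)
  moreover have "\<bar>c - t\<bar> \<le> t" using calculation by linarith
  ultimately show "y \<in> sweep A s t" unfolding sweep_def by blast
qed

lemma sweep_compact: "compact A \<Longrightarrow> compact (sweep A s t)"
  unfolding sweep_eq_ray_sweep by (intro compact_translation ray_sweep_compact)

lemma sweep_convex: "convex A \<Longrightarrow> convex (sweep A s t)"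
  unfolding sweep_eq_ray_sweep by (intro convex_translation ray_sweep_convex)

text \<open>On every line parallel to \<open>s\<close> a convex set is a segment, and sweeping prolongs it at one
  end. The part that is added by sweeping further is thus the part added at the beginning, moved
  along \<open>s\<close>. This makes the volume growth independent of the time already elapsed, without any
  integration over projections.\<close>

lemma ray_sweep_Diff:
  assumes A: "convex A" and "0 \<le> t" "0 \<le> h"
  shows "ray_sweep A s (t + h) - ray_sweep A s t = (+) (t *\<^sub>R s) ` (ray_sweep A s h - A)"
proof (intro set_eqI iffI)
  fix p assume p: "p \<in> ray_sweep A s (t + h) - ray_sweep A s t"
  then obtain a c where a: "a \<in> A" "0 \<le> c" "c \<le> t + h" "p = a + c *\<^sub>R s" unfolding ray_sweep_def by blast
  have "c > t"
    using p a unfolding ray_sweep_def by (metis (mono_tags, lifting) DiffD2 mem_Collect_eq not_le)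
  have "p = t *\<^sub>R s + (a + (c - t) *\<^sub>R s)" using a by (simp add: algebra_simps)
  moreover have "a + (c - t) *\<^sub>R s \<in> ray_sweep A s h"
    unfolding ray_sweep_def using a \<open>c > t\<close> by (auto intro!: exI[of _ a] exI[of _ "c - t"])
  moreover have "a + (c - t) *\<^sub>R s \<notin> A"
  proof
    assume "a + (c - t) *\<^sub>R s \<in> A"
    then have "(a + (c - t) *\<^sub>R s) + t *\<^sub>R s \<in> ray_sweep A s t"
      unfolding ray_sweep_def using assms by blast
    then show False using p a by (simp add: algebra_simps)
  qed
  ultimately show "p \<in> (+) (t *\<^sub>R s) ` (ray_sweep A s h - A)" by blast
next
  fix p assume "p \<in> (+) (t *\<^sub>R s) ` (ray_sweep A s h - A)"
  then obtain q where q: "p = t *\<^sub>R s + q" "q \<in> ray_sweep A s h" "q \<notin> A" by blast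
  then obtain a c where a: "a \<in> A" "0 \<le> c" "c \<le> h" "q = a + c *\<^sub>R s" unfolding ray_sweep_def by blast
  have "p = a + (c + t) *\<^sub>R s" using q a by (simp add: algebra_simps)
  then have "p \<in> ray_sweep A s (t + h)" unfolding ray_sweep_def using a assms
    by (auto intro!: exI[of _ a] exI[of _ "c + t"])
  moreover have "p \<notin> ray_sweep A s t"
  proof
    assume "p \<in> ray_sweep A s t"
    then obtain b e where b: "b \<in> A" "0 \<le> e" "e \<le> t" "p = b + e *\<^sub>R s" unfolding ray_sweep_def by blast
    have "c \<noteq> 0" using q a by auto
    \<comment> \<open>\<open>q\<close> lies between \<open>a\<close> and \<open>b\<close> on a line parallel to \<open>s\<close>, at the parameter \<open>\<theta>\<close>\<close>
    define \<theta> where "\<theta> = c / (c + (t - e))"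
    have pos: "c + (t - e) > 0" using a b \<open>c \<noteq> 0\<close> by linarith
    have \<theta>: "0 \<le> \<theta>" "\<theta> \<le> 1" using a b pos by (auto simp: \<theta>_def)
    have ba: "b = a + (c + (t - e)) *\<^sub>R s" using q a b by (simp add: algebra_simps)
    have "(1 - \<theta>) *\<^sub>R a + \<theta> *\<^sub>R b = a + (\<theta> * (c + (t - e))) *\<^sub>R s"
      unfolding ba by (simp add: algebra_simps)
    also have "\<theta> * (c + (t - e)) = c" using pos by (simp add: \<theta>_def)
    finally have "(1 - \<theta>) *\<^sub>R a + \<theta> *\<^sub>R b = q" using a by simp
    moreover have "(1 - \<theta>) *\<^sub>R a + \<theta> *\<^sub>R b \<in> A"
      using A a b \<theta> by (intro convexD) auto
    ultimately show False using q by simp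
  qed
  ultimately show "p \<in> ray_sweep A s (t + h) - ray_sweep A s t" by blast
qed

text \<open>Cauchy's functional equation: nonnegativity makes \<open>g\<close> monotone, so that the values at
  \<open>n * t\<close> are enclosed by those at neighbouring integers, with an error that is bounded in \<open>n\<close>.\<close>

lemma additive_nonneg_imp_linear:
  fixes g :: "real \<Rightarrow> real"
  assumes add: "\<And>s t. 0 \<le> s \<Longrightarrow> 0 \<le> t \<Longrightarrow> g (s + t) = g s + g t"
    and nonneg: "\<And>t. 0 \<le> t \<Longrightarrow> 0 \<le> g t" and "0 \<le> t"
  shows "g t = t * g 1"
proof -
  have mono: "g s \<le> g t" if "0 \<le> s" "s \<le> t" for s t
    using add[of s "t - s"] nonneg[of "t - s"] that by simp
  have mult: "g (real n * t) = real n * g t" if "0 \<le> t" for n t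
  proof (induction n)
    case 0
    then show ?case using add[of 0 0] by simp
  next
    case (Suc n)
    then show ?case using add[of "real n * t" t] that by (simp add: algebra_simps)
  qed
  have bound: "real n * \<bar>g t - t * g 1\<bar> \<le> g 1" for n
  proof -
    define k where "k = nat \<lfloor>real n * t\<rfloor>"
    have k: "real k \<le> real n * t" "real n * t \<le> real (Suc k)"
      using \<open>0 \<le> t\<close> by (auto simp: k_def) linarith
    have "g (real k) \<le> g (real n * t)" "g (real n * t) \<le> g (real (Suc k))"
      using k \<open>0 \<le> t\<close> by (auto intro!: mono)
    then have 1: "real k * g 1 \<le> real n * g t" "real n * g t \<le> (real k + 1) * g 1"
      using mult[of 1 k] mult[of 1 "Suc k"] mult[of t n] \<open>0 \<le> t\<close> by (simp_all add: algebra_simps)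
    have 2: "real k * g 1 \<le> (real n * t) * g 1" "(real n * t) * g 1 \<le> (real k + 1) * g 1"
      using k nonneg[of 1] by (auto intro!: mult_right_mono)
    have "\<bar>real n * g t - (real n * t) * g 1\<bar> \<le> g 1"
      using 1 2 by (simp add: algebra_simps abs_le_iff)
    then show ?thesis by (metis abs_mult abs_of_nat mult.assoc right_diff_distrib')
  qed
  show ?thesis
  proof (rule ccontr)
    assume "g t \<noteq> t * g 1"
    then have "\<bar>g t - t * g 1\<bar> > 0" by simp
    then obtain n where "real n * \<bar>g t - t * g 1\<bar> > g 1"
      using reals_Archimedean3 by blast
    then show False using bound[of n] by simp
  qed
qed

lemma ray_sweep_0 [simp]: "ray_sweep A s 0 = A"
  unfolding ray_sweep_def by (auto intro!: exI[of _ "0::real"])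

lemma ray_sweep_mono: "t \<le> t' \<Longrightarrow> ray_sweep A s t \<subseteq> ray_sweep A s t'"
  unfolding ray_sweep_def by force

lemma measure_ray_sweep:
  assumes A: "compact A" "convex A" and t: "0 \<le> t"
  shows "measure lebesgue (ray_sweep A s t) =
    measure lebesgue A + t * (measure lebesgue (ray_sweep A s 1) - measure lebesgue A)"
proof -
  define g where "g t = measure lebesgue (ray_sweep A s t) - measure lebesgue A" for t
  have lm: "ray_sweep A s t \<in> lmeasurable" for t
    by (intro lmeasurable_compact ray_sweep_compact A)
  have step: "measure lebesgue (ray_sweep A s (t + h)) - measure lebesgue (ray_sweep A s t)
      = measure lebesgue (ray_sweep A s h - A)" if "0 \<le> t" "0 \<le> h" for t h
  proof -
    have "measure lebesgue (ray_sweep A s (t + h)) - measure lebesgue (ray_sweep A s t)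
        = measure lebesgue (ray_sweep A s (t + h) - ray_sweep A s t)"
      by (rule measurable_measure_Diff[symmetric]) (use lm ray_sweep_mono[of t "t + h"] that in \<open>auto dest: fmeasurableD\<close>)
    then show ?thesis by (simp add: ray_sweep_Diff[OF A(2) that] measure_translation)
  qed
  have g: "g h = measure lebesgue (ray_sweep A s h - A)" if "0 \<le> h" for h
    using step[of 0 h] that by (simp add: g_def)
  have "g t = t * g 1"
  proof (rule additive_nonneg_imp_linear[OF _ _ t])
    show "g (s + t) = g s + g t" if "0 \<le> s" "0 \<le> t" for s t
      using step[OF that] g[OF that(2)] by (simp add: g_def)
    show "0 \<le> g t" if "0 \<le> t" for t using g[OF that] by simp
  qed
  then show ?thesis by (simp add: g_def)
qed

lemma measure_sweep:
  assumes A: "compact A" "convex A" and t: "0 \<le> t"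
  shows "measure lebesgue (sweep A s t) =
    measure lebesgue A + t * (measure lebesgue (sweep A s 1) - measure lebesgue A)"
proof -
  have "measure lebesgue (sweep A s t) = measure lebesgue (ray_sweep A s (2 * t))" for t
    by (simp only: sweep_eq_ray_sweep measure_translation)
  moreover have "measure lebesgue (ray_sweep A s 2) = measure lebesgue A
      + 2 * (measure lebesgue (ray_sweep A s 1) - measure lebesgue A)"
    by (rule measure_ray_sweep[OF A]) simp
  then have "2 * (measure lebesgue (ray_sweep A s 1) - measure lebesgue A)
      = measure lebesgue (ray_sweep A s (2 * 1)) - measure lebesgue A" by simp
  moreover have "measure lebesgue (ray_sweep A s (2 * t)) = measure lebesgue A
      + t * (2 * (measure lebesgue (ray_sweep A s 1) - measure lebesgue A))"
    using measure_ray_sweep[OF A, of "2 * t" s] t by simp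
  ultimately show ?thesis by (simp only:)
qed

text \<open>The sum of \<open>K\<close> and \<open>r\<close> times the zonotope generated by the centred segments from \<open>- T i\<close> to
  \<open>T i\<close>.\<close>

definition zonotope_sum :: "'a::euclidean_space set \<Rightarrow> nat \<Rightarrow> (nat \<Rightarrow> 'a) \<Rightarrow> real \<Rightarrow> 'a set" where
  "zonotope_sum K n T r = {a + (\<Sum>i<n. c i *\<^sub>R T i) | a c. a \<in> K \<and> (\<forall>i<n. \<bar>c i\<bar> \<le> r)}"

lemma zonotope_sum_0 [simp]: "zonotope_sum K 0 T r = K"
  unfolding zonotope_sum_def by auto

lemma zonotope_sum_Suc: "zonotope_sum K (Suc n) T r = sweep (zonotope_sum K n T r) (T n) r"
proof (intro set_eqI iffI)
  fix y assume "y \<in> zonotope_sum K (Suc n) T r"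
  then obtain a c where a: "a \<in> K" "\<forall>i<Suc n. \<bar>c i\<bar> \<le> r" "y = a + (\<Sum>i<Suc n. c i *\<^sub>R T i)"
    unfolding zonotope_sum_def by blast
  then have "y = (a + (\<Sum>i<n. c i *\<^sub>R T i)) + c n *\<^sub>R T n" "\<bar>c n\<bar> \<le> r"
    "a + (\<Sum>i<n. c i *\<^sub>R T i) \<in> zonotope_sum K n T r"
    unfolding zonotope_sum_def by (auto simp: add.assoc intro!: exI[of _ a] exI[of _ c])
  then show "y \<in> sweep (zonotope_sum K n T r) (T n) r" unfolding sweep_def by blast
next
  fix y assume "y \<in> sweep (zonotope_sum K n T r) (T n) r"
  then obtain a c e where a: "a \<in> K" "\<forall>i<n. \<bar>c i\<bar> \<le> r" "\<bar>e\<bar> \<le> r"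
    "y = (a + (\<Sum>i<n. c i *\<^sub>R T i)) + e *\<^sub>R T n"
    unfolding zonotope_sum_def sweep_def by blast
  have "y = a + (\<Sum>i<Suc n. (c(n := e)) i *\<^sub>R T i)" using a by (simp add: add.assoc)
  moreover have "\<forall>i<Suc n. \<bar>(c(n := e)) i\<bar> \<le> r" using a by (auto simp: less_Suc_eq)
  ultimately show "y \<in> zonotope_sum K (Suc n) T r" unfolding zonotope_sum_def using a by blast
qed

lemma sweep_zonotope_sum: "sweep (zonotope_sum K n T r) s t = zonotope_sum (sweep K s t) n T r"
proof (intro set_eqI iffI)
  fix y assume "y \<in> sweep (zonotope_sum K n T r) s t"
  then obtain a c e where "a \<in> K" "\<forall>i<n. \<bar>c i\<bar> \<le> r" "\<bar>e\<bar> \<le> t"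
    "y = (a + (\<Sum>i<n. c i *\<^sub>R T i)) + e *\<^sub>R s"
    unfolding zonotope_sum_def sweep_def by blast
  then have "y = (a + e *\<^sub>R s) + (\<Sum>i<n. c i *\<^sub>R T i)" "a + e *\<^sub>R s \<in> sweep K s t" "\<forall>i<n. \<bar>c i\<bar> \<le> r"
    unfolding sweep_def by (auto simp: algebra_simps)
  then show "y \<in> zonotope_sum (sweep K s t) n T r" unfolding zonotope_sum_def by blast
next
  fix y assume "y \<in> zonotope_sum (sweep K s t) n T r"
  then obtain a c e where "a \<in> K" "\<forall>i<n. \<bar>c i\<bar> \<le> r" "\<bar>e\<bar> \<le> t"
    "y = (a + e *\<^sub>R s) + (\<Sum>i<n. c i *\<^sub>R T i)"
    unfolding zonotope_sum_def sweep_def by blast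
  then have "y = (a + (\<Sum>i<n. c i *\<^sub>R T i)) + e *\<^sub>R s" "\<bar>e\<bar> \<le> t"
    "a + (\<Sum>i<n. c i *\<^sub>R T i) \<in> zonotope_sum K n T r"
    unfolding zonotope_sum_def by (auto simp: algebra_simps)
  then show "y \<in> sweep (zonotope_sum K n T r) s t" unfolding sweep_def by blast
qed

lemma zonotope_sum_compact: "compact K \<Longrightarrow> compact (zonotope_sum K n T r)"
  by (induction n) (auto simp: zonotope_sum_Suc intro: sweep_compact)

lemma zonotope_sum_convex: "convex K \<Longrightarrow> convex (zonotope_sum K n T r)"
  by (induction n) (auto simp: zonotope_sum_Suc intro: sweep_convex)

text \<open>The last segment enters affinely, with slope equal to a difference of two volumes of the
  same form but with fewer segments. The second of them has a different body, so that the
  induction has to run over all bodies.\<close>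

lemma measure_zonotope_sum_poly:
  assumes "compact K" "convex K"
  shows "\<exists>p. \<forall>r\<ge>0. measure lebesgue (zonotope_sum K n T r) = poly p r"
  using assms
proof (induction n arbitrary: K)
  case 0
  then show ?case by (intro exI[of _ "[:measure lebesgue K:]"]) simp
next
  case (Suc n)
  obtain p where p: "\<forall>r\<ge>0. measure lebesgue (zonotope_sum K n T r) = poly p r"
    using Suc by blast
  obtain q where q: "\<forall>r\<ge>0. measure lebesgue (zonotope_sum (sweep K (T n) 1) n T r) = poly q r"
    using Suc.IH[of "sweep K (T n) 1"] Suc.prems sweep_compact sweep_convex by blast
  have "measure lebesgue (zonotope_sum K (Suc n) T r) = poly (p + [:0, 1:] * (q - p)) r" if "r \<ge> 0" for r
    unfolding zonotope_sum_Suc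
    by (subst measure_sweep)
      (use Suc.prems that p q in \<open>auto intro: zonotope_sum_compact zonotope_sum_convex simp: sweep_zonotope_sum\<close>)
  then show ?case by blast
qed

text \<open>The support function of the zonotope at \<open>u\<close> is the sum of the values \<open>\<bar>u \<bullet> T i\<bar>\<close>, which is
  close to \<open>norm u\<close> by \<open>abs_inner_finite_approx\<close>. A lower bound of the support function gives an
  inscribed ball by separation, and an upper bound a circumscribed one.\<close>

lemma zonotope_approximates_ball:
  fixes \<delta> :: real assumes "\<delta> > 0"
  obtains n and T :: "nat \<Rightarrow> 'a::euclidean_space"
  where "cball 0 (1 - \<delta>) \<subseteq> zonotope_sum {0} n T 1" "zonotope_sum {0} n T 1 \<subseteq> cball 0 (1 + \<delta>)"
proof -
  obtain n and T :: "nat \<Rightarrow> 'a" where T: "\<And>u. \<bar>(\<Sum>i<n. \<bar>u \<bullet> T i\<bar>) - norm u\<bar> \<le> \<delta> * norm u"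
    using abs_inner_finite_approx[OF assms, where 'a='a] by metis
  show ?thesis
  proof (rule that[of n T])
    show "cball 0 (1 - \<delta>) \<subseteq> zonotope_sum {0} n T 1"
    proof (rule ccontr)
      assume "\<not> ?thesis"
      then obtain x where "x \<in> cball 0 (1 - \<delta>)" and x: "x \<notin> zonotope_sum {0} n T 1" by blast
      then have nx: "norm x \<le> 1 - \<delta>" by simp
      obtain a b where ab: "a \<bullet> x < b" "\<forall>z\<in>zonotope_sum {0} n T 1. a \<bullet> z > b"
        using separating_hyperplane_closed_point[of "zonotope_sum {0} n T 1" x]
          zonotope_sum_convex[of "{0}" n T 1] zonotope_sum_compact[of "{0}" n T 1] x compact_imp_closed
        by (metis compact_sing convex_singleton)
      let ?z = "\<Sum>i<n. (- sgn (a \<bullet> T i)) *\<^sub>R T i"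
      have "0 + ?z \<in> zonotope_sum {0} n T 1"
        unfolding zonotope_sum_def by (rule CollectI, rule exI[of _ 0], rule exI[of _ "\<lambda>i. - sgn (a \<bullet> T i)"])
          (auto simp: abs_sgn_eq)
      then have "a \<bullet> x < a \<bullet> ?z" using ab by fastforce
      also have "a \<bullet> ?z = - (\<Sum>i<n. \<bar>a \<bullet> T i\<bar>)"
        by (simp add: inner_sum_right abs_sgn mult.commute sum_negf)
      also have "\<dots> \<le> - ((1 - \<delta>) * norm a)"
        using T[of a] by (simp add: algebra_simps abs_le_iff)
      also have "\<dots> \<le> - (norm x * norm a)" using nx by (simp add: mult_right_mono)
      also have "\<dots> \<le> a \<bullet> x" using Cauchy_Schwarz_ineq2[of a x] by (simp add: mult.commute abs_le_iff)
      finally show False by simp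
    qed
    show "zonotope_sum {0} n T 1 \<subseteq> cball 0 (1 + \<delta>)"
    proof
      fix z assume "z \<in> zonotope_sum {0} n T 1"
      then obtain c where c: "\<forall>i<n. \<bar>c i\<bar> \<le> 1" "z = (\<Sum>i<n. c i *\<^sub>R T i)"
        unfolding zonotope_sum_def by auto
      have "z \<bullet> z = (\<Sum>i<n. c i * (z \<bullet> T i))" by (subst (2) c) (simp add: inner_sum_right)
      also have "\<dots> \<le> (\<Sum>i<n. \<bar>z \<bullet> T i\<bar>)"
      proof (rule sum_mono)
        fix i assume "i \<in> {..<n}"
        then have "\<bar>c i * (z \<bullet> T i)\<bar> \<le> 1 * \<bar>z \<bullet> T i\<bar>"
          unfolding abs_mult using c by (intro mult_right_mono) auto
        then show "c i * (z \<bullet> T i) \<le> \<bar>z \<bullet> T i\<bar>" by linarith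
      qed
      also have "\<dots> \<le> (1 + \<delta>) * norm z" using T[of z] by (simp add: algebra_simps abs_le_iff)
      finally have "norm z * norm z \<le> (1 + \<delta>) * norm z" by (simp add: norm_eq_sqrt_inner)
      then show "z \<in> cball 0 (1 + \<delta>)" by (cases "z = 0") (use assms in auto)
    qed
  qed
qed


section \<open>Limits of polynomials of bounded degree\<close>

definition lagrange_basis :: "nat \<Rightarrow> nat \<Rightarrow> real poly" where
  "lagrange_basis d j = (\<Prod>i\<in>{..d} - {j}. smult (1 / (real j - real i)) [:- real i, 1:])"

lemma poly_lagrange_basis:
  assumes "j \<le> d" "k \<le> d"
  shows "poly (lagrange_basis d j) (real k) = (if k = j then 1 else 0)"
proof (cases "k = j")
  case True
  then show ?thesis
    by (auto simp: lagrange_basis_def poly_prod diff_divide_distrib[symmetric] intro!: prod.neutral)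
next
  case False
  then have "k \<in> {..d} - {j}" using assms by auto
  then show ?thesis using False
    by (auto simp: lagrange_basis_def poly_prod intro!: bexI[of _ k])
qed

lemma degree_lagrange_basis: assumes "j \<le> d" shows "degree (lagrange_basis d j) \<le> d"
proof -
  have "degree (lagrange_basis d j) \<le> (\<Sum>i\<in>{..d} - {j}. degree (smult (1 / (real j - real i)) [:- real i, 1:]))"
    unfolding lagrange_basis_def by (rule order_trans[OF degree_prod_sum_le]) (simp_all add: o_def)
  also have "\<dots> \<le> (\<Sum>i\<in>{..d} - {j}. 1)"
    by (rule sum_mono) (auto intro: order_trans[OF degree_smult_le])
  also have "\<dots> = d" using assms by (simp add: card_Diff_singleton)
  finally show ?thesis .
qed

lemma lagrange_interpolation:
  assumes "degree p \<le> d"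
  shows "p = (\<Sum>j\<le>d. smult (poly p (real j)) (lagrange_basis d j))" (is "p = ?q")
proof (rule poly_eqI_degree[where A = "real ` {..d}"])
  have card: "card (real ` {..d}) = Suc d" by (simp add: card_image inj_on_def)
  have "degree ?q \<le> d"
    by (rule degree_sum_le) (auto intro: order_trans[OF degree_smult_le] degree_lagrange_basis)
  then show "degree p < card (real ` {..d})" "degree ?q < card (real ` {..d})"
    using card assms by linarith+
  fix x assume "x \<in> real ` {..d}"
  then obtain k where k: "x = real k" "k \<le> d" by auto
  then show "poly p x = poly ?q x"
    by (simp add: poly_sum poly_lagrange_basis if_distrib[of "\<lambda>x. _ * x"] cong: if_cong)
qed

text \<open>A polynomial of degree at most \<open>d\<close> is given by its values at \<open>0, \<dots>, d\<close> through Lagrange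
  interpolation, and this formula passes to the limit.\<close>

lemma limit_of_polynomials:
  fixes f :: "real \<Rightarrow> real"
  assumes deg: "\<And>n::nat. degree (p n) \<le> d"
    and lim: "\<And>r. 0 \<le> r \<Longrightarrow> (\<lambda>n. poly (p n) r) \<longlonglongrightarrow> f r"
  obtains q where "degree q \<le> d" "\<And>r. 0 \<le> r \<Longrightarrow> f r = poly q r"
proof
  let ?q = "\<Sum>j\<le>d. smult (f (real j)) (lagrange_basis d j)"
  show "degree ?q \<le> d"
    by (rule degree_sum_le) (auto intro: order_trans[OF degree_smult_le] degree_lagrange_basis)
  fix r :: real assume r: "0 \<le> r"
  have eq: "poly (p n) r = (\<Sum>j\<le>d. poly (p n) (real j) * poly (lagrange_basis d j) r)" for n
    by (subst lagrange_interpolation[OF deg[of n]]) (simp add: poly_sum)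
  have "(\<lambda>n. poly (p n) r) \<longlonglongrightarrow> poly ?q r"
    unfolding eq poly_sum poly_smult by (intro tendsto_intros lim) simp
  then show "f r = poly ?q r" using LIMSEQ_unique lim[OF r] by blast
qed

text \<open>The polynomial is compared at infinity with the polynomial on the right-hand side, which has
  degree at most \<open>d\<close> and coefficient \<open>C\<close> there.\<close>

lemma poly_growth:
  fixes p :: "real poly"
  assumes "\<And>r. 0 \<le> r \<Longrightarrow> \<bar>poly p r\<bar> \<le> C * (R + r) ^ d"
  shows "degree p \<le> d" "coeff p d \<le> C"
proof -
  define q where "q = smult C ([:R, 1:] ^ d)"
  have q: "poly q r = C * (R + r) ^ d" for r by (simp add: q_def poly_power)
  have dq: "degree q \<le> d"
    unfolding q_def by (rule order_trans[OF degree_smult_le]) (simp add: degree_power_eq)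
  have lim: "((\<lambda>x. poly s x / x ^ k) \<longlongrightarrow> coeff s k) at_top" if "degree s \<le> k" for s :: "real poly" and k
  proof (cases "degree s = k")
    case True
    then show ?thesis using poly_divide_tendsto_aux[of s] at_top_le_at_infinity tendsto_mono by blast
  next
    case False
    then have "degree s < degree (monom (1::real) k)" using that by (simp add: degree_monom_eq)
    from poly_divide_tendsto_0_at_infinity[OF this]
    have "((\<lambda>x. poly s x / x ^ k) \<longlongrightarrow> 0) at_infinity" by (simp add: poly_monom)
    moreover have "coeff s k = 0" using False that by (simp add: coeff_eq_0)
    ultimately show ?thesis using at_top_le_at_infinity tendsto_mono by metis
  qed
  have le: "\<forall>\<^sub>F x in at_top. \<bar>poly p x / x ^ k\<bar> \<le> poly q x / x ^ k" for k
    using eventually_gt_at_top[of 0]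
  proof eventually_elim
    case (elim x)
    then have "\<bar>poly p x\<bar> \<le> poly q x" using assms[of x] by (simp add: q)
    then show ?case using elim by (simp add: abs_divide divide_right_mono)
  qed
  show deg: "degree p \<le> d"
  proof (rule ccontr)
    assume *: "\<not> ?thesis"
    let ?k = "degree p"
    have "((\<lambda>x. poly p x / x ^ ?k) \<longlongrightarrow> coeff p ?k) at_top" by (rule lim) simp
    then have "((\<lambda>x. \<bar>poly p x / x ^ ?k\<bar>) \<longlongrightarrow> \<bar>coeff p ?k\<bar>) at_top" by (rule tendsto_rabs)
    moreover have "((\<lambda>x. poly q x / x ^ ?k) \<longlongrightarrow> coeff q ?k) at_top" by (rule lim) (use * dq in simp)
    ultimately have "\<bar>coeff p ?k\<bar> \<le> coeff q ?k"
      using le by (intro tendsto_le[OF trivial_limit_at_top_linorder]) auto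
    moreover have "coeff q ?k = 0" using * dq by (intro coeff_eq_0) simp
    ultimately have "coeff p ?k = 0" by simp
    then have "p = 0" by simp
    then show False using * by simp
  qed
  have "coeff p d \<le> coeff q d"
  proof (rule tendsto_le[OF trivial_limit_at_top_linorder lim[OF dq] lim[OF deg]])
    show "\<forall>\<^sub>F x in at_top. poly p x / x ^ d \<le> poly q x / x ^ d"
      using le[of d] by eventually_elim (rule order_trans[OF abs_ge_self])
  qed
  also have "coeff q d = C"
    using lead_coeff_power[of "[:R, 1:]" d] by (simp add: q_def degree_power_eq)
  finally show "coeff p d \<le> C" .
qed

section \<open>Steiner's formula\<close>

definition parallel_body :: "'a::euclidean_space set \<Rightarrow> real \<Rightarrow> 'a set" where
  "parallel_body K r = (\<Union>x\<in>K. cball x r)"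

lemma parallel_body_sums: "parallel_body K r = {x + y | x y. x \<in> K \<and> y \<in> cball 0 r}"
proof (intro set_eqI iffI)
  fix z assume "z \<in> parallel_body K r"
  then obtain x where "x \<in> K" "dist x z \<le> r" unfolding parallel_body_def by auto
  then have "x \<in> K \<and> z - x \<in> cball 0 r \<and> z = x + (z - x)" by (simp add: dist_norm norm_minus_commute)
  then show "z \<in> {x + y | x y. x \<in> K \<and> y \<in> cball 0 r}" by blast
next
  fix z assume "z \<in> {x + y | x y. x \<in> K \<and> y \<in> cball 0 r}"
  then obtain x y where "x \<in> K" "norm y \<le> r" "z = x + y" by auto
  then show "z \<in> parallel_body K r" unfolding parallel_body_def by (auto simp: dist_norm intro!: bexI[of _ x])
qed

lemma parallel_body_compact: "compact K \<Longrightarrow> compact (parallel_body K r)"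
  unfolding parallel_body_sums by (intro compact_sums) auto

text \<open>Dilation by \<open>l\<close> about a point of \<open>K\<close> maps the parallel body onto a set that contains the
  larger one. This gives continuity in the radius with explicit constants.\<close>

lemma measure_parallel_body_scale:
  fixes K :: "'a::euclidean_space set"
  assumes K: "compact K" "convex K" "K \<noteq> {}" and "0 \<le> t" "1 \<le> l"
  shows "measure lebesgue (parallel_body K (l * t)) \<le> l ^ DIM('a) * measure lebesgue (parallel_body K t)"
proof -
  obtain a where a: "a \<in> K" using K by auto
  have "parallel_body K (l * t) \<subseteq> (\<lambda>x. l *\<^sub>R x + (1 - l) *\<^sub>R a) ` parallel_body K t"
  proof
    fix y assume "y \<in> parallel_body K (l * t)"
    then obtain k b where kb: "k \<in> K" "norm b \<le> l * t" "y = k + b" unfolding parallel_body_sums by auto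
    define x where "x = ((1 / l) *\<^sub>R k + (1 - 1 / l) *\<^sub>R a) + (1 / l) *\<^sub>R b"
    have "(1 / l) *\<^sub>R k + (1 - 1 / l) *\<^sub>R a \<in> K" using K kb a assms by (intro convexD) auto
    moreover have "norm ((1 / l) *\<^sub>R b) \<le> t" using kb assms by (simp add: field_simps)
    ultimately have "x \<in> parallel_body K t" unfolding parallel_body_sums x_def mem_Collect_eq mem_cball_0 by blast
    moreover have "y = l *\<^sub>R x + (1 - l) *\<^sub>R a"
      using assms by (simp add: x_def kb scaleR_add_right algebra_simps)
    ultimately show "y \<in> (\<lambda>x. l *\<^sub>R x + (1 - l) *\<^sub>R a) ` parallel_body K t" by blast
  qed
  moreover have "compact ((\<lambda>x. l *\<^sub>R x + (1 - l) *\<^sub>R a) ` parallel_body K t)"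
    by (intro compact_continuous_image continuous_intros parallel_body_compact K)
  ultimately have "measure lebesgue (parallel_body K (l * t)) \<le> measure lebesgue ((\<lambda>x. l *\<^sub>R x + (1 - l) *\<^sub>R a) ` parallel_body K t)"
    using K by (intro measure_mono_fmeasurable)
      (auto intro!: lmeasurable_compact fmeasurableD parallel_body_compact)
  also have "(\<lambda>x. l *\<^sub>R x + (1 - l) *\<^sub>R a) ` parallel_body K t = (\<lambda>x. (1 - l) *\<^sub>R a + l *\<^sub>R x) ` parallel_body K t"
    by (simp add: add.commute)
  also have "measure lebesgue \<dots> = l ^ DIM('a) * measure lebesgue (parallel_body K t)"
    using assms measure_lebesgue_affine[of l "(1 - l) *\<^sub>R a" "parallel_body K t"]
    by (simp add: add.commute)
  finally show ?thesis .
qed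

lemma parallel_body_zonotope_sum:
  assumes "0 \<le> r"
    and lo: "cball 0 (1 - \<delta>) \<subseteq> zonotope_sum {0} n T 1" and hi: "zonotope_sum {0} n T 1 \<subseteq> cball 0 (1 + \<delta>)"
  shows "parallel_body K ((1 - \<delta>) * r) \<subseteq> zonotope_sum K n T r"
    "zonotope_sum K n T r \<subseteq> parallel_body K ((1 + \<delta>) * r)"
proof -
  show "parallel_body K ((1 - \<delta>) * r) \<subseteq> zonotope_sum K n T r"
  proof
    fix y assume "y \<in> parallel_body K ((1 - \<delta>) * r)"
    then obtain k b where kb: "k \<in> K" "norm b \<le> (1 - \<delta>) * r" "y = k + b" unfolding parallel_body_sums by auto
    obtain c where c: "\<forall>i<n. \<bar>c i\<bar> \<le> r" "b = (\<Sum>i<n. c i *\<^sub>R T i)"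
    proof (cases "r = 0")
      case True
      then show ?thesis using that[of "\<lambda>_. 0"] kb by simp
    next
      case False
      then have "r > 0" using assms by simp
      have "(1 / r) *\<^sub>R b \<in> cball 0 (1 - \<delta>)" using kb \<open>r > 0\<close> by (simp add: field_simps)
      then have "(1 / r) *\<^sub>R b \<in> zonotope_sum {0} n T 1" using lo by blast
      then obtain c where c: "\<forall>i<n. \<bar>c i\<bar> \<le> 1" "(1 / r) *\<^sub>R b = (\<Sum>i<n. c i *\<^sub>R T i)"
        unfolding zonotope_sum_def by auto
      have "b = r *\<^sub>R (\<Sum>i<n. c i *\<^sub>R T i)" using \<open>r > 0\<close> by (simp flip: c(2))
      also have "\<dots> = (\<Sum>i<n. (r * c i) *\<^sub>R T i)" by (simp add: scaleR_sum_right)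
      finally have "b = (\<Sum>i<n. (r * c i) *\<^sub>R T i)" .
      moreover have "\<forall>i<n. \<bar>r * c i\<bar> \<le> r"
      proof (intro allI impI)
        fix i assume "i < n"
        then have "r * \<bar>c i\<bar> \<le> r * 1" using c(1) \<open>r > 0\<close> by (intro mult_left_mono) auto
        then show "\<bar>r * c i\<bar> \<le> r" using \<open>r > 0\<close> by (simp add: abs_mult)
      qed
      ultimately show ?thesis by (intro that[of "\<lambda>i. r * c i"])
    qed
    then show "y \<in> zonotope_sum K n T r" unfolding zonotope_sum_def using kb by blast
  qed
  show "zonotope_sum K n T r \<subseteq> parallel_body K ((1 + \<delta>) * r)"
  proof
    fix y assume "y \<in> zonotope_sum K n T r"
    then obtain k c where kc: "k \<in> K" "\<forall>i<n. \<bar>c i\<bar> \<le> r" "y = k + (\<Sum>i<n. c i *\<^sub>R T i)"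
      unfolding zonotope_sum_def by blast
    have "norm (\<Sum>i<n. c i *\<^sub>R T i) \<le> (1 + \<delta>) * r"
    proof (cases "r = 0")
      case True
      then show ?thesis using kc by simp
    next
      case False
      then have "r > 0" using assms by simp
      have "0 + (\<Sum>i<n. (c i / r) *\<^sub>R T i) \<in> zonotope_sum {0} n T 1"
        unfolding zonotope_sum_def using kc \<open>r > 0\<close>
        by (intro CollectI exI[of _ 0] exI[of _ "\<lambda>i. c i / r"]) (auto simp: abs_divide)
      then have "norm (\<Sum>i<n. (c i / r) *\<^sub>R T i) \<le> 1 + \<delta>" using hi by fastforce
      moreover have "(\<Sum>i<n. c i *\<^sub>R T i) = r *\<^sub>R (\<Sum>i<n. (c i / r) *\<^sub>R T i)"
        using \<open>r > 0\<close> by (simp add: scaleR_sum_right)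
      ultimately show ?thesis using \<open>r > 0\<close> by (simp add: mult.commute)
    qed
    then show "y \<in> parallel_body K ((1 + \<delta>) * r)" unfolding parallel_body_sums using kc by auto
  qed
qed

text \<open>The ball of radius \<open>r\<close> is squeezed between multiples of zonotopes; by
  \<open>measure_parallel_body_scale\<close> the polynomials of the zonotopes then converge to the volume of
  the parallel body. They have bounded degree because they grow no faster than the volume of a
  large ball. The same growth bounds the top coefficient, on which the moment condition gives no
  information.\<close>

theorem steiner_formula:
  fixes K :: "'a::euclidean_space set"
  assumes K: "compact K" "convex K" "K \<noteq> {}"
  obtains p where "degree p \<le> DIM('a)" "coeff p DIM('a) \<le> unit_ball_vol DIM('a)"
    "\<And>r. 0 \<le> r \<Longrightarrow> measure lebesgue (parallel_body K r) = poly p r"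
proof -
  let ?d = "DIM('a)"
  define \<kappa> where "\<kappa> = unit_ball_vol (real ?d)"
  define v where "v r = measure lebesgue (parallel_body K r)" for r
  have v0: "0 \<le> v r" for r by (simp add: v_def)
  obtain R where R0: "R > 0" "\<forall>x\<in>K. norm x \<le> R"
    using compact_imp_bounded[OF K(1)] unfolding bounded_pos by blast
  then have R: "R > 0" "K \<subseteq> cball 0 R" by auto
  have up: "v r \<le> \<kappa> * (R + r) ^ ?d" if "0 \<le> r" for r
  proof -
    have "parallel_body K r \<subseteq> cball 0 (R + r)"
    proof
      fix y assume "y \<in> parallel_body K r"
      then obtain k b where kb: "k \<in> K" "norm b \<le> r" "y = k + b" unfolding parallel_body_sums by auto
      then have "norm k \<le> R" using R by auto
      then show "y \<in> cball 0 (R + r)" using kb norm_triangle_ineq[of k b] by simp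
    qed
    then have "v r \<le> measure lebesgue (cball (0::'a) (R + r))"
      unfolding v_def using K
      by (intro measure_mono_fmeasurable) (auto intro!: fmeasurableD lmeasurable_compact parallel_body_compact)
    also have "\<dots> = \<kappa> * (R + r) ^ ?d"
      using R that content_cball[of "R + r" "0::'a"] by (simp add: \<kappa>_def)
    finally show ?thesis .
  qed
  define \<delta> where "\<delta> k = 1 / (real k + 2)" for k
  have \<delta>: "0 < \<delta> k" "\<delta> k < 1" for k by (auto simp: \<delta>_def)
  have "\<exists>p. \<forall>r\<ge>0. (1 - \<delta> k) ^ ?d * v r \<le> poly p r \<and> poly p r \<le> (1 + \<delta> k) ^ ?d * v r" for k
  proof -
    obtain n and T :: "nat \<Rightarrow> 'a"
      where T: "cball 0 (1 - \<delta> k) \<subseteq> zonotope_sum {0} n T 1" "zonotope_sum {0} n T 1 \<subseteq> cball 0 (1 + \<delta> k)"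
      by (rule zonotope_approximates_ball[OF \<delta>(1)[of k]])
    obtain p where p: "\<forall>r\<ge>0. measure lebesgue (zonotope_sum K n T r) = poly p r"
      using measure_zonotope_sum_poly[OF K(1,2)] by blast
    have "(1 - \<delta> k) ^ ?d * v r \<le> poly p r \<and> poly p r \<le> (1 + \<delta> k) ^ ?d * v r" if r: "0 \<le> r" for r
    proof
      note incl = parallel_body_zonotope_sum[OF r T, of K]
      note co = fmeasurableD lmeasurable_compact parallel_body_compact zonotope_sum_compact K
      have "v r = v ((1 / (1 - \<delta> k)) * ((1 - \<delta> k) * r))" using \<delta>[of k] by simp
      also have "\<dots> \<le> (1 / (1 - \<delta> k)) ^ ?d * v ((1 - \<delta> k) * r)"
        unfolding v_def using \<delta>[of k] r by (intro measure_parallel_body_scale K) auto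
      also have "v ((1 - \<delta> k) * r) \<le> poly p r"
        using p r incl(1) unfolding v_def
        by (metis measure_mono_fmeasurable co(1) co(2) co(3) co(4) K(1))
      finally have "v r \<le> (1 / (1 - \<delta> k)) ^ ?d * poly p r" using \<delta>[of k] by simp
      then show "(1 - \<delta> k) ^ ?d * v r \<le> poly p r"
        using \<delta>[of k] by (simp add: power_one_over field_simps)
      have "poly p r \<le> v ((1 + \<delta> k) * r)"
        using p r incl(2) unfolding v_def
        by (metis measure_mono_fmeasurable co(1) co(2) co(3) co(4) K(1))
      also have "\<dots> \<le> (1 + \<delta> k) ^ ?d * v r"
        unfolding v_def using \<delta>[of k] r by (intro measure_parallel_body_scale K) auto
      finally show "poly p r \<le> (1 + \<delta> k) ^ ?d * v r" .
    qed
    then show ?thesis by blast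
  qed
  then obtain p where p: "\<And>k r. 0 \<le> r \<Longrightarrow> (1 - \<delta> k) ^ ?d * v r \<le> poly (p k) r"
    "\<And>k r. 0 \<le> r \<Longrightarrow> poly (p k) r \<le> (1 + \<delta> k) ^ ?d * v r" by metis
  have "degree (p k) \<le> ?d" for k
  proof (rule poly_growth(1))
    fix r :: real assume r: "0 \<le> r"
    have "0 \<le> (1 - \<delta> k) ^ ?d * v r" using v0 \<delta>[of k] by simp
    then have "\<bar>poly (p k) r\<bar> \<le> (1 + \<delta> k) ^ ?d * v r" using p(1)[OF r, of k] p(2)[OF r, of k] by linarith
    also have "\<dots> \<le> (1 + \<delta> k) ^ ?d * (\<kappa> * (R + r) ^ ?d)"
      using up[OF r] \<delta>[of k] by (intro mult_left_mono) auto
    finally show "\<bar>poly (p k) r\<bar> \<le> ((1 + \<delta> k) ^ ?d * \<kappa>) * (R + r) ^ ?d" by (simp add: mult.assoc)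
  qed
  moreover have "(\<lambda>k. poly (p k) r) \<longlonglongrightarrow> v r" if r: "0 \<le> r" for r
  proof (rule real_tendsto_sandwich)
    have \<delta>0: "\<delta> \<longlonglongrightarrow> 0"
      unfolding \<delta>_def using LIMSEQ_ignore_initial_segment[OF lim_1_over_n, of 2] by (simp add: add.commute)
    have "(\<lambda>k. (1 - \<delta> k) ^ ?d * v r) \<longlonglongrightarrow> (1 - 0) ^ ?d * v r"
      by (intro tendsto_intros \<delta>0)
    then show "(\<lambda>k. (1 - \<delta> k) ^ ?d * v r) \<longlonglongrightarrow> v r" by simp
    have "(\<lambda>k. (1 + \<delta> k) ^ ?d * v r) \<longlonglongrightarrow> (1 + 0) ^ ?d * v r"
      by (intro tendsto_intros \<delta>0)
    then show "(\<lambda>k. (1 + \<delta> k) ^ ?d * v r) \<longlonglongrightarrow> v r" by simp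
  qed (use p[OF r] in auto)
  ultimately obtain q where q: "degree q \<le> ?d" "\<And>r. 0 \<le> r \<Longrightarrow> v r = poly q r"
    by (rule limit_of_polynomials[where p=p and f=v]) auto
  have "coeff q ?d \<le> \<kappa>"
  proof (rule poly_growth(2))
    fix r :: real assume r: "0 \<le> r"
    show "\<bar>poly q r\<bar> \<le> \<kappa> * (R + r) ^ ?d" using up[OF r] v0[of r] q(2)[OF r] by simp
  qed
  then show ?thesis using that q unfolding v_def \<kappa>_def by blast
qed

lemma steiner_poly_eqI:
  assumes "\<And>r. 0 \<le> r \<Longrightarrow> measure lborel (\<Union>x\<in>K. cball x r) = poly p r"
  shows "steiner_poly K = p"
  unfolding steiner_poly_def
proof (rule the_equality)
  show "\<forall>r\<ge>0. measure lborel (\<Union>x\<in>K. cball x r) = poly p r" using assms by blast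
  fix q assume q: "\<forall>r\<ge>0. measure lborel (\<Union>x\<in>K. cball x r) = poly q r"
  let ?n = "max (degree p) (degree q)"
  show "q = p"
  proof (rule poly_eqI_degree[where A = "real ` {..?n}"])
    have "card (real ` {..?n}) = Suc ?n" by (simp add: card_image inj_on_def)
    then show "degree q < card (real ` {..?n})" "degree p < card (real ` {..?n})" by auto
  qed (use assms q in fastforce)
qed

lemma measure_parallel_body_intrinsic_volumes:
  fixes K :: "'a::euclidean_space set"
  assumes K: "compact K" "convex K" "K \<noteq> {}" and r: "0 \<le> r"
  shows "measure lborel (parallel_body K r) \<le> unit_ball_vol DIM('a) * r ^ DIM('a)
      + (\<Sum>k<DIM('a). unit_ball_vol (real k) * r ^ k * intrinsic_volume (DIM('a) - k) K)"
    and "intrinsic_volume DIM('a) K = measure lborel K"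
proof -
  let ?d = "DIM('a)"
  obtain p where p: "degree p \<le> ?d" "coeff p ?d \<le> unit_ball_vol ?d"
    "\<And>r. 0 \<le> r \<Longrightarrow> measure lebesgue (parallel_body K r) = poly p r"
    using steiner_formula[OF K] by blast
  have leb: "measure lebesgue (parallel_body K r) = measure lborel (parallel_body K r)" for r
    by (rule measure_completion) (simp add: parallel_body_compact[OF K(1)] compact_imp_closed borel_closed)
  have sp: "steiner_poly K = p"
    by (rule steiner_poly_eqI) (use p(3) leb in \<open>simp add: parallel_body_def\<close>)
  have iv: "unit_ball_vol (real k) * intrinsic_volume (?d - k) K = coeff p k" if "k \<le> ?d" for k
  proof -
    have "unit_ball_vol (real k) \<noteq> 0" using unit_ball_vol_pos[of "real k"] by linarith
    then show ?thesis using that by (simp add: intrinsic_volume_def sp)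
  qed
  have "measure lborel (parallel_body K r) = (\<Sum>k\<le>?d. coeff p k * r ^ k)"
  proof -
    have "poly p r = poly (\<Sum>k\<le>?d. monom (coeff p k) k) r" by (simp only: poly_as_sum_of_monoms'[OF p(1)])
    then show ?thesis using p(3)[OF r] leb by (simp add: poly_sum poly_monom)
  qed
  also have "\<dots> = (\<Sum>k<?d. coeff p k * r ^ k) + coeff p ?d * r ^ ?d"
    by (simp add: lessThan_Suc_atMost[symmetric])
  also have "\<dots> \<le> (\<Sum>k<?d. unit_ball_vol (real k) * r ^ k * intrinsic_volume (?d - k) K) + unit_ball_vol ?d * r ^ ?d"
    using p(2) r by (intro add_mono mult_right_mono sum_mono) (auto simp: iv[symmetric])
  finally show "measure lborel (parallel_body K r) \<le> unit_ball_vol ?d * r ^ ?d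
      + (\<Sum>k<?d. unit_ball_vol (real k) * r ^ k * intrinsic_volume (?d - k) K)" by simp
  have "measure lborel (parallel_body K 0) = coeff p 0"
    using p(3)[of 0] leb by (simp add: poly_0_coeff_0)
  then show "intrinsic_volume ?d K = measure lborel K"
    by (simp add: intrinsic_volume_def sp parallel_body_def)
qed

section \<open>Measurability with respect to the Fell topology\<close>

lemma countable_ball_base:
  obtains \<B> :: "'a::euclidean_space set set" where "countable \<B>" "\<And>B. B \<in> \<B> \<Longrightarrow> open B \<and> bounded B"
    "\<And>x G. open G \<Longrightarrow> x \<in> G \<Longrightarrow> \<exists>B\<in>\<B>. x \<in> B \<and> closure B \<subseteq> G"
proof -
  obtain D :: "'a set" where D: "countable D" "\<And>X. open X \<Longrightarrow> X \<noteq> {} \<Longrightarrow> \<exists>d\<in>D. d \<in> X"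
    using countable_dense_setE by blast
  define \<B> where "\<B> = (\<lambda>(d, n::nat). ball d (1 / Suc n)) ` (D \<times> UNIV)"
  show ?thesis
  proof (rule that[of \<B>])
    show "countable \<B>" unfolding \<B>_def using D by (intro countable_image countable_SIGMA) auto
    show "\<And>B. B \<in> \<B> \<Longrightarrow> open B \<and> bounded B" by (auto simp: \<B>_def)
    fix x and G :: "'a set" assume "open G" "x \<in> G"
    then obtain e where e: "e > 0" "ball x e \<subseteq> G" using open_contains_ball by blast
    obtain n :: nat where n: "1 / real (Suc n) < e / 2" using e nat_approx_posE[of "e / 2"] by auto
    have "ball x (1 / Suc n) \<noteq> {}" by simp
    then obtain d where d: "d \<in> D" "d \<in> ball x (1 / Suc n)" using D(2) open_ball by blast
    have "cball d (1 / Suc n) \<subseteq> ball x e"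
    proof
      fix y assume y: "y \<in> cball d (1 / Suc n)"
      have "dist x y \<le> dist x d + dist d y" by (rule dist_triangle)
      then show "y \<in> ball x e" using d y n by (simp only: mem_ball mem_cball)
    qed
    then have "closure (ball d (1 / Suc n)) \<subseteq> G" using e by (simp add: closure_ball)
    moreover have "x \<in> ball d (1 / Suc n)" using d by (simp add: dist_commute)
    moreover have "ball d (1 / Suc n) \<in> \<B>" unfolding \<B>_def using d(1) by force
    ultimately show "\<exists>B\<in>\<B>. x \<in> B \<and> closure B \<subseteq> G" by blast
  qed
qed

lemma openin_fell_closed: "openin fell_topology U \<Longrightarrow> F \<in> U \<Longrightarrow> closed F"
  unfolding fell_topology_def openin_topology_generated_by_iff
  by (induction rule: generate_topology_on.induct) auto

text \<open>The Fell topology has a countable subbase, which replaces the arbitrary open sets by members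
  of a countable base and the arbitrary compact sets by finite unions of closures of such members.
  For a compact set disjoint from \<open>F\<close>, such a union is found between it and the complement of
  \<open>F\<close>.\<close>

lemma fell_topology_countable_subbase:
  fixes \<B> :: "'a::euclidean_space set set"
  assumes base: "\<And>x G. open G \<Longrightarrow> x \<in> G \<Longrightarrow> \<exists>B\<in>\<B>. x \<in> B \<and> closure B \<subseteq> G"
    and op: "\<And>B. B \<in> \<B> \<Longrightarrow> open B"
    and U: "openin fell_topology U" and F: "F \<in> U"
  defines "\<C> \<equiv> (\<lambda>B. {F. F \<inter> B \<noteq> {}}) ` \<B> \<union> (\<lambda>D. {F. F \<inter> (\<Union>B\<in>D. closure B) = {}}) ` {D. finite D \<and> D \<subseteq> \<B>}"
  shows "\<exists>\<D>. finite \<D> \<and> \<D> \<subseteq> \<C> \<and> F \<in> \<Inter>\<D> \<and> {F. closed F} \<inter> \<Inter>\<D> \<subseteq> U"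
  using U[unfolded fell_topology_def openin_topology_generated_by_iff] F
proof (induction arbitrary: F rule: generate_topology_on.induct)
  case Empty
  then show ?case by simp
next
  case (Int a b)
  obtain \<D>1 where 1: "finite \<D>1" "\<D>1 \<subseteq> \<C>" "F \<in> \<Inter>\<D>1" "{F. closed F} \<inter> \<Inter>\<D>1 \<subseteq> a"
    using Int.IH(1)[of F] Int.prems by (elim exE conjE IntE) blast
  obtain \<D>2 where 2: "finite \<D>2" "\<D>2 \<subseteq> \<C>" "F \<in> \<Inter>\<D>2" "{F. closed F} \<inter> \<Inter>\<D>2 \<subseteq> b"
    using Int.IH(2)[of F] Int.prems by (elim exE conjE IntE) blast
  have "finite (\<D>1 \<union> \<D>2)" "\<D>1 \<union> \<D>2 \<subseteq> \<C>" "F \<in> \<Inter>(\<D>1 \<union> \<D>2)" using 1 2 by blast+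
  moreover have "{F. closed F} \<inter> \<Inter>(\<D>1 \<union> \<D>2) \<subseteq> a \<inter> b" using 1(4) 2(4) by blast
  ultimately show ?case by blast
next
  case (UN K)
  then obtain k where k: "k \<in> K" "F \<in> k" by blast
  from UN.IH[OF this] obtain \<D> where "finite \<D>" "\<D> \<subseteq> \<C>" "F \<in> \<Inter>\<D>" "{F. closed F} \<inter> \<Inter>\<D> \<subseteq> k" by blast
  then show ?case using k(1) by (intro exI[of _ \<D>]) blast
next
  case (Basis s)
  then consider G where "open G" "s = {F. closed F \<and> F \<inter> G \<noteq> {}}"
    | K where "compact K" "s = {F. closed F \<and> F \<inter> K = {}}" by blast
  then show ?case
  proof cases
    case 1
    then obtain x where x: "x \<in> F" "x \<in> G" using Basis by auto
    obtain B where B: "B \<in> \<B>" "x \<in> B" "closure B \<subseteq> G" using base[OF 1(1) x(2)] by blast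
    then have "B \<subseteq> G" using closure_subset by blast
    then show ?thesis using B x 1
      by (intro exI[of _ "{{F. F \<inter> B \<noteq> {}}}"]) (auto simp: \<C>_def)
  next
    case 2
    then have F: "closed F" "F \<inter> K = {}" using Basis by auto
    have "\<exists>B\<in>\<B>. x \<in> B \<and> closure B \<subseteq> - F" if "x \<in> K" for x
      using base[of "- F" x] F that by auto
    then obtain b where b: "\<And>x. x \<in> K \<Longrightarrow> b x \<in> \<B> \<and> x \<in> b x \<and> closure (b x) \<subseteq> - F" by metis
    obtain D where D: "D \<subseteq> K" "finite D" "K \<subseteq> (\<Union>x\<in>D. b x)"
    proof (rule compactE_image[OF 2(1), of K b])
      show "open (b x)" if "x \<in> K" for x using b[OF that] op by blast
      show "K \<subseteq> (\<Union>x\<in>K. b x)"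
      proof
        fix x assume "x \<in> K"
        moreover from b[OF this] have "x \<in> b x" by simp
        ultimately show "x \<in> (\<Union>x\<in>K. b x)" by (rule UN_I)
      qed
    qed (rule that)
    let ?C = "{F. F \<inter> (\<Union>B\<in>b ` D. closure B) = {}}"
    have bD: "b ` D \<subseteq> \<B>" "\<And>x. x \<in> D \<Longrightarrow> closure (b x) \<subseteq> - F" using D(1) b by auto
    have "?C \<in> (\<lambda>D. {F. F \<inter> (\<Union>B\<in>D. closure B) = {}}) ` {D. finite D \<and> D \<subseteq> \<B>}"
      by (rule imageI) (use D(2) bD(1) in simp)
    then have "?C \<in> \<C>" unfolding \<C>_def by (rule UnI2)
    moreover have "F \<in> ?C" using bD(2) by auto
    moreover have "{F. closed F} \<inter> \<Inter>{?C} \<subseteq> s"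
    proof -
      have "(\<Union>x\<in>D. b x) \<subseteq> (\<Union>B\<in>b ` D. closure B)" using closure_subset by fastforce
      then have "K \<subseteq> (\<Union>B\<in>b ` D. closure B)" using D(3) by (rule subset_trans[rotated])
      then have "F' \<inter> K = {}" if "F' \<inter> (\<Union>B\<in>b ` D. closure B) = {}" for F' using that by blast
      then show ?thesis by (auto simp: 2(2))
    qed
    ultimately have "finite {?C} \<and> {?C} \<subseteq> \<C> \<and> F \<in> \<Inter>{?C} \<and> {F. closed F} \<inter> \<Inter>{?C} \<subseteq> s"
      by simp
    then show ?thesis by (rule exI)
  qed
qed

text \<open>Since the Fell topology is second countable, its open sets are countable unions of finite
  intersections of events of hitting or missing a set. An open set is hit if and only if one of
  countably many compact subsets is hit.\<close>

theorem measurable_fell_borelI: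
  fixes h :: "'w \<Rightarrow> 'a::euclidean_space set"
  assumes closed: "\<And>\<omega>. \<omega> \<in> space M \<Longrightarrow> closed (h \<omega>)"
    and hit: "\<And>K. compact K \<Longrightarrow> {\<omega>\<in>space M. h \<omega> \<inter> K \<noteq> {}} \<in> sets M"
  shows "h \<in> M \<rightarrow>\<^sub>M fell_borel"
  unfolding fell_borel_def
proof (rule measurable_measure_of)
  show "{U. openin fell_topology U} \<subseteq> Pow {F::'a set. closed F}" by (auto dest: openin_fell_closed)
  show "h \<in> space M \<rightarrow> {F. closed F}" using closed by auto
  fix U :: "'a set set" assume "U \<in> {U. openin fell_topology U}"
  then have U: "openin fell_topology U" by simp
  obtain \<B> :: "'a set set" where B: "countable \<B>" "\<And>B. B \<in> \<B> \<Longrightarrow> open B \<and> bounded B"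
    "\<And>x G. open G \<Longrightarrow> x \<in> G \<Longrightarrow> \<exists>B\<in>\<B>. x \<in> B \<and> closure B \<subseteq> G"
    using countable_ball_base by blast
  define \<C> where "\<C> = (\<lambda>B. {F. F \<inter> B \<noteq> {}}) ` \<B> \<union> (\<lambda>D. {F. F \<inter> (\<Union>B\<in>D. closure B) = {}}) ` {D. finite D \<and> D \<subseteq> \<B>}"
  define \<E> where "\<E> = {\<D>. finite \<D> \<and> \<D> \<subseteq> \<C> \<and> {F. closed F} \<inter> \<Inter>\<D> \<subseteq> U}"
  have ctC: "countable \<C>" unfolding \<C>_def using B(1)
    by (intro countable_Un countable_image countable_Collect_finite_subset) auto
  have "countable \<E>"
    by (rule countable_subset[OF _ countable_Collect_finite_subset[OF ctC]]) (auto simp: \<E>_def)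
  have comp: "compact (closure B)" if "B \<in> \<B>" for B using B(2)[OF that] by (simp add: compact_closure)
  have hitB: "{\<omega>\<in>space M. h \<omega> \<inter> B \<noteq> {}} \<in> sets M" if BB: "B \<in> \<B>" for B
  proof -
    have "{\<omega>\<in>space M. h \<omega> \<inter> B \<noteq> {}} = (\<Union>B'\<in>{B'\<in>\<B>. closure B' \<subseteq> B}. {\<omega>\<in>space M. h \<omega> \<inter> closure B' \<noteq> {}})"
    proof (intro set_eqI iffI)
      fix \<omega> assume "\<omega> \<in> {\<omega>\<in>space M. h \<omega> \<inter> B \<noteq> {}}"
      then obtain x where x: "\<omega> \<in> space M" "x \<in> h \<omega>" "x \<in> B" by blast
      obtain B' where "B' \<in> \<B>" "x \<in> B'" "closure B' \<subseteq> B" using B(3)[of B x] B(2)[OF BB] x by blast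
      then show "\<omega> \<in> (\<Union>B'\<in>{B'\<in>\<B>. closure B' \<subseteq> B}. {\<omega>\<in>space M. h \<omega> \<inter> closure B' \<noteq> {}})"
        using x closure_subset by blast
    qed blast
    also have "\<dots> \<in> sets M"
      by (rule sets.countable_UN') (use B(1) comp hit in \<open>auto intro: countable_subset[of _ \<B>]\<close>)
    finally show ?thesis .
  qed
  have gen: "{\<omega>\<in>space M. h \<omega> \<in> C} \<in> sets M" if CC: "C \<in> \<C>" for C
  proof -
    consider B where "B \<in> \<B>" "C = {F. F \<inter> B \<noteq> {}}"
      | D where "finite D" "D \<subseteq> \<B>" "C = {F. F \<inter> (\<Union>B\<in>D. closure B) = {}}"
      using CC unfolding \<C>_def by blast
    then show ?thesis
    proof cases
      case 1
      then show ?thesis using hitB by simp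
    next
      case 2
      have "compact (\<Union>B\<in>D. closure B)" using 2 comp by (intro compact_UN) auto
      from hit[OF this] have "space M - {\<omega>\<in>space M. h \<omega> \<inter> (\<Union>B\<in>D. closure B) \<noteq> {}} \<in> sets M" by blast
      moreover have "{\<omega>\<in>space M. h \<omega> \<in> C} = space M - {\<omega>\<in>space M. h \<omega> \<inter> (\<Union>B\<in>D. closure B) \<noteq> {}}"
        unfolding 2 by blast
      ultimately show ?thesis by simp
    qed
  qed
  have "h -` U \<inter> space M = (\<Union>\<D>\<in>\<E>. {\<omega>\<in>space M. \<forall>C\<in>\<D>. h \<omega> \<in> C})"
  proof (intro set_eqI iffI)
    fix \<omega> assume "\<omega> \<in> h -` U \<inter> space M"
    then have w: "\<omega> \<in> space M" "h \<omega> \<in> U" by auto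
    have op: "open B" if "B \<in> \<B>" for B using B(2)[OF that] by simp
    have "\<exists>\<D>. finite \<D> \<and> \<D> \<subseteq> \<C> \<and> h \<omega> \<in> \<Inter>\<D> \<and> {F. closed F} \<inter> \<Inter>\<D> \<subseteq> U"
      unfolding \<C>_def
      by (rule fell_topology_countable_subbase) (rule B(3), assumption, assumption, erule op, rule U, rule w(2))
    then obtain \<D> where D: "finite \<D>" "\<D> \<subseteq> \<C>" "h \<omega> \<in> \<Inter>\<D>" "{F. closed F} \<inter> \<Inter>\<D> \<subseteq> U"
      by (elim exE conjE)
    then have "\<D> \<in> \<E>" by (simp add: \<E>_def)
    moreover have "\<omega> \<in> {\<omega>\<in>space M. \<forall>C\<in>\<D>. h \<omega> \<in> C}" using w(1) D(3) by simp
    ultimately show "\<omega> \<in> (\<Union>\<D>\<in>\<E>. {\<omega>\<in>space M. \<forall>C\<in>\<D>. h \<omega> \<in> C})" by (rule UN_I)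
  next
    fix \<omega> assume "\<omega> \<in> (\<Union>\<D>\<in>\<E>. {\<omega>\<in>space M. \<forall>C\<in>\<D>. h \<omega> \<in> C})"
    then obtain \<D> where D: "{F. closed F} \<inter> \<Inter>\<D> \<subseteq> U" "\<omega> \<in> space M" "\<forall>C\<in>\<D>. h \<omega> \<in> C"
      unfolding \<E>_def by auto
    then have "h \<omega> \<in> {F. closed F} \<inter> \<Inter>\<D>" using closed by auto
    then show "\<omega> \<in> h -` U \<inter> space M" using D by auto
  qed
  also have "\<dots> \<in> sets M"
  proof (rule sets.countable_UN'[OF \<open>countable \<E>\<close>])
    show "(\<lambda>\<D>. {\<omega>\<in>space M. \<forall>C\<in>\<D>. h \<omega> \<in> C}) ` \<E> \<subseteq> sets M"
      using gen by (auto simp: \<E>_def intro!: sets.sets_Collect_finite_All)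
  qed
  finally show "h -` U \<inter> space M \<in> sets M" .
qed

section \<open>The measurable space of point configurations\<close>

lemma point_measure_on_sets: "point_measure_on S \<mu> \<Longrightarrow> sets \<mu> = sets S"
  unfolding point_measure_on_def by auto

lemma point_measure_on_space: "point_measure_on S \<mu> \<Longrightarrow> space \<mu> = space S"
  by (rule sets_eq_imp_space_eq[OF point_measure_on_sets])

text \<open>The sigma-algebra is the one generated by the evaluations at measurable sets, so that a law
  on this space is determined by its finite-dimensional distributions.\<close>

definition config :: "'a measure \<Rightarrow> 'a measure measure" where
  "config S = sigma {\<mu>. point_measure_on S \<mu>}
     {{\<mu>. point_measure_on S \<mu> \<and> emeasure \<mu> B \<in> A} | B A. B \<in> sets S \<and> A \<in> sets borel}"

lemma space_config: "space (config S) = {\<mu>. point_measure_on S \<mu>}"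
  unfolding config_def by (rule space_measure_of) auto

lemma measurable_emeasure_config:
  assumes "B \<in> sets S" shows "(\<lambda>\<mu>. emeasure \<mu> B) \<in> borel_measurable (config S)"
proof (rule measurableI)
  fix A :: "ennreal set" assume "A \<in> sets borel"
  then have "{\<mu>. point_measure_on S \<mu> \<and> emeasure \<mu> B \<in> A} \<in> sets (config S)"
    unfolding config_def using assms by (intro in_measure_of) auto
  moreover have "(\<lambda>\<mu>. emeasure \<mu> B) -` A \<inter> space (config S) = {\<mu>. point_measure_on S \<mu> \<and> emeasure \<mu> B \<in> A}"
    by (auto simp: space_config)
  ultimately show "(\<lambda>\<mu>. emeasure \<mu> B) -` A \<inter> space (config S) \<in> sets (config S)" by simp
qed simp

lemma measurable_configI:
  assumes "\<And>\<omega>. \<omega> \<in> space M \<Longrightarrow> point_measure_on S (\<eta> \<omega>)"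
    and [measurable]: "\<And>B. B \<in> sets S \<Longrightarrow> (\<lambda>\<omega>. emeasure (\<eta> \<omega>) B) \<in> borel_measurable M"
  shows "\<eta> \<in> M \<rightarrow>\<^sub>M config S"
  unfolding config_def
proof (rule measurable_measure_of)
  fix U assume "U \<in> {{\<mu>. point_measure_on S \<mu> \<and> emeasure \<mu> B \<in> A} | B A. B \<in> sets S \<and> A \<in> sets borel}"
  then obtain B A where U: "U = {\<mu>. point_measure_on S \<mu> \<and> emeasure \<mu> B \<in> A}"
    and [measurable]: "B \<in> sets S" "A \<in> sets borel" by auto
  have "\<eta> -` U \<inter> space M = {\<omega>\<in>space M. emeasure (\<eta> \<omega>) B \<in> A}" using assms(1) by (auto simp: U)
  also have "\<dots> \<in> sets M" by measurable
  finally show "\<eta> -` U \<inter> space M \<in> sets M" .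
qed (use assms(1) in auto)

text \<open>By approximation of \<open>h\<close> with simple functions. The smoothed shot noise below is such an
  integral.\<close>

lemma measurable_nn_integral_config:
  assumes "h \<in> borel_measurable S"
  shows "(\<lambda>\<mu>. \<integral>\<^sup>+x. h x \<partial>\<mu>) \<in> borel_measurable (config S)"
  using assms
proof (induction h rule: borel_measurable_induct)
  case (cong f g)
  have "(\<lambda>\<mu>. \<integral>\<^sup>+x. f x \<partial>\<mu>) \<in> borel_measurable (config S) \<longleftrightarrow> (\<lambda>\<mu>. \<integral>\<^sup>+x. g x \<partial>\<mu>) \<in> borel_measurable (config S)"
    by (intro measurable_cong nn_integral_cong) (simp add: cong space_config point_measure_on_space)
  then show ?case using cong by simp
next
  case (set A)
  have "(\<lambda>\<mu>. \<integral>\<^sup>+x. indicator A x \<partial>\<mu>) \<in> borel_measurable (config S) \<longleftrightarrow> (\<lambda>\<mu>. emeasure \<mu> A) \<in> borel_measurable (config S)"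
    by (intro measurable_cong) (use set in \<open>simp add: space_config point_measure_on_sets\<close>)
  then show ?case using measurable_emeasure_config set by blast
next
  case (mult u c)
  have "(\<lambda>\<mu>. \<integral>\<^sup>+x. c * u x \<partial>\<mu>) \<in> borel_measurable (config S) \<longleftrightarrow> (\<lambda>\<mu>. c * (\<integral>\<^sup>+x. u x \<partial>\<mu>)) \<in> borel_measurable (config S)"
    by (intro measurable_cong nn_integral_cmult)
      (use mult in \<open>simp add: space_config measurable_cong_sets[OF point_measure_on_sets refl]\<close>)
  then show ?case using mult by simp
next
  case (add u v)
  have "(\<lambda>\<mu>. \<integral>\<^sup>+x. v x + u x \<partial>\<mu>) \<in> borel_measurable (config S) \<longleftrightarrow>
      (\<lambda>\<mu>. (\<integral>\<^sup>+x. v x \<partial>\<mu>) + (\<integral>\<^sup>+x. u x \<partial>\<mu>)) \<in> borel_measurable (config S)"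
    by (intro measurable_cong nn_integral_add)
      (use add in \<open>simp_all add: space_config measurable_cong_sets[OF point_measure_on_sets refl]\<close>)
  then show ?case using add by simp
next
  case (seq U)
  have "(\<lambda>\<mu>. \<integral>\<^sup>+x. (SUP i. U i) x \<partial>\<mu>) \<in> borel_measurable (config S) \<longleftrightarrow>
      (\<lambda>\<mu>. SUP i. (\<integral>\<^sup>+x. U i x \<partial>\<mu>)) \<in> borel_measurable (config S)"
  proof (intro measurable_cong)
    fix \<mu> assume "\<mu> \<in> space (config S)"
    then have "point_measure_on S \<mu>" by (simp add: space_config)
    then show "(\<integral>\<^sup>+x. (SUP i. U i) x \<partial>\<mu>) = (SUP i. (\<integral>\<^sup>+x. U i x \<partial>\<mu>))"
      unfolding SUP_apply
      using seq by (intro nn_integral_monotone_convergence_SUP)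
        (simp_all add: measurable_cong_sets[OF point_measure_on_sets refl])
  qed
  then show ?case using seq by (simp add: image_image cong: SUP_cong_simp)
qed

section \<open>The law of a Poisson process is determined by its intensity\<close>

lemma poisson_process_measurable: "poisson_process P S \<eta> \<Longrightarrow> \<eta> \<in> P \<rightarrow>\<^sub>M config S"
  by (intro measurable_configI) (auto simp: poisson_process_def)

lemma poisson_weights_sums: "(\<lambda>k. a ^ k / fact k * exp (- a)) sums (1::real)"
proof -
  have "(\<lambda>k. a ^ k / fact k * exp (- a)) sums (exp a * exp (- a))"
    using sums_mult2[OF exp_converges[of a], of "exp (- a)"] by (simp add: field_simps)
  then show ?thesis by (simp add: exp_minus)
qed

lemma poisson_process_AE_nat:
  assumes "prob_space P" and eta: "poisson_process P S \<eta>" and B: "B \<in> sets S" "emeasure S B < \<infinity>"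
  shows "AE \<omega> in P. \<exists>k::nat. emeasure (\<eta> \<omega>) B = of_nat k"
proof -
  interpret prob_space P by fact
  have [measurable]: "(\<lambda>\<omega>. emeasure (\<eta> \<omega>) B) \<in> borel_measurable P"
    using eta B by (auto simp: poisson_process_def)
  define E where "E k = {\<omega>\<in>space P. emeasure (\<eta> \<omega>) B = of_nat k}" for k :: nat
  have [measurable]: "E k \<in> events" for k unfolding E_def by measurable
  have dis: "disjoint_family E" by (auto simp: disjoint_family_on_def E_def)
  have p: "prob (E k) = measure S B ^ k / fact k * exp (- measure S B)" for k
    using eta B unfolding poisson_process_def E_def by blast
  have "(\<lambda>k. prob (E k)) sums prob (\<Union>k. E k)"
    using dis by (intro finite_measure_UNION) auto
  then have "prob (\<Union>k. E k) = 1" unfolding p using poisson_weights_sums sums_unique2 by blast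
  then have "AE \<omega> in P. \<omega> \<in> (\<Union>k. E k)" by (subst AE_in_set_eq_1) auto
  then show ?thesis by eventually_elim (auto simp: E_def)
qed

lemma poisson_process_marginal:
  assumes "prob_space P" and eta: "poisson_process P S \<eta>" and B: "B \<in> sets S" and A: "A \<in> sets borel"
  shows "emeasure P {\<omega>\<in>space P. emeasure (\<eta> \<omega>) B \<in> A} =
    (if emeasure S B = \<infinity> then indicator A \<infinity>
     else (\<Sum>k. if of_nat k \<in> A then ennreal (measure S B ^ k / fact k * exp (- measure S B)) else 0))"
proof -
  interpret prob_space P by fact
  note [measurable] = A
  have [measurable]: "(\<lambda>\<omega>. emeasure (\<eta> \<omega>) B) \<in> borel_measurable P"
    using eta B by (auto simp: poisson_process_def)
  show ?thesis
  proof (cases "emeasure S B = \<infinity>")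
    case True
    then have "AE \<omega> in P. emeasure (\<eta> \<omega>) B = \<infinity>" using eta B by (auto simp: poisson_process_def)
    then have "emeasure P {\<omega>\<in>space P. emeasure (\<eta> \<omega>) B \<in> A} = emeasure P {\<omega>\<in>space P. \<infinity> \<in> A}"
      by (intro emeasure_eq_AE) auto
    then show ?thesis using True by (cases "\<infinity> \<in> A") (simp_all add: emeasure_space_1)
  next
    case False
    define E where "E k = {\<omega>\<in>space P. emeasure (\<eta> \<omega>) B = of_nat k}" for k :: nat
    have [measurable]: "E k \<in> events" for k unfolding E_def by measurable
    have p: "prob (E k) = measure S B ^ k / fact k * exp (- measure S B)" for k
      using eta B False unfolding poisson_process_def E_def by (simp add: less_top)
    let ?N = "{\<omega>\<in>space P. emeasure (\<eta> \<omega>) B \<in> A}"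
    have "emeasure P ?N = emeasure P (\<Union>k. ?N \<inter> E k)"
    proof (rule emeasure_eq_AE)
      have "AE \<omega> in P. \<exists>k::nat. emeasure (\<eta> \<omega>) B = of_nat k"
        by (rule poisson_process_AE_nat[OF assms(1-3)]) (use False in \<open>simp add: less_top\<close>)
      then show "AE \<omega> in P. (\<omega> \<in> ?N) = (\<omega> \<in> (\<Union>k. ?N \<inter> E k))"
        by eventually_elim (auto simp: E_def)
    qed auto
    also have "\<dots> = (\<Sum>k. emeasure P (?N \<inter> E k))"
      by (rule suminf_emeasure[symmetric]) (auto simp: disjoint_family_on_def E_def)
    also have "\<dots> = (\<Sum>k. if of_nat k \<in> A then ennreal (measure S B ^ k / fact k * exp (- measure S B)) else 0)"
    proof (rule suminf_cong)
      fix k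
      have "?N \<inter> E k = (if of_nat k \<in> A then E k else {})" by (auto simp: E_def)
      then show "emeasure P (?N \<inter> E k) = (if of_nat k \<in> A then ennreal (measure S B ^ k / fact k * exp (- measure S B)) else 0)"
        by (simp add: emeasure_eq_measure p)
    qed
    finally show ?thesis using False by simp
  qed
qed

text \<open>The sets in \<open>J\<close> may overlap, while independence is available for disjoint sets only. Each of
  them is a disjoint union of atoms, so that the counts on \<open>J\<close> are sums of the counts on the
  atoms, which are independent with known marginals.\<close>

lemma poisson_process_fidi:
  fixes \<eta> \<eta>' :: "'w \<Rightarrow> 'a measure"
  assumes "prob_space P" and eta: "poisson_process P S \<eta>" "poisson_process P S \<eta>'"
    and J: "finite J" "J \<subseteq> sets S" and A: "\<And>B. B \<in> J \<Longrightarrow> A B \<in> sets borel"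
  shows "emeasure P {\<omega>\<in>space P. \<forall>B\<in>J. emeasure (\<eta> \<omega>) B \<in> A B}
    = emeasure P {\<omega>\<in>space P. \<forall>B\<in>J. emeasure (\<eta>' \<omega>) B \<in> A B}"
proof -
  interpret prob_space P by fact
  obtain f0 and n :: nat where f0: "bij_betw f0 {..<n} (Pow J)"
    using ex_bij_betw_nat_finite[of "Pow J"] J(1) by (auto simp: atLeast0LessThan)
  \<comment> \<open>the value for \<open>i \<ge> n\<close> is immaterial, but it makes \<open>C i\<close> measurable for every \<open>i\<close>\<close>
  define f where "f i = (if i < n then f0 i else {})" for i
  have f: "bij_betw f {..<n} (Pow J)" using f0 by (subst bij_betw_cong[of _ _ f0]) (auto simp: f_def)
  have n: "{..<n} \<noteq> {}"
    using f by (metis Pow_not_empty bij_betw_empty1)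
  \<comment> \<open>the atoms of the algebra of sets generated by the members of \<open>J\<close>\<close>
  define C where "C i = space S \<inter> \<Inter>(f i) - \<Union>(J - f i)" for i
  have fJ: "f i \<subseteq> J" for i
    using bij_betwE[OF f, rule_format, of i] by (cases "i < n") (auto simp: f_def)
  have fin: "finite (f i)" for i using fJ[of i] J finite_subset by blast
  have C: "C i \<in> sets S" for i
  proof -
    have "space S \<inter> \<Inter>(f i) \<in> sets S"
    proof -
      have Inter: "space S \<inter> \<Inter>F \<in> sets S" if "finite F" "F \<subseteq> sets S" for F
        using that
      proof (induction F rule: finite_induct)
        case (insert B F)
        then have "B \<inter> (space S \<inter> \<Inter>F) \<in> sets S" by blast
        moreover have "B \<inter> (space S \<inter> \<Inter>F) = space S \<inter> \<Inter>(insert B F)" by auto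
        ultimately show ?case by simp
      qed simp
      show ?thesis by (rule Inter) (use fin[of i] fJ[of i] J(2) in auto)
    qed
    moreover have "\<Union>(J - f i) \<in> sets S" using J by (intro sets.finite_Union) auto
    ultimately show ?thesis unfolding C_def by blast
  qed
  have dis: "disjoint_family_on C {..<n}"
    unfolding disjoint_family_on_def
  proof (intro ballI impI)
    fix i j assume ij: "i \<in> {..<n}" "j \<in> {..<n}" "i \<noteq> j"
    then have "f i \<noteq> f j" using f by (auto simp: bij_betw_def inj_on_def)
    then show "C i \<inter> C j = {}" using fJ[of i] fJ[of j] ij unfolding C_def by blast
  qed
  define I where "I B = {i. i < n \<and> B \<in> f i}" for B
  have part: "B = (\<Union>i\<in>I B. C i)" if B: "B \<in> J" for B
  proof (intro set_eqI iffI)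
    fix x assume x: "x \<in> B"
    have "{D\<in>J. x \<in> D} \<in> Pow J" by blast
    then obtain i where i: "i < n" "f i = {D\<in>J. x \<in> D}" using f by (metis (no_types, lifting) bij_betw_iff_bijections lessThan_iff)
    have "x \<in> space S" using x B J(2) sets.sets_into_space by blast
    then have "x \<in> C i" unfolding C_def i(2) by auto
    moreover have "i \<in> I B" using i x B by (auto simp: I_def)
    ultimately show "x \<in> (\<Union>i\<in>I B. C i)" by blast
  qed (auto simp: C_def I_def)
  have sum: "emeasure \<mu> B = (\<Sum>i\<in>I B. emeasure \<mu> (C i))" if "B \<in> J" "point_measure_on S \<mu>" for \<mu> B
  proof -
    have "(\<Sum>i\<in>I B. emeasure \<mu> (C i)) = emeasure \<mu> (\<Union>i\<in>I B. C i)"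
      by (rule sum_emeasure)
        (use dis C point_measure_on_sets[OF that(2)] in \<open>auto simp: I_def disjoint_family_on_def\<close>)
    then show ?thesis using part[OF that(1)] by simp
  qed
  let ?Pi = "PiM {..<n} (\<lambda>_. borel) :: (nat \<Rightarrow> ennreal) measure"
  define Y where "Y = {x\<in>space ?Pi. \<forall>B\<in>J. (\<Sum>i\<in>I B. x i) \<in> A B}"
  have Y: "Y \<in> sets ?Pi"
    unfolding Y_def
  proof (rule sets.sets_Collect_finite_All[OF _ J(1)])
    fix B assume "B \<in> J"
    have [measurable]: "A B \<in> sets borel" by (rule A) fact
    have "(\<lambda>x. \<Sum>i\<in>I B. x i) \<in> borel_measurable ?Pi"
      by (intro borel_measurable_sum measurable_component_singleton) (auto simp: I_def)
    then show "{x\<in>space ?Pi. (\<Sum>i\<in>I B. x i) \<in> A B} \<in> sets ?Pi" by measurable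
  qed
  have law: "emeasure P {\<omega>\<in>space P. \<forall>B\<in>J. emeasure (\<zeta> \<omega>) B \<in> A B} =
      emeasure (PiM {..<n} (\<lambda>i. distr P borel (\<lambda>\<omega>. emeasure (\<zeta> \<omega>) (C i)))) Y"
    if z: "poisson_process P S \<zeta>" for \<zeta>
  proof -
    have rv: "random_variable borel (\<lambda>\<omega>. emeasure (\<zeta> \<omega>) (C i))" for i
      using z C[of i] by (auto simp: poisson_process_def)
    have pm: "point_measure_on S (\<zeta> \<omega>)" if "\<omega> \<in> space P" for \<omega>
      using z that by (auto simp: poisson_process_def)
    have "indep_vars (\<lambda>_. borel) (\<lambda>i \<omega>. emeasure (\<zeta> \<omega>) (C i)) {..<n}"
      using z C dis unfolding poisson_process_def by blast
    then have eq: "distr P ?Pi (\<lambda>\<omega>. \<lambda>i\<in>{..<n}. emeasure (\<zeta> \<omega>) (C i))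
        = PiM {..<n} (\<lambda>i. distr P borel (\<lambda>\<omega>. emeasure (\<zeta> \<omega>) (C i)))"
      using indep_vars_iff_distr_eq_PiM[OF n, where M' = "\<lambda>_. borel" and X = "\<lambda>i \<omega>. emeasure (\<zeta> \<omega>) (C i)"] rv by auto
    have m: "(\<lambda>\<omega>. \<lambda>i\<in>{..<n}. emeasure (\<zeta> \<omega>) (C i)) \<in> P \<rightarrow>\<^sub>M ?Pi"
      by (rule measurable_restrict) (use rv in auto)
    have "{\<omega>\<in>space P. \<forall>B\<in>J. emeasure (\<zeta> \<omega>) B \<in> A B}
        = (\<lambda>\<omega>. \<lambda>i\<in>{..<n}. emeasure (\<zeta> \<omega>) (C i)) -` Y \<inter> space P"
    proof -
      have "(\<Sum>i\<in>I B. (\<lambda>i\<in>{..<n}. emeasure (\<zeta> \<omega>) (C i)) i) = emeasure (\<zeta> \<omega>) B"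
        if "B \<in> J" "\<omega> \<in> space P" for B \<omega>
        using sum[OF that(1) pm[OF that(2)]] by (auto simp: I_def intro!: sum.cong)
      then show ?thesis using measurable_space[OF m] unfolding Y_def by auto
    qed
    then show ?thesis by (simp add: emeasure_distr[OF m Y, symmetric] eq)
  qed
  have "distr P borel (\<lambda>\<omega>. emeasure (\<eta> \<omega>) (C i)) = distr P borel (\<lambda>\<omega>. emeasure (\<eta>' \<omega>) (C i))"
    for i
  proof (rule measure_eqI)
    fix X assume "X \<in> sets (distr P borel (\<lambda>\<omega>. emeasure (\<eta> \<omega>) (C i)))"
    then have X: "X \<in> sets borel" by simp
    have m: "(\<lambda>\<omega>. emeasure (\<eta> \<omega>) (C i)) \<in> borel_measurable P" "(\<lambda>\<omega>. emeasure (\<eta>' \<omega>) (C i)) \<in> borel_measurable P"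
      using eta C[of i] by (auto simp: poisson_process_def)
    show "emeasure (distr P borel (\<lambda>\<omega>. emeasure (\<eta> \<omega>) (C i))) X
        = emeasure (distr P borel (\<lambda>\<omega>. emeasure (\<eta>' \<omega>) (C i))) X"
      using poisson_process_marginal[OF assms(1) eta(1) C[of i] X] poisson_process_marginal[OF assms(1) eta(2) C[of i] X]
      by (simp add: emeasure_distr m X vimage_def Int_def conj_commute)
  qed simp
  then have "PiM {..<n} (\<lambda>i. distr P borel (\<lambda>\<omega>. emeasure (\<eta> \<omega>) (C i)))
      = PiM {..<n} (\<lambda>i. distr P borel (\<lambda>\<omega>. emeasure (\<eta>' \<omega>) (C i)))"
    by (intro PiM_cong) auto
  then show ?thesis using law[OF eta(1)] law[OF eta(2)] by simp
qed

theorem poisson_process_law_unique: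
  assumes "prob_space P" and eta: "poisson_process P S \<eta>" "poisson_process P S \<eta>'"
  shows "distr P (config S) \<eta> = distr P (config S) \<eta>'"
proof -
  interpret prob_space P by fact
  define \<E> where "\<E> = {{\<mu>. point_measure_on S \<mu> \<and> (\<forall>B\<in>J. emeasure \<mu> B \<in> A B)} | J A.
    finite J \<and> J \<subseteq> sets S \<and> (\<forall>B. A B \<in> sets (borel :: ennreal measure))}"
  let ?\<Omega> = "{\<mu>. point_measure_on S \<mu>}"
  note m = poisson_process_measurable[OF eta(1)] poisson_process_measurable[OF eta(2)]
  have gen: "sets (config S) = sigma_sets ?\<Omega> \<E>"
  proof (rule antisym)
    show "sigma_sets ?\<Omega> \<E> \<subseteq> sets (config S)"
    proof (subst space_config[symmetric], rule sets.sigma_sets_subset, rule subsetI)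
      fix X assume "X \<in> \<E>"
      then obtain J A where X: "X = {\<mu>. point_measure_on S \<mu> \<and> (\<forall>B\<in>J. emeasure \<mu> B \<in> A B)}"
        "finite J" "J \<subseteq> sets S" "\<forall>B. A B \<in> sets (borel :: ennreal measure)" unfolding \<E>_def by blast
      have "{\<mu>\<in>space (config S). \<forall>B\<in>J. emeasure \<mu> B \<in> A B} \<in> sets (config S)"
      proof (rule sets.sets_Collect_finite_All[OF _ X(2)])
        fix B assume "B \<in> J"
        then have [measurable]: "(\<lambda>\<mu>. emeasure \<mu> B) \<in> borel_measurable (config S)" "A B \<in> sets borel"
          using X by (auto intro: measurable_emeasure_config)
        show "{\<mu>\<in>space (config S). emeasure \<mu> B \<in> A B} \<in> sets (config S)" by measurable
      qed
      then show "X \<in> sets (config S)" by (simp add: X(1) space_config)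
    qed
    have "{{\<mu>. point_measure_on S \<mu> \<and> emeasure \<mu> B \<in> A} | B A. B \<in> sets S \<and> A \<in> sets borel} \<subseteq> \<E>"
    proof clarify
      fix B and A :: "ennreal set" assume "B \<in> sets S" "A \<in> sets borel"
      then show "{\<mu>. point_measure_on S \<mu> \<and> emeasure \<mu> B \<in> A} \<in> \<E>"
        unfolding \<E>_def by (intro CollectI exI[of _ "{B}"] exI[of _ "\<lambda>_. A"]) auto
    qed
    then show "sets (config S) \<subseteq> sigma_sets ?\<Omega> \<E>"
      unfolding config_def by (subst sets_measure_of) (blast, rule sigma_sets_mono')
  qed
  show ?thesis
  proof (rule measure_eqI_generator_eq[where E = \<E> and \<Omega> = ?\<Omega> and A = "\<lambda>_. ?\<Omega>"])
    show "Int_stable \<E>"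
    proof (rule Int_stableI)
      fix X Y assume "X \<in> \<E>" "Y \<in> \<E>"
      then obtain J A J' A' where X: "X = {\<mu>. point_measure_on S \<mu> \<and> (\<forall>B\<in>J. emeasure \<mu> B \<in> A B)}"
        "finite J" "J \<subseteq> sets S" "\<forall>B. A B \<in> sets (borel :: ennreal measure)"
        and Y: "Y = {\<mu>. point_measure_on S \<mu> \<and> (\<forall>B\<in>J'. emeasure \<mu> B \<in> A' B)}"
        "finite J'" "J' \<subseteq> sets S" "\<forall>B. A' B \<in> sets (borel :: ennreal measure)" unfolding \<E>_def by blast
      define D where "D B = (if B \<in> J then A B else UNIV) \<inter> (if B \<in> J' then A' B else UNIV)" for B
      have "X \<inter> Y = {\<mu>. point_measure_on S \<mu> \<and> (\<forall>B\<in>J \<union> J'. emeasure \<mu> B \<in> D B)}"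
        unfolding X(1) Y(1) D_def by auto
      moreover have "\<forall>B. D B \<in> sets borel" using X Y by (auto simp: D_def)
      ultimately show "X \<inter> Y \<in> \<E>" unfolding \<E>_def using X Y
        by (intro CollectI exI[of _ "J \<union> J'"] exI[of _ D]) auto
    qed
    show "\<E> \<subseteq> Pow ?\<Omega>" unfolding \<E>_def by blast
    fix X assume "X \<in> \<E>"
    then obtain J A where X: "X = {\<mu>. point_measure_on S \<mu> \<and> (\<forall>B\<in>J. emeasure \<mu> B \<in> A B)}"
      "finite J" "J \<subseteq> sets S" "\<forall>B. A B \<in> sets (borel :: ennreal measure)" unfolding \<E>_def by blast
    have XE: "X \<in> sets (config S)" unfolding gen using \<open>X \<in> \<E>\<close> by (rule sigma_sets.Basic)
    have pre: "\<zeta> -` X \<inter> space P = {\<omega>\<in>space P. \<forall>B\<in>J. emeasure (\<zeta> \<omega>) B \<in> A B}"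
      if "poisson_process P S \<zeta>" for \<zeta>
      using that unfolding X(1) poisson_process_def by auto
    show "emeasure (distr P (config S) \<eta>) X = emeasure (distr P (config S) \<eta>') X"
      using poisson_process_fidi[OF assms(1) eta X(2,3), of A] X(4)
      by (simp add: emeasure_distr m XE pre eta)
  next
    show "range (\<lambda>_. ?\<Omega>) \<subseteq> \<E>"
      unfolding \<E>_def by (auto intro!: exI[of _ "{}"] exI[of _ "\<lambda>_. UNIV"])
    show "(\<Union>i::nat. ?\<Omega>) = ?\<Omega>" by simp
    interpret d: prob_space "distr P (config S) \<eta>" by (rule prob_space_distr) (rule m)
    show "emeasure (distr P (config S) \<eta>) ?\<Omega> \<noteq> \<infinity>" for i :: nat by simp
  qed (simp_all add: gen)
qed

section \<open>Measure-preserving maps of the state space\<close>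

text \<open>The target sigma-algebra is that of \<open>\<mu>\<close> itself, so that the state space need not be carried
  along.\<close>

definition push :: "('a \<Rightarrow> 'a) \<Rightarrow> 'a measure \<Rightarrow> 'a measure" where
  "push T \<mu> = distr \<mu> \<mu> T"

lemma point_measure_on_push:
  assumes T: "T \<in> S \<rightarrow>\<^sub>M S" and mu: "point_measure_on S \<mu>"
  shows "point_measure_on S (push T \<mu>)"
proof -
  obtain I :: "nat set" and X where X: "X ` I \<subseteq> space S" "\<mu> = distr (count_space I) S X"
    using mu unfolding point_measure_on_def by blast
  have Xm: "X \<in> count_space I \<rightarrow>\<^sub>M S" using X by (auto simp: measurable_count_space_eq1)
  have "push T \<mu> = distr (distr (count_space I) S X) S T"
    unfolding push_def X(2) by (rule distr_cong) auto
  also have "\<dots> = distr (count_space I) S (T \<circ> X)" by (rule distr_distr[OF T Xm])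
  finally show ?thesis
    unfolding point_measure_on_def using X measurable_space[OF T]
    by (intro exI[of _ I] exI[of _ "T \<circ> X"]) auto
qed

lemma emeasure_push:
  assumes "T \<in> S \<rightarrow>\<^sub>M S" "point_measure_on S \<mu>" "B \<in> sets S"
  shows "emeasure (push T \<mu>) B = emeasure \<mu> (T -` B \<inter> space S)"
proof -
  have eq: "sets \<mu> = sets S" "space \<mu> = space S"
    using assms(2) by (simp_all add: point_measure_on_sets point_measure_on_space)
  have "T \<in> \<mu> \<rightarrow>\<^sub>M \<mu>" using assms(1) by (simp only: measurable_cong_sets[OF eq(1) eq(1)])
  then show ?thesis unfolding push_def using assms(3) by (simp add: emeasure_distr eq)
qed

lemma poisson_process_push:
  assumes P: "prob_space P" and eta: "poisson_process P S \<eta>"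
    and T: "T \<in> S \<rightarrow>\<^sub>M S" and pres: "\<And>B. B \<in> sets S \<Longrightarrow> emeasure S (T -` B \<inter> space S) = emeasure S B"
  shows "poisson_process P S (\<lambda>\<omega>. push T (\<eta> \<omega>))"
proof -
  interpret prob_space P by fact
  have pm: "point_measure_on S (\<eta> \<omega>)" if "\<omega> \<in> space P" for \<omega> using eta that by (auto simp: poisson_process_def)
  have e: "emeasure (push T (\<eta> \<omega>)) B = emeasure (\<eta> \<omega>) (T -` B \<inter> space S)" if "\<omega> \<in> space P" "B \<in> sets S" for \<omega> B
    by (rule emeasure_push[OF T pm[OF that(1)] that(2)])
  have TB: "T -` B \<inter> space S \<in> sets S" if "B \<in> sets S" for B using T that by (rule measurable_sets)
  have mp: "measure S (T -` B \<inter> space S) = measure S B" if "B \<in> sets S" for B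
    by (simp add: measure_def pres[OF that])
  have eF: "prob {\<omega>\<in>space P. emeasure (\<eta> \<omega>) B = of_nat k} = measure S B ^ k / fact k * exp (- measure S B)"
    if "B \<in> sets S" "emeasure S B < \<infinity>" for B and k :: nat
    using eta that unfolding poisson_process_def by blast
  have me: "(\<lambda>\<omega>. emeasure (push T (\<eta> \<omega>)) B) \<in> borel_measurable P" if B: "B \<in> sets S" for B
  proof -
    have "(\<lambda>\<omega>. emeasure (push T (\<eta> \<omega>)) B) \<in> borel_measurable P \<longleftrightarrow>
        (\<lambda>\<omega>. emeasure (\<eta> \<omega>) (T -` B \<inter> space S)) \<in> borel_measurable P"
      by (rule measurable_cong) (rule e[OF _ B])
    then show ?thesis using eta TB[OF B] by (auto simp: poisson_process_def)
  qed
  show ?thesis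
    unfolding poisson_process_def
  proof (intro conjI ballI allI impI)
    fix \<omega> assume "\<omega> \<in> space P" then show "point_measure_on S (push T (\<eta> \<omega>))"
      by (intro point_measure_on_push T pm)
  next
    fix B assume B: "B \<in> sets S"
    show "(\<lambda>\<omega>. emeasure (push T (\<eta> \<omega>)) B) \<in> borel_measurable P" by (rule me[OF B])
  next
    fix B k assume B: "B \<in> sets S" "emeasure S B < \<infinity>"
    have "{\<omega>\<in>space P. emeasure (push T (\<eta> \<omega>)) B = of_nat k} = {\<omega>\<in>space P. emeasure (\<eta> \<omega>) (T -` B \<inter> space S) = of_nat k}"
      using e[OF _ B(1)] by auto
    then show "prob {\<omega>\<in>space P. emeasure (push T (\<eta> \<omega>)) B = of_nat k} = measure S B ^ k / fact k * exp (- measure S B)"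
      using eF[OF TB[OF B(1)], of k] B(2) by (simp only: pres[OF B(1)] mp[OF B(1)])
  next
    fix B assume B: "B \<in> sets S" "emeasure S B = \<infinity>"
    then have "AE \<omega> in P. emeasure (\<eta> \<omega>) (T -` B \<inter> space S) = \<infinity>"
      using eta TB[OF B(1)] pres[OF B(1)] by (auto simp: poisson_process_def)
    moreover have "AE \<omega> in P. \<omega> \<in> space P" by (rule AE_space)
    ultimately show "AE \<omega> in P. emeasure (push T (\<eta> \<omega>)) B = \<infinity>"
      by eventually_elim (simp add: e B)
  next
    fix n :: nat and B assume B: "B ` {..<n} \<subseteq> sets S \<and> disjoint_family_on B {..<n}"
    have "(\<lambda>i. T -` B i \<inter> space S) ` {..<n} \<subseteq> sets S" using B TB by auto
    moreover have "disjoint_family_on (\<lambda>i. T -` B i \<inter> space S) {..<n}"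
      unfolding disjoint_family_on_def
    proof (intro ballI impI)
      fix i j assume "i \<in> {..<n}" "j \<in> {..<n}" "i \<noteq> j"
      then have "B i \<inter> B j = {}" using B by (auto simp: disjoint_family_on_def)
      then show "(T -` B i \<inter> space S) \<inter> (T -` B j \<inter> space S) = {}" by blast
    qed
    ultimately have i: "indep_vars (\<lambda>_. borel) (\<lambda>i \<omega>. emeasure (\<eta> \<omega>) (T -` B i \<inter> space S)) {..<n}"
      using eta unfolding poisson_process_def by blast
    show "indep_vars (\<lambda>_. borel) (\<lambda>i \<omega>. emeasure (push T (\<eta> \<omega>)) (B i)) {..<n}"
      unfolding indep_vars_def2
    proof (intro conjI ballI)
      show "random_variable borel (\<lambda>\<omega>. emeasure (push T (\<eta> \<omega>)) (B i))" if "i \<in> {..<n}" for i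
        using me[of "B i"] B that by auto
      have "{(\<lambda>\<omega>. emeasure (push T (\<eta> \<omega>)) (B i)) -` A \<inter> space P | A. A \<in> sets borel}
          = {(\<lambda>\<omega>. emeasure (\<eta> \<omega>) (T -` B i \<inter> space S)) -` A \<inter> space P | A. A \<in> sets borel}"
        if "i \<in> {..<n}" for i
      proof -
        have "(\<lambda>\<omega>. emeasure (push T (\<eta> \<omega>)) (B i)) -` A \<inter> space P
            = (\<lambda>\<omega>. emeasure (\<eta> \<omega>) (T -` B i \<inter> space S)) -` A \<inter> space P" for A
          using e[of _ "B i"] B that by auto
        then show ?thesis by simp
      qed
      then show "indep_sets (\<lambda>i. {(\<lambda>\<omega>. emeasure (push T (\<eta> \<omega>)) (B i)) -` A \<inter> space P | A. A \<in> sets borel}) {..<n}"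
        using i unfolding indep_vars_def2 by (subst indep_sets_cong[OF refl]) auto
    qed
  qed
qed

section \<open>Random concave functions\<close>

text \<open>Preimages of open sets under such a functional are open in the seminorm, that is, generators
  of the sigma-algebra.\<close>

lemma L1_functional_measurable:
  fixes F :: "('a::euclidean_space \<Rightarrow> real) \<Rightarrow> real"
  assumes lip: "\<And>f h. f \<in> L1_tilde \<Longrightarrow> h \<in> L1_tilde \<Longrightarrow> \<bar>F h - F f\<bar> \<le> (\<integral>x. \<bar>h x - f x\<bar> \<partial>lborel)"
  shows "F \<in> borel_measurable L1_tilde_borel"
proof (rule borel_measurableI)
  fix S :: "real set" assume S: "open S"
  let ?G = "{U. U \<subseteq> L1_tilde \<and>
         (\<forall>f\<in>U. \<exists>\<epsilon>>0. \<forall>h\<in>L1_tilde. (\<integral>x. \<bar>h x - f x\<bar> \<partial>lborel) < \<epsilon> \<longrightarrow> h \<in> U)} :: ('a \<Rightarrow> real) set set"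
  have sp: "space L1_tilde_borel = (L1_tilde :: ('a \<Rightarrow> real) set)"
    unfolding L1_tilde_borel_def by (rule space_measure_of) auto
  have "F -` S \<inter> L1_tilde \<in> ?G"
  proof (intro CollectI conjI ballI)
    fix f assume "f \<in> F -` S \<inter> L1_tilde"
    then have f: "F f \<in> S" "f \<in> L1_tilde" by auto
    then obtain e where e: "e > 0" "\<And>y. dist y (F f) < e \<Longrightarrow> y \<in> S" using S by (metis open_dist)
    show "\<exists>\<epsilon>>0. \<forall>h\<in>L1_tilde. (\<integral>x. \<bar>h x - f x\<bar> \<partial>lborel) < \<epsilon> \<longrightarrow> h \<in> F -` S \<inter> L1_tilde"
    proof (intro exI[of _ e] conjI ballI impI)
      fix h assume h: "h \<in> L1_tilde" "(\<integral>x. \<bar>h x - f x\<bar> \<partial>lborel) < e"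
      then have "dist (F h) (F f) < e" using lip[OF f(2) h(1)] by (simp add: dist_real_def)
      then show "h \<in> F -` S \<inter> L1_tilde" using e(2) h(1) by simp
    qed (rule e(1))
  qed simp
  then show "F -` S \<inter> space L1_tilde_borel \<in> sets L1_tilde_borel"
    unfolding sp unfolding L1_tilde_borel_def by (rule in_measure_of[rotated]) auto
qed

locale shot_noise_model =
  fixes Q :: "'m measure" and \<gamma> u :: real and g :: "'m \<Rightarrow> 'a::euclidean_space \<Rightarrow> real"
  assumes Q: "prob_space Q"
    and g_measurable: "g \<in> Q \<rightarrow>\<^sub>M L1_tilde_borel"
    and g_nonneg: "\<And>m x. m \<in> space Q \<Longrightarrow> 0 \<le> g m x"
    and grain_nonempty: "\<And>m. m \<in> space Q \<Longrightarrow> grain g m \<noteq> {}"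
    and g_concave: "\<And>m. m \<in> space Q \<Longrightarrow> concave_on (grain g m) (g m)"
    and grain_pos: "\<And>m. m \<in> space Q \<Longrightarrow> measure lborel (grain g m) > 0"
    and moments: "\<And>i. i \<in> {1..DIM('a)} \<Longrightarrow> integrable Q (\<lambda>m. intrinsic_volume i (grain g m))"
begin

sublocale Q: prob_space Q by (rule Q)

lemma g_L1: assumes "m \<in> space Q" shows "g m \<in> L1_tilde"
proof -
  have "space L1_tilde_borel = (L1_tilde :: ('a \<Rightarrow> real) set)"
    unfolding L1_tilde_borel_def by (rule space_measure_of) blast
  then show ?thesis using measurable_space[OF g_measurable assms] by simp
qed

lemma support_eq: assumes "m \<in> space Q" shows "closure {x. g m x \<noteq> 0} = grain g m"
proof -
  have "g m x \<noteq> 0 \<longleftrightarrow> g m x > 0" for x using g_nonneg[OF assms, of x] by linarith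
  then have "{x. g m x \<noteq> 0} = {x. g m x > 0}" by (intro Collect_cong)
  then show ?thesis unfolding grain_def by (rule arg_cong)
qed

lemma
  assumes m: "m \<in> space Q"
  shows grain_compact: "compact (grain g m)" and grain_convex: "convex (grain g m)"
    and g_continuous: "continuous_on (grain g m) (g m)"
  using g_L1[OF m] unfolding L1_tilde_def mem_Collect_eq support_eq[OF m] by simp_all

lemma g_outside: "m \<in> space Q \<Longrightarrow> y \<notin> grain g m \<Longrightarrow> g m y = 0"
  using support_eq[of m] closure_subset[of "{x. g m x \<noteq> 0}"] by auto

text \<open>A convex set of positive volume has interior points, and a closed convex set with interior
  points is the closure of its interior. Everything about \<open>g m\<close> that is needed pointwise can
  therefore be seen on sets of positive measure, which the seminorm detects.\<close>

lemma grain_regular: assumes m: "m \<in> space Q" shows "closure (interior (grain g m)) = grain g m"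
proof -
  have "interior (grain g m) \<noteq> {}"
  proof
    assume "interior (grain g m) = {}"
    then have "negligible (grain g m)" using negligible_convex_interior[OF grain_convex[OF m]] by simp
    then have "measure lebesgue (grain g m) = 0" by (rule negligible_imp_measure0)
    moreover have "measure lebesgue (grain g m) = measure lborel (grain g m)"
      by (rule measure_completion) (simp add: grain_compact[OF m] compact_imp_closed borel_closed)
    ultimately show False using grain_pos[OF m] by simp
  qed
  then show ?thesis
    using convex_closure_interior[OF grain_convex[OF m]] grain_compact[OF m]
    by (simp add: compact_imp_closed)
qed

lemma superlevel_contains_open:
  assumes m: "m \<in> space Q" and U: "open U" "z \<in> U" and c: "0 \<le> c" "c < g m z"
  obtains V where "open V" "V \<noteq> {}" "V \<subseteq> U" "\<And>v. v \<in> V \<Longrightarrow> c < g m v"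
proof -
  let ?K = "grain g m"
  have "openin (top_of_set ?K) (?K \<inter> g m -` {c<..})"
    by (rule continuous_openin_preimage_gen[OF g_continuous[OF m]]) simp
  then obtain T where T: "open T" "?K \<inter> g m -` {c<..} = ?K \<inter> T" by (auto simp: openin_open)
  have "z \<in> ?K" using c g_outside[OF m, of z] by fastforce
  then have z: "z \<in> T \<inter> U" "z \<in> closure (interior ?K)" using T c U grain_regular[OF m] by auto
  have "open (T \<inter> U)" using T U by auto
  then have "(T \<inter> U) \<inter> interior ?K \<noteq> {}" using z open_Int_closure_eq_empty by blast
  moreover have "open ((T \<inter> U) \<inter> interior ?K)" using \<open>open (T \<inter> U)\<close> by auto
  moreover have "c < g m v" if "v \<in> (T \<inter> U) \<inter> interior ?K" for v
  proof -
    have "v \<in> ?K \<inter> T" using that interior_subset by blast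
    then have "v \<in> ?K \<inter> g m -` {c<..}" by (simp only: T(2))
    then show ?thesis by simp
  qed
  ultimately show ?thesis using that[of "(T \<inter> U) \<inter> interior ?K"] by blast
qed

text \<open>Upper semicontinuity: on its closed support \<open>g m\<close> is continuous, and it drops to the
  smallest value 0 outside.\<close>

lemma g_usc:
  assumes m: "m \<in> space Q" and "0 < \<epsilon>"
  obtains \<delta> where "\<delta> > 0" "\<And>z. dist x z < \<delta> \<Longrightarrow> g m z < g m x + \<epsilon>"
proof (cases "x \<in> grain g m")
  case True
  obtain \<delta> where d: "\<delta> > 0" "\<And>z. z \<in> grain g m \<Longrightarrow> dist z x < \<delta> \<Longrightarrow> dist (g m z) (g m x) < \<epsilon>"
    using g_continuous[OF m] True \<open>0 < \<epsilon>\<close> unfolding continuous_on_iff by blast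
  show ?thesis
  proof (rule that[OF d(1)])
    fix z assume z: "dist x z < \<delta>"
    show "g m z < g m x + \<epsilon>"
    proof (cases "z \<in> grain g m")
      case True
      then show ?thesis using d(2)[OF True] z by (simp add: dist_commute dist_real_def)
    next
      case False
      then show ?thesis using g_outside[OF m False] g_nonneg[OF m, of x] \<open>0 < \<epsilon>\<close> by simp
    qed
  qed
next
  case False
  have "open (- grain g m)" using grain_compact[OF m] compact_imp_closed by blast
  then obtain \<delta> where d: "\<delta> > 0" "ball x \<delta> \<subseteq> - grain g m" using False by (metis ComplI open_contains_ball)
  show ?thesis
  proof (rule that[OF d(1)])
    fix z assume "dist x z < \<delta>"
    then have "z \<notin> grain g m" using d(2) by auto
    then show "g m z < g m x + \<epsilon>" using g_outside[OF m] g_nonneg[OF m, of x] \<open>0 < \<epsilon>\<close> by simp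
  qed
qed

text \<open>By \<open>superlevel_contains_open\<close>, \<open>g m\<close> exceeds \<open>c\<close> somewhere in \<open>U\<close> if and only if the
  integral of the excess over \<open>U\<close> is positive. This integral is a Lipschitz functional of \<open>g m\<close>,
  whereas evaluation at a point is not continuous in the seminorm.\<close>

lemma superlevel_hit_measurable:
  assumes U: "open U" and c: "0 \<le> c"
  shows "{m\<in>space Q. \<exists>z\<in>U. c < g m z} \<in> sets Q"
proof -
  define F where "F f = (\<integral>x. indicator U x * max 0 (f x - c) \<partial>lborel)" for f :: "'a \<Rightarrow> real"
  have [measurable]: "U \<in> sets borel" using U by simp
  have int: "integrable lborel (\<lambda>x. indicator U x * max 0 (f x - c))" if "f \<in> L1_tilde" for f :: "'a \<Rightarrow> real"
  proof (rule Bochner_Integration.integrable_bound)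
    show "integrable lborel f" using that by (simp add: L1_tilde_def)
    then have [measurable]: "f \<in> borel_measurable borel" by auto
    show "(\<lambda>x. indicator U x * max 0 (f x - c)) \<in> borel_measurable lborel" by measurable
    show "AE x in lborel. norm (indicator U x * max 0 (f x - c)) \<le> norm (f x)"
      using c by (auto simp: indicator_def)
  qed
  have "F \<in> borel_measurable L1_tilde_borel"
  proof (rule L1_functional_measurable)
    fix f h :: "'a \<Rightarrow> real" assume f: "f \<in> L1_tilde" and h: "h \<in> L1_tilde"
    have i: "integrable lborel (\<lambda>x. \<bar>h x - f x\<bar>)"
      using f h by (auto simp: L1_tilde_def)
    have "F h - F f = (\<integral>x. indicator U x * max 0 (h x - c) - indicator U x * max 0 (f x - c) \<partial>lborel)"
      unfolding F_def by (rule Bochner_Integration.integral_diff[symmetric]) (rule int[OF h], rule int[OF f])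
    also have "\<bar>\<dots>\<bar> \<le> (\<integral>x. \<bar>indicator U x * max 0 (h x - c) - indicator U x * max 0 (f x - c)\<bar> \<partial>lborel)"
      by (rule integral_abs_bound)
    also have "\<dots> \<le> (\<integral>x. \<bar>h x - f x\<bar> \<partial>lborel)"
      by (rule integral_mono[OF integrable_abs[OF Bochner_Integration.integrable_diff[OF int[OF h] int[OF f]]] i])
        (auto simp: indicator_def)
    finally show "\<bar>F h - F f\<bar> \<le> (\<integral>x. \<bar>h x - f x\<bar> \<partial>lborel)" .
  qed
  then have [measurable]: "(\<lambda>m. F (g m)) \<in> borel_measurable Q"
    using g_measurable by (rule measurable_compose[rotated])
  have "0 < F (g m) \<longleftrightarrow> (\<exists>z\<in>U. c < g m z)" if m: "m \<in> space Q" for m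
  proof
    assume "0 < F (g m)"
    show "\<exists>z\<in>U. c < g m z"
    proof (rule ccontr)
      assume "\<not> ?thesis"
      then have *: "indicator U x * max 0 (g m x - c) = 0" for x by (auto simp: indicator_def max_def)
      have "F (g m) = (LINT x::'a|lborel. 0)"
        unfolding F_def by (rule Bochner_Integration.integral_cong[OF refl]) (rule *)
      then have "F (g m) = 0" by simp
      then show False using \<open>0 < F (g m)\<close> by simp
    qed
  next
    assume "\<exists>z\<in>U. c < g m z"
    then obtain z where z: "z \<in> U" "c < g m z" by blast
    obtain V where V: "open V" "V \<noteq> {}" "V \<subseteq> U" "\<And>v. v \<in> V \<Longrightarrow> c < g m v"
      using superlevel_contains_open[OF m U z(1) c z(2)] by blast
    have "F (g m) \<ge> 0" unfolding F_def by (rule integral_nonneg_AE) simp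
    moreover have "F (g m) \<noteq> 0"
    proof
      assume "F (g m) = 0"
      then have "AE x in lborel. indicator U x * max 0 (g m x - c) = 0"
        unfolding F_def using integral_nonneg_eq_0_iff_AE[OF int[OF g_L1[OF m]]] by simp
      then have "AE x in lborel. x \<notin> V"
        by eventually_elim (use V(3,4) in \<open>fastforce simp: indicator_def max_def split: if_splits\<close>)
      then have "emeasure lborel V = 0"
        using V(1) by (subst (asm) AE_iff_measurable[where N = V]) auto
      then have "V \<in> null_sets lborel" using V(1) by auto
      then have "negligible V" by (simp add: negligible_iff_null_sets null_sets_completionI)
      then show False using open_not_negligible V by blast
    qed
    ultimately show "0 < F (g m)" by simp
  qed
  then have "{m\<in>space Q. \<exists>z\<in>U. c < g m z} = {m\<in>space Q. 0 < F (g m)}" by auto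
  also have "\<dots> \<in> sets Q" by measurable
  finally show ?thesis .
qed

text \<open>A point of the ball around \<open>x\<close> also lies in a slightly smaller ball around a nearby point
  \<open>p\<close> of a countable dense set; so the set is a countable union of measurable rectangles.\<close>

lemma joint_hit_measurable:
  assumes c: "0 \<le> c"
  shows "{w\<in>space (borel \<Otimes>\<^sub>M Q). \<exists>z\<in>ball (fst w) r. c < g (snd w) z} \<in> sets (borel \<Otimes>\<^sub>M Q)"
proof -
  obtain D :: "'a set" where D: "countable D" "\<And>X. open X \<Longrightarrow> X \<noteq> {} \<Longrightarrow> \<exists>d\<in>D. d \<in> X"
    using countable_dense_setE by blast
  define B where "B p n = ball p (1 / Suc n) \<times> {m\<in>space Q. \<exists>z\<in>ball p (r - 1 / Suc n). c < g m z}"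
    for p :: 'a and n :: nat
  have "{w\<in>space (borel \<Otimes>\<^sub>M Q). \<exists>z\<in>ball (fst w) r. c < g (snd w) z} = (\<Union>p\<in>D. \<Union>n. B p n)"
  proof (intro set_eqI iffI)
    fix w assume w: "w \<in> {w\<in>space (borel \<Otimes>\<^sub>M Q). \<exists>z\<in>ball (fst w) r. c < g (snd w) z}"
    obtain x m where xm: "w = (x, m)" by (cases w)
    then obtain z where z: "m \<in> space Q" "dist x z < r" "c < g m z" using w by (auto simp: space_pair_measure)
    define \<delta> where "\<delta> = r - dist x z"
    have "\<delta> > 0" using z by (simp add: \<delta>_def)
    then obtain n :: nat where n: "1 / Suc n < \<delta> / 2" using nat_approx_posE[of "\<delta> / 2"] by auto
    have "ball x (1 / Suc n) \<noteq> {}" by simp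
    then obtain p where p: "p \<in> D" "dist x p < 1 / Suc n" using D(2)[OF open_ball] by (metis mem_ball)
    have "dist p z \<le> dist x p + dist x z" by (metis dist_commute dist_triangle)
    also have "\<dots> < r - 1 / Suc n" using p(2) n by (simp add: \<delta>_def)
    finally have "(x, m) \<in> B p n" unfolding B_def using z p(2) by (auto simp: dist_commute)
    then show "w \<in> (\<Union>p\<in>D. \<Union>n. B p n)" using p(1) xm by blast
  next
    fix w assume "w \<in> (\<Union>p\<in>D. \<Union>n. B p n)"
    then obtain p n where pn: "w \<in> B p n" by blast
    obtain x m where xm: "w = (x, m)" by (cases w)
    obtain z where z: "dist p x < 1 / Suc n" "m \<in> space Q" "dist p z < r - 1 / Suc n" "c < g m z"
      using pn unfolding xm B_def by auto
    have "dist x z \<le> dist p x + dist p z" by (metis dist_commute dist_triangle)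
    then have "dist x z < r" using z by linarith
    then show "w \<in> {w\<in>space (borel \<Otimes>\<^sub>M Q). \<exists>z\<in>ball (fst w) r. c < g (snd w) z}"
      using z xm by (auto simp: space_pair_measure)
  qed
  moreover have "B p n \<in> sets (borel \<Otimes>\<^sub>M Q)" for p n
    unfolding B_def by (intro pair_measureI superlevel_hit_measurable c) auto
  then have "(\<Union>p\<in>D. \<Union>n. B p n) \<in> sets (borel \<Otimes>\<^sub>M Q)"
    using D(1) by (intro sets.countable_UN') auto
  ultimately show ?thesis by simp
qed

text \<open>Passing to suprema over small balls gives upper approximations of \<open>g m\<close> that decrease to it
  by upper semicontinuity, and that can be compared at nearby points.\<close>

definition local_sup :: "real \<Rightarrow> 'a \<times> 'm \<Rightarrow> ennreal" where
  "local_sup r w = (SUP z\<in>ball (fst w) r. ennreal (g (snd w) z))"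

lemma local_sup_measurable: "local_sup r \<in> borel_measurable (borel \<Otimes>\<^sub>M Q)"
proof (rule borel_measurableI_greater)
  fix c :: ennreal
  show "{w\<in>space (borel \<Otimes>\<^sub>M Q). c < local_sup r w} \<in> sets (borel \<Otimes>\<^sub>M Q)"
  proof (cases c)
    case top
    then show ?thesis by simp
  next
    case (real c')
    have "{w\<in>space (borel \<Otimes>\<^sub>M Q). c < local_sup r w}
        = {w\<in>space (borel \<Otimes>\<^sub>M Q). \<exists>z\<in>ball (fst w) r. c' < g (snd w) z}"
      using real unfolding local_sup_def less_SUP_iff by (auto simp: ennreal_less_iff)
    then show ?thesis using joint_hit_measurable real(1) by simp
  qed
qed

lemma g_joint_measurable: "(\<lambda>w. ennreal (g (snd w) (fst w))) \<in> borel_measurable (borel \<Otimes>\<^sub>M Q)"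
proof -
  have eq: "ennreal (g (snd w) (fst w)) = (INF n::nat. local_sup (1 / Suc n) w)"
    if w: "w \<in> space (borel \<Otimes>\<^sub>M Q)" for w
  proof (rule antisym)
    show "ennreal (g (snd w) (fst w)) \<le> (INF n::nat. local_sup (1 / Suc n) w)"
      unfolding local_sup_def by (intro INF_greatest SUP_upper) simp
    have m: "snd w \<in> space Q" using w by (auto simp: space_pair_measure)
    show "(INF n::nat. local_sup (1 / Suc n) w) \<le> ennreal (g (snd w) (fst w))"
    proof (rule ennreal_le_epsilon)
      fix e :: real assume e: "0 < e"
      obtain \<delta> where d: "\<delta> > 0" "\<And>z. dist (fst w) z < \<delta> \<Longrightarrow> g (snd w) z < g (snd w) (fst w) + e"
        using g_usc[OF m e] by blast
      obtain n :: nat where n: "1 / Suc n < \<delta>" using nat_approx_posE[OF d(1)] by auto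
      have "(INF n::nat. local_sup (1 / Suc n) w) \<le> local_sup (1 / Suc n) w" by (rule INF_lower) simp
      also have "\<dots> \<le> ennreal (g (snd w) (fst w) + e)"
        unfolding local_sup_def
      proof (rule SUP_least)
        fix z assume "z \<in> ball (fst w) (1 / Suc n)"
        then have "dist (fst w) z < \<delta>" using n by (simp only: mem_ball)
        then show "ennreal (g (snd w) z) \<le> ennreal (g (snd w) (fst w) + e)"
          using d(2) by (intro ennreal_leI) (simp add: less_imp_le)
      qed
      also have "\<dots> = ennreal (g (snd w) (fst w)) + ennreal e"
        using g_nonneg[OF m] e by (simp add: ennreal_plus)
      finally show "(INF n::nat. local_sup (1 / Suc n) w) \<le> ennreal (g (snd w) (fst w)) + ennreal e" .
    qed
  qed
  have "(\<lambda>w. INF n::nat. local_sup (1 / Suc n) w) \<in> borel_measurable (borel \<Otimes>\<^sub>M Q)"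
    by (intro borel_measurable_INF local_sup_measurable) auto
  then show ?thesis by (subst measurable_cong[OF eq])
qed

definition intensity :: "('a \<times> 'm) measure" where
  "intensity = scale_measure (ennreal \<gamma>) lborel \<Otimes>\<^sub>M Q"

lemma sets_intensity: "sets intensity = sets (borel \<Otimes>\<^sub>M Q)"
  unfolding intensity_def by (rule sets_pair_measure_cong) auto

lemma space_intensity: "space intensity = UNIV \<times> space Q"
  unfolding intensity_def by (simp add: space_pair_measure space_scale_measure)

lemma measurable_intensity: "borel_measurable intensity = borel_measurable (borel \<Otimes>\<^sub>M Q)"
  by (rule measurable_cong_sets[OF sets_intensity refl])

text \<open>The pairs \<open>(x, m)\<close> for which the translate of \<open>{z. 0 < g m z}\<close> by \<open>x\<close> meets the open ball of
  radius \<open>R\<close> about the origin.\<close>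

definition hit_ball :: "real \<Rightarrow> ('a \<times> 'm) set" where
  "hit_ball R = {w\<in>UNIV \<times> space Q. \<exists>z\<in>ball (- fst w) R. 0 < g (snd w) z}"

lemma hit_ball_sets: "hit_ball R \<in> sets intensity"
proof -
  let ?T = "\<lambda>w::'a \<times> 'm. (- fst w, snd w)"
  have "?T \<in> borel \<Otimes>\<^sub>M Q \<rightarrow>\<^sub>M borel \<Otimes>\<^sub>M Q" by measurable
  from measurable_sets[OF this joint_hit_measurable[of 0 R]]
  have "?T -` {w\<in>space (borel \<Otimes>\<^sub>M Q). \<exists>z\<in>ball (fst w) R. 0 < g (snd w) z} \<inter> space (borel \<Otimes>\<^sub>M Q) \<in> sets intensity"
    by (simp add: sets_intensity)
  moreover have "?T -` {w\<in>space (borel \<Otimes>\<^sub>M Q). \<exists>z\<in>ball (fst w) R. 0 < g (snd w) z} \<inter> space (borel \<Otimes>\<^sub>M Q) = hit_ball R"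
    by (auto simp: hit_ball_def space_pair_measure)
  ultimately show ?thesis by simp
qed

lemma sigma_finite_scaled_lborel: "sigma_finite_measure (scale_measure (ennreal \<gamma>) (lborel :: 'a measure))"
proof
  show "\<exists>A. countable A \<and> A \<subseteq> sets (scale_measure (ennreal \<gamma>) (lborel :: 'a measure)) \<and>
      \<Union>A = space (scale_measure (ennreal \<gamma>) (lborel :: 'a measure)) \<and>
      (\<forall>a\<in>A. emeasure (scale_measure (ennreal \<gamma>) lborel) a \<noteq> \<infinity>)"
  proof (intro exI[of _ "range (\<lambda>n::nat. cball (0::'a) (real n))"] conjI ballI)
    show "\<Union> (range (\<lambda>n::nat. cball (0::'a) (real n))) = space (scale_measure (ennreal \<gamma>) lborel)"
      using real_arch_simple by (fastforce simp: space_scale_measure)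
    fix a assume "a \<in> range (\<lambda>n::nat. cball (0::'a) (real n))"
    then show "emeasure (scale_measure (ennreal \<gamma>) lborel) a \<noteq> \<infinity>"
      by (auto simp: emeasure_cball ennreal_mult_eq_top_iff)
  qed auto
qed

lemma emeasure_intensity:
  assumes "A \<in> sets intensity"
  shows "emeasure intensity A = (\<integral>\<^sup>+m. ennreal \<gamma> * emeasure lborel ((\<lambda>x. (x, m)) -` A) \<partial>Q)"
proof -
  interpret s: sigma_finite_measure "scale_measure (ennreal \<gamma>) (lborel :: 'a measure)"
    by (rule sigma_finite_scaled_lborel)
  interpret pair_sigma_finite "scale_measure (ennreal \<gamma>) (lborel :: 'a measure)" Q ..
  show ?thesis
    using emeasure_pair_measure_alt2[OF assms[unfolded intensity_def]] unfolding intensity_def by simp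
qed

text \<open>For fixed \<open>m\<close> the germs \<open>x\<close> in question lie in the reflection of a parallel body of the
  grain. By Steiner's formula its volume is at most a combination of the intrinsic volumes of
  positive index, which are integrable by assumption, and a constant.\<close>

lemma hit_ball_finite: assumes R: "0 \<le> R" shows "emeasure intensity (hit_ball R) < \<infinity>"
proof -
  define b where "b m = unit_ball_vol DIM('a) * R ^ DIM('a)
      + (\<Sum>k<DIM('a). unit_ball_vol (real k) * R ^ k * intrinsic_volume (DIM('a) - k) (grain g m))" for m
  have bi: "integrable Q b"
    unfolding b_def
    by (intro Bochner_Integration.integrable_add Bochner_Integration.integrable_sum integrable_mult_right moments Q.integrable_const) auto
  have sec: "emeasure lborel ((\<lambda>x. (x, m)) -` hit_ball R) \<le> ennreal (b m)" and b0: "0 \<le> b m"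
    if m: "m \<in> space Q" for m
  proof -
    have vol: "measure lborel (parallel_body (grain g m) R) \<le> b m"
      unfolding b_def by (rule measure_parallel_body_intrinsic_volumes(1)) (use m R in \<open>auto intro: grain_compact grain_convex dest: grain_nonempty\<close>)
    then show "0 \<le> b m" using measure_nonneg order_trans by blast
    let ?P = "parallel_body (grain g m) R"
    have comp: "compact ?P" by (rule parallel_body_compact[OF grain_compact[OF m]])
    have "(\<lambda>x. (x, m)) -` hit_ball R \<subseteq> uminus ` ?P"
    proof
      fix x assume "x \<in> (\<lambda>x. (x, m)) -` hit_ball R"
      then obtain z where z: "dist (- x) z < R" "0 < g m z" by (auto simp: hit_ball_def)
      then have "z \<in> grain g m" using g_outside[OF m, of z] by fastforce
      then have "- x \<in> ?P" unfolding parallel_body_def using z by (auto simp: dist_commute intro!: bexI[of _ z])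
      then show "x \<in> uminus ` ?P" by (metis image_eqI minus_minus)
    qed
    moreover have cm: "compact (uminus ` ?P)" using compact_negations[OF comp] by simp
    ultimately have "emeasure lborel ((\<lambda>x. (x, m)) -` hit_ball R) \<le> emeasure lborel (uminus ` ?P)"
      by (intro emeasure_mono) (auto simp: compact_imp_closed borel_closed)
    also have "\<dots> = emeasure lebesgue ((\<lambda>x. 0 + (-1) *\<^sub>R x) ` ?P)"
      using cm by (simp add: emeasure_completion compact_imp_closed borel_closed cong: image_cong_simp)
    also have "\<dots> = emeasure lborel ?P"
      using emeasure_lebesgue_affine[of "-1" 0 ?P] comp
      by (simp add: emeasure_completion compact_imp_closed borel_closed)
    also have "\<dots> = ennreal (measure lborel ?P)"
      using emeasure_compact_finite[OF comp] by (intro emeasure_eq_ennreal_measure) (simp add: less_top)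
    also have "\<dots> \<le> ennreal (b m)" by (rule ennreal_leI[OF vol])
    finally show "emeasure lborel ((\<lambda>x. (x, m)) -` hit_ball R) \<le> ennreal (b m)" .
  qed
  have "emeasure intensity (hit_ball R) = (\<integral>\<^sup>+m. ennreal \<gamma> * emeasure lborel ((\<lambda>x. (x, m)) -` hit_ball R) \<partial>Q)"
    by (rule emeasure_intensity[OF hit_ball_sets])
  also have "\<dots> \<le> (\<integral>\<^sup>+m. ennreal \<gamma> * ennreal (b m) \<partial>Q)"
    by (intro nn_integral_mono mult_left_mono sec) auto
  also have "\<dots> = ennreal \<gamma> * (\<integral>\<^sup>+m. ennreal (b m) \<partial>Q)"
    using bi by (intro nn_integral_cmult) auto
  also have "(\<integral>\<^sup>+m. ennreal (b m) \<partial>Q) = ennreal (\<integral>m. b m \<partial>Q)"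
    by (rule nn_integral_eq_integral[OF bi]) (use b0 in auto)
  also have "ennreal \<gamma> * ennreal (\<integral>m. b m \<partial>Q) < \<infinity>"
    by (simp add: ennreal_mult_less_top)
  finally show ?thesis .
qed

section \<open>Locally finite configurations\<close>

text \<open>The configurations for which only finitely many grains meet any bounded set. Almost every
  realization is of this kind.\<close>

definition locally_finite :: "('a \<times> 'm) measure set" where
  "locally_finite = {\<mu>\<in>space (config intensity). \<forall>k::nat. emeasure \<mu> (hit_ball k) < \<infinity>}"

lemma locally_finite_sets: "locally_finite \<in> sets (config intensity)"
proof -
  have [measurable]: "(\<lambda>\<mu>. emeasure \<mu> (hit_ball (real k))) \<in> borel_measurable (config intensity)" for k
    by (rule measurable_emeasure_config[OF hit_ball_sets])
  show ?thesis unfolding locally_finite_def by measurable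
qed

lemma locally_finite_point_measure: "\<mu> \<in> locally_finite \<Longrightarrow> point_measure_on intensity \<mu>"
  by (simp add: locally_finite_def space_config)

lemma AE_locally_finite:
  assumes P: "prob_space P" and eta: "poisson_process P intensity \<eta>"
  shows "AE \<omega> in P. \<eta> \<omega> \<in> locally_finite"
proof -
  have "AE \<omega> in P. \<forall>k::nat. emeasure (\<eta> \<omega>) (hit_ball k) < \<infinity>"
    unfolding AE_all_countable
  proof
    fix k :: nat
    have "AE \<omega> in P. \<exists>j::nat. emeasure (\<eta> \<omega>) (hit_ball k) = of_nat j"
      by (rule poisson_process_AE_nat[OF P eta hit_ball_sets hit_ball_finite]) simp
    then show "AE \<omega> in P. emeasure (\<eta> \<omega>) (hit_ball k) < \<infinity>"
      by eventually_elim (auto simp: less_top[symmetric])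
  qed
  moreover have "AE \<omega> in P. \<omega> \<in> space P" by (rule AE_space)
  ultimately show ?thesis
    by eventually_elim (use eta in \<open>auto simp: locally_finite_def space_config poisson_process_def\<close>)
qed

text \<open>One finite index set serves for all integrands that vanish off \<open>hit_ball R\<close>. This allows to
  compare the shot noise with the integrals of local suprema around different points.\<close>

lemma locally_finite_representation:
  assumes "\<mu> \<in> locally_finite"
  obtains J :: "nat set" and X where "finite J" "\<forall>i\<in>J. snd (X i) \<in> space Q"
    "emeasure \<mu> (hit_ball (real R)) = of_nat (card J)"
    "\<forall>h\<in>borel_measurable intensity. (\<forall>w\<in>space intensity - hit_ball (real R). h w = 0) \<longrightarrow>
      (\<integral>\<^sup>+w. h w \<partial>\<mu>) = (\<Sum>i\<in>J. h (X i))"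
proof -
  obtain I :: "nat set" and X where X: "X ` I \<subseteq> space intensity" "\<mu> = distr (count_space I) intensity X"
    using locally_finite_point_measure[OF assms] unfolding point_measure_on_def by blast
  have Xm: "X \<in> count_space I \<rightarrow>\<^sub>M intensity" using X(1) by (auto simp: measurable_count_space_eq1)
  define J where "J = {i\<in>I. X i \<in> hit_ball (real R)}"
  have "emeasure \<mu> (hit_ball (real R)) = emeasure (count_space I) (X -` hit_ball (real R) \<inter> I)"
    unfolding X(2) using emeasure_distr[OF Xm hit_ball_sets] by simp
  also have "X -` hit_ball (real R) \<inter> I = J" by (auto simp: J_def)
  also have "emeasure (count_space I) J = (if finite J then of_nat (card J) else \<infinity>)"
    by (subst emeasure_count_space) (auto simp: J_def)
  finally have N: "emeasure \<mu> (hit_ball (real R)) = (if finite J then of_nat (card J) else \<infinity>)" .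
  moreover have "emeasure \<mu> (hit_ball (real R)) < \<infinity>" using assms unfolding locally_finite_def by blast
  ultimately have fin: "finite J" by (auto split: if_splits)
  show ?thesis
  proof (rule that[OF fin])
    show "\<forall>i\<in>J. snd (X i) \<in> space Q"
    proof
      fix i assume "i \<in> J"
      then have "X i \<in> space intensity" using X(1) by (auto simp: J_def)
      then show "snd (X i) \<in> space Q" by (auto simp: space_intensity)
    qed
    show "emeasure \<mu> (hit_ball (real R)) = of_nat (card J)" using N fin by simp
    show "\<forall>h\<in>borel_measurable intensity. (\<forall>w\<in>space intensity - hit_ball (real R). h w = 0) \<longrightarrow>
      (\<integral>\<^sup>+w. h w \<partial>\<mu>) = (\<Sum>i\<in>J. h (X i))"
    proof (intro ballI impI)
      fix h :: "'a \<times> 'm \<Rightarrow> ennreal" assume h: "h \<in> borel_measurable intensity"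
        and h0: "\<forall>w\<in>space intensity - hit_ball (real R). h w = 0"
      have "(\<integral>\<^sup>+w. h w \<partial>\<mu>) = (\<integral>\<^sup>+i. h (X i) \<partial>count_space I)"
        unfolding X(2) by (rule nn_integral_distr[OF Xm]) (use h in simp)
      also have "\<dots> = (\<Sum>i\<in>J. h (X i))"
      proof (rule nn_integral_count_space'[OF fin])
        fix i assume i: "i \<in> I" "i \<notin> J"
        then have "X i \<in> space intensity - hit_ball (real R)" using X(1) by (auto simp: J_def)
        then show "h (X i) = 0" using h0 by blast
      qed (auto simp: J_def)
      finally show "(\<integral>\<^sup>+w. h w \<partial>\<mu>) = (\<Sum>i\<in>J. h (X i))" .
    qed
  qed
qed

lemma shot_noise_alt: "shot_noise g \<mu> y = (\<integral>\<^sup>+w. ennreal (g (snd w) (y - fst w)) \<partial>\<mu>)"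
  unfolding shot_noise_def by (simp add: case_prod_unfold)

lemma reflect_measurable:
  assumes "f \<in> borel_measurable (borel \<Otimes>\<^sub>M Q)"
  shows "(\<lambda>w. f (y - fst w, snd w)) \<in> borel_measurable intensity"
proof -
  have "(\<lambda>w. (y - fst w, snd w)) \<in> borel \<Otimes>\<^sub>M Q \<rightarrow>\<^sub>M borel \<Otimes>\<^sub>M Q" by measurable
  from measurable_compose[OF this assms] show ?thesis unfolding measurable_intensity .
qed

lemma shot_noise_integrand_measurable:
  "(\<lambda>w. ennreal (g (snd w) (y - fst w))) \<in> borel_measurable intensity"
  using reflect_measurable[OF g_joint_measurable, of y] by simp

lemma locally_finite_shot_noise:
  assumes "\<mu> \<in> locally_finite"
  obtains J :: "nat set" and X where "finite J" "\<forall>i\<in>J. snd (X i) \<in> space Q"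
    "emeasure \<mu> (hit_ball (real R)) = of_nat (card J)"
    "\<forall>y. norm y < real R \<longrightarrow> shot_noise g \<mu> y = ennreal (\<Sum>i\<in>J. g (snd (X i)) (y - fst (X i)))"
    "\<forall>h\<in>borel_measurable intensity. (\<forall>w\<in>space intensity - hit_ball (real R). h w = 0) \<longrightarrow>
      (\<integral>\<^sup>+w. h w \<partial>\<mu>) = (\<Sum>i\<in>J. h (X i))"
proof -
  obtain J :: "nat set" and X where J: "finite J" "\<forall>i\<in>J. snd (X i) \<in> space Q"
    "emeasure \<mu> (hit_ball (real R)) = of_nat (card J)"
    and sum: "\<forall>h\<in>borel_measurable intensity. (\<forall>w\<in>space intensity - hit_ball (real R). h w = 0) \<longrightarrow>
      (\<integral>\<^sup>+w. h w \<partial>\<mu>) = (\<Sum>i\<in>J. h (X i))"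
    by (rule locally_finite_representation[OF assms])
  have sn: "shot_noise g \<mu> y = ennreal (\<Sum>i\<in>J. g (snd (X i)) (y - fst (X i)))" if y: "norm y < real R" for y
  proof -
    have "shot_noise g \<mu> y = (\<Sum>i\<in>J. ennreal (g (snd (X i)) (y - fst (X i))))"
      unfolding shot_noise_alt
    proof (rule sum[rule_format, OF shot_noise_integrand_measurable])
      fix w assume w: "w \<in> space intensity - hit_ball (real R)"
      have "dist (- fst w) (y - fst w) < real R" using y by (simp add: dist_norm)
      then have "\<not> 0 < g (snd w) (y - fst w)"
        using w by (auto simp: hit_ball_def space_intensity)
      then show "ennreal (g (snd w) (y - fst w)) = 0" by (simp add: ennreal_eq_0_iff)
    qed
    also have "\<dots> = ennreal (\<Sum>i\<in>J. g (snd (X i)) (y - fst (X i)))"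
      by (rule sum_ennreal) (use J(2) g_nonneg in auto)
    finally show ?thesis .
  qed
  have "\<forall>y. norm y < real R \<longrightarrow> shot_noise g \<mu> y = ennreal (\<Sum>i\<in>J. g (snd (X i)) (y - fst (X i)))"
    using sn by blast
  from that[OF J this sum] show ?thesis .
qed

section \<open>Excursion sets are polyconvex on compact windows\<close>

lemma shifted_grains:
  assumes "finite J" "\<forall>i\<in>J. snd (X i) \<in> space Q"
  shows "concave_grains J (\<lambda>i. (+) (fst (X i)) ` grain g (snd (X i))) (\<lambda>i y. g (snd (X i)) (y - fst (X i)))"
proof
  show "finite J" by fact
  fix j assume j: "j \<in> J"
  let ?x = "fst (X j)" and ?m = "snd (X j)"
  have m: "?m \<in> space Q" using assms(2) j by blast
  have mem: "y \<in> (+) ?x ` grain g ?m \<longleftrightarrow> y - ?x \<in> grain g ?m" for y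
    by (auto intro!: image_eqI[of _ _ "y - ?x"])
  show "closed ((+) ?x ` grain g ?m)"
    by (intro closed_translation compact_imp_closed grain_compact m)
  show cv: "convex ((+) ?x ` grain g ?m)"
    by (intro convex_translation grain_convex m)
  show "continuous_on ((+) ?x ` grain g ?m) (\<lambda>y. g ?m (y - ?x))"
    by (rule continuous_on_compose2[OF g_continuous[OF m]]) (auto intro!: continuous_intros)
  show "concave_on ((+) ?x ` grain g ?m) (\<lambda>y. g ?m (y - ?x))"
    unfolding concave_on_iff
  proof (intro conjI cv ballI allI impI)
    fix a b and s t :: real
    assume ab: "a \<in> (+) ?x ` grain g ?m" "b \<in> (+) ?x ` grain g ?m" and st: "0 \<le> s" "0 \<le> t" "s + t = 1"
    have "s *\<^sub>R a + t *\<^sub>R b - ?x = s *\<^sub>R (a - ?x) + t *\<^sub>R (b - ?x)"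
      using st by (simp add: algebra_simps) (metis scaleR_add_left scaleR_one)
    moreover have "s * g ?m (a - ?x) + t * g ?m (b - ?x) \<le> g ?m (s *\<^sub>R (a - ?x) + t *\<^sub>R (b - ?x))"
      using g_concave[OF m] ab st unfolding concave_on_iff mem by blast
    ultimately show "s * g ?m (a - ?x) + t * g ?m (b - ?x) \<le> g ?m (s *\<^sub>R a + t *\<^sub>R b - ?x)" by simp
  qed
  show "0 \<le> g ?m (y - ?x)" for y by (rule g_nonneg[OF m])
  show "g ?m (y - ?x) = 0" if "y \<notin> (+) ?x ` grain g ?m" for y
    using that g_outside[OF m] mem by blast
qed

lemma excursion_window:
  assumes "C \<subseteq> ball 0 (real R)" "\<forall>i\<in>J. snd (X i) \<in> space Q"
    and "\<forall>y. norm y < real R \<longrightarrow> shot_noise g \<mu> y = ennreal (\<Sum>i\<in>J. g (snd (X i)) (y - fst (X i)))"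
  shows "excursion_set g u \<mu> \<inter> C = {y\<in>C. u \<le> 0 + (\<Sum>i\<in>J. g (snd (X i)) (y - fst (X i)))}"
proof -
  have "ennreal u \<le> shot_noise g \<mu> y \<longleftrightarrow> u \<le> 0 + (\<Sum>i\<in>J. g (snd (X i)) (y - fst (X i)))" if "y \<in> C" for y
  proof -
    have "norm y < real R" using that assms(1) by auto
    moreover have "0 \<le> (\<Sum>i\<in>J. g (snd (X i)) (y - fst (X i)))"
      using assms(2) g_nonneg by (intro sum_nonneg) auto
    ultimately show ?thesis using assms(3) by (simp add: ennreal_le_iff)
  qed
  then show ?thesis unfolding excursion_set_def by auto
qed

lemma excursion_polyconvex:
  assumes mu: "\<mu> \<in> locally_finite" and C: "polyconvex C"
  shows "polyconvex (excursion_set g u \<mu> \<inter> C)"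
proof -
  obtain b where b: "\<forall>x\<in>C. norm x \<le> b"
    using compact_imp_bounded[OF polyconvex_compact[OF C]] unfolding bounded_iff by blast
  obtain R :: nat where R: "b < real R" using reals_Archimedean2 by blast
  have sub: "cball (0::'a) b \<subseteq> ball 0 (real R)" using R by auto
  obtain J :: "nat set" and X where J: "finite J" "\<forall>i\<in>J. snd (X i) \<in> space Q"
    "\<forall>y. norm y < real R \<longrightarrow> shot_noise g \<mu> y = ennreal (\<Sum>i\<in>J. g (snd (X i)) (y - fst (X i)))"
    using locally_finite_shot_noise[OF mu, of R] by metis
  have eq: "excursion_set g u \<mu> \<inter> cball 0 b = {y\<in>cball 0 b. u \<le> 0 + (\<Sum>i\<in>J. g (snd (X i)) (y - fst (X i)))}"
    by (rule excursion_window[OF sub]) (fact J)+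
  interpret concave_grains J "\<lambda>i. (+) (fst (X i)) ` grain g (snd (X i))" "\<lambda>i y. g (snd (X i)) (y - fst (X i))"
    by (rule shifted_grains) (fact J)+
  have "polyconvex (excursion_set g u \<mu> \<inter> cball 0 b)"
    unfolding eq by (rule polyconvex_superlevel) (auto simp: concave_on_iff)
  moreover have "excursion_set g u \<mu> \<inter> C = (excursion_set g u \<mu> \<inter> cball 0 b) \<inter> C" using b by auto
  ultimately show ?thesis using polyconvex_Int[OF _ C] by simp
qed

text \<open>This is \<open>3 ^ N\<close> for the number \<open>N\<close> of points in \<open>hit_ball R\<close>. The real power makes it a
  measurable function without a case distinction for infinitely many points.\<close>

definition weight :: "nat \<Rightarrow> ('a \<times> 'm) measure \<Rightarrow> real" where
  "weight R \<mu> = 3 powr enn2real (emeasure \<mu> (hit_ball (real R)))"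

lemma weight_of_nat: "emeasure \<mu> (hit_ball (real R)) = of_nat n \<Longrightarrow> weight R \<mu> = 3 ^ n"
  by (simp add: weight_def powr_realpow)

lemma weight_measurable: "weight R \<in> borel_measurable (config intensity)"
proof -
  have [measurable]: "(\<lambda>\<mu>. emeasure \<mu> (hit_ball (real R))) \<in> borel_measurable (config intensity)"
    by (rule measurable_emeasure_config[OF hit_ball_sets])
  show ?thesis unfolding weight_def by measurable
qed

lemma valuation_excursion_bound:
  fixes \<phi> :: "'a set \<Rightarrow> real"
  assumes mu: "\<mu> \<in> locally_finite"
    and add: "\<And>A B. polyconvex A \<Longrightarrow> polyconvex B \<Longrightarrow> \<phi> (A \<union> B) = \<phi> A + \<phi> B - \<phi> (A \<inter> B)"
    and bound: "\<And>A. compact A \<Longrightarrow> convex A \<Longrightarrow> A \<subseteq> C0 \<Longrightarrow> \<bar>\<phi> A\<bar> \<le> M"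
    and C0: "C0 \<subseteq> ball 0 (real R)" and C: "compact C" "convex C" "C \<subseteq> C0"
  shows "\<bar>\<phi> (excursion_set g u \<mu> \<inter> C)\<bar> \<le> weight R \<mu> * M"
proof -
  obtain J :: "nat set" and X where J: "finite J" "\<forall>i\<in>J. snd (X i) \<in> space Q"
    "emeasure \<mu> (hit_ball (real R)) = of_nat (card J)"
    "\<forall>y. norm y < real R \<longrightarrow> shot_noise g \<mu> y = ennreal (\<Sum>i\<in>J. g (snd (X i)) (y - fst (X i)))"
    using locally_finite_shot_noise[OF mu, of R] by metis
  have sub: "C \<subseteq> ball 0 (real R)" using C0 C by blast
  have eq: "excursion_set g u \<mu> \<inter> C = {y\<in>C. u \<le> 0 + (\<Sum>i\<in>J. g (snd (X i)) (y - fst (X i)))}"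
    by (rule excursion_window[OF sub]) (fact J)+
  interpret concave_grains J "\<lambda>i. (+) (fst (X i)) ` grain g (snd (X i))" "\<lambda>i y. g (snd (X i)) (y - fst (X i))"
    by (rule shifted_grains) (fact J)+
  show ?thesis
    unfolding eq weight_of_nat[OF J(3)]
    by (rule valuation_superlevel_bound[where ?C0.0 = C0, OF add bound])
      (use C in \<open>auto simp: concave_on_iff\<close>)
qed

text \<open>For a Poisson variable with mean \<open>a\<close>, the mean of \<open>3 ^ N\<close> is the exponential series of
  \<open>3 * a\<close> times \<open>exp (- a)\<close>.\<close>

lemma integrable_weight:
  assumes P: "prob_space P" and eta: "poisson_process P intensity \<eta>"
  shows "integrable P (\<lambda>\<omega>. weight R (\<eta> \<omega>))"
proof -
  interpret prob_space P by fact
  let ?H = "hit_ball (real R)"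
  define a where "a = measure intensity ?H"
  have [measurable]: "(\<lambda>\<omega>. emeasure (\<eta> \<omega>) ?H) \<in> borel_measurable P"
    using eta hit_ball_sets by (auto simp: poisson_process_def)
  have fin: "emeasure intensity ?H < \<infinity>" by (rule hit_ball_finite) simp
  define E where "E k = {\<omega>\<in>space P. emeasure (\<eta> \<omega>) ?H = of_nat k}" for k :: nat
  have [measurable]: "E k \<in> events" for k unfolding E_def by measurable
  have p: "prob (E k) = a ^ k / fact k * exp (- a)" for k
    using eta hit_ball_sets fin unfolding poisson_process_def E_def a_def by blast
  have "AE \<omega> in P. \<exists>k::nat. emeasure (\<eta> \<omega>) ?H = of_nat k"
    by (rule poisson_process_AE_nat[OF P eta hit_ball_sets fin])
  moreover have "AE \<omega> in P. \<omega> \<in> space P" by (rule AE_space)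
  ultimately have "AE \<omega> in P. ennreal (weight R (\<eta> \<omega>)) = (\<Sum>k. ennreal (3 ^ k) * indicator (E k) \<omega>)"
  proof eventually_elim
    case (elim \<omega>)
    then obtain k :: nat where k: "emeasure (\<eta> \<omega>) ?H = of_nat k" by blast
    have "indicator (E j) \<omega> = (if j = k then 1 else (0::ennreal))" for j
      using k elim(2) by (auto simp: E_def indicator_def)
    then have "(\<Sum>j. ennreal (3 ^ j) * indicator (E j) \<omega>) = (\<Sum>j\<in>{k}. ennreal (3 ^ j) * indicator (E j) \<omega>)"
      by (intro suminf_finite) auto
    then show ?case using k elim(2) by (simp add: weight_of_nat E_def)
  qed
  then have "(\<integral>\<^sup>+\<omega>. ennreal (weight R (\<eta> \<omega>)) \<partial>P) = (\<integral>\<^sup>+\<omega>. (\<Sum>k. ennreal (3 ^ k) * indicator (E k) \<omega>) \<partial>P)"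
    by (rule nn_integral_cong_AE)
  also have "\<dots> = (\<Sum>k. \<integral>\<^sup>+\<omega>. ennreal (3 ^ k) * indicator (E k) \<omega> \<partial>P)"
    by (rule nn_integral_suminf) measurable
  also have "\<dots> = (\<Sum>k. ennreal (3 ^ k * (a ^ k / fact k * exp (- a))))"
    by (intro suminf_cong) (simp add: nn_integral_cmult_indicator emeasure_eq_measure p ennreal_mult'[symmetric])
  also have "\<dots> < \<infinity>"
  proof -
    have "(\<lambda>k. (3 * a) ^ k / fact k) sums exp (3 * a)"
      using exp_converges[of "3 * a"] by (simp add: field_simps)
    then have "summable (\<lambda>k. (3 * a) ^ k / fact k * exp (- a))"
      by (intro summable_mult2) (rule sums_summable)
    then have "summable (\<lambda>k. 3 ^ k * (a ^ k / fact k * exp (- a)))"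
      by (simp add: power_mult_distrib mult.assoc)
    moreover have "0 \<le> a" by (simp add: a_def)
    ultimately show ?thesis by (subst suminf_ennreal2) auto
  qed
  finally have "(\<integral>\<^sup>+\<omega>. ennreal (norm (weight R (\<eta> \<omega>))) \<partial>P) < \<infinity>" by (simp add: weight_def)
  moreover have "(\<lambda>\<omega>. weight R (\<eta> \<omega>)) \<in> borel_measurable P" unfolding weight_def by measurable
  ultimately show ?thesis by (intro integrableI_bounded)
qed

section \<open>Measurability of excursion sets\<close>

definition smoothed :: "real \<Rightarrow> 'a \<Rightarrow> ('a \<times> 'm) measure \<Rightarrow> ennreal" where
  "smoothed r q \<mu> = (\<integral>\<^sup>+w. local_sup r (q - fst w, snd w) \<partial>\<mu>)"

lemma smoothed_measurable: "smoothed r q \<in> borel_measurable (config intensity)"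
  unfolding smoothed_def
  by (intro measurable_nn_integral_config reflect_measurable local_sup_measurable)

text \<open>For points \<open>q\<close> tending to \<open>l\<close>, each of the finitely many relevant local suprema around \<open>q\<close>
  is at most slightly larger than the grain at \<open>l\<close>, by upper semicontinuity. So if the smoothed
  shot noise of radius tending to 0 reaches \<open>u\<close> at points closer and closer to \<open>K\<close>, the shot noise
  itself reaches \<open>u\<close> at a limit point in \<open>K\<close>. In the other direction, the smoothed shot noise at
  \<open>q\<close> dominates the shot noise at all points near \<open>q\<close>.\<close>

lemma excursion_hits_iff:
  fixes D :: "'a set"
  assumes mu: "\<mu> \<in> locally_finite" and K: "compact K" and D: "\<And>X. open X \<Longrightarrow> X \<noteq> {} \<Longrightarrow> \<exists>d\<in>D. d \<in> X"
  shows "excursion_set g u \<mu> \<inter> K \<noteq> {} \<longleftrightarrow>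
    (\<forall>n::nat. \<exists>q\<in>{q\<in>D. \<exists>y\<in>K. dist q y < 1 / Suc n}. ennreal u \<le> smoothed (1 / Suc n) q \<mu>)"
proof
  assume "excursion_set g u \<mu> \<inter> K \<noteq> {}"
  then obtain y where y: "y \<in> K" "ennreal u \<le> shot_noise g \<mu> y" by (auto simp: excursion_set_def)
  show "\<forall>n::nat. \<exists>q\<in>{q\<in>D. \<exists>y\<in>K. dist q y < 1 / Suc n}. ennreal u \<le> smoothed (1 / Suc n) q \<mu>"
  proof
    fix n :: nat
    have "ball y (1 / Suc n) \<noteq> {}" by simp
    then obtain q where q: "q \<in> D" "dist y q < 1 / Suc n" using D[OF open_ball] by (metis mem_ball)
    have "shot_noise g \<mu> y \<le> smoothed (1 / Suc n) q \<mu>"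
      unfolding shot_noise_alt smoothed_def local_sup_def fst_conv snd_conv
    proof (intro nn_integral_mono SUP_upper)
      fix w
      show "y - fst w \<in> ball (q - fst w) (1 / real (Suc n))" using q(2) by (simp only: mem_ball) (simp add: dist_norm norm_minus_commute)
    qed
    then have "ennreal u \<le> smoothed (1 / Suc n) q \<mu>" using y(2) by (rule order_trans[rotated])
    moreover have "q \<in> {q\<in>D. \<exists>y\<in>K. dist q y < 1 / Suc n}" using q y(1) by (auto simp: dist_commute)
    ultimately show "\<exists>q\<in>{q\<in>D. \<exists>y\<in>K. dist q y < 1 / Suc n}. ennreal u \<le> smoothed (1 / Suc n) q \<mu>" by blast
  qed
next
  assume "\<forall>n::nat. \<exists>q\<in>{q\<in>D. \<exists>y\<in>K. dist q y < 1 / Suc n}. ennreal u \<le> smoothed (1 / Suc n) q \<mu>"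
  then have "\<forall>n. \<exists>q y. y \<in> K \<and> dist q y < 1 / real (Suc n) \<and> ennreal u \<le> smoothed (1 / real (Suc n)) q \<mu>" by blast
  then obtain q y where qy: "\<And>n. y n \<in> K" "\<And>n. dist (q n) (y n) < 1 / real (Suc n)"
    "\<And>n. ennreal u \<le> smoothed (1 / real (Suc n)) (q n) \<mu>" by metis
  obtain b where b: "\<forall>x\<in>K. norm x \<le> b"
    using compact_imp_bounded[OF K] unfolding bounded_iff by blast
  \<comment> \<open>one unit for the distance of \<open>q n\<close> to \<open>K\<close> and one for the radius of the local suprema\<close>
  obtain R :: nat where R: "b + 2 < real R" using reals_Archimedean2 by blast
  obtain J :: "nat set" and X where J: "finite J" "\<forall>i\<in>J. snd (X i) \<in> space Q"
    "emeasure \<mu> (hit_ball (real R)) = of_nat (card J)"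
    "\<forall>y. norm y < real R \<longrightarrow> shot_noise g \<mu> y = ennreal (\<Sum>i\<in>J. g (snd (X i)) (y - fst (X i)))"
    and sum: "\<forall>h\<in>borel_measurable intensity. (\<forall>w\<in>space intensity - hit_ball (real R). h w = 0) \<longrightarrow>
      (\<integral>\<^sup>+w. h w \<partial>\<mu>) = (\<Sum>i\<in>J. h (X i))"
    by (rule locally_finite_shot_noise[OF mu, of R])
  have sm: "smoothed (1 / real (Suc n)) (q n) \<mu> = (\<Sum>i\<in>J. local_sup (1 / real (Suc n)) (q n - fst (X i), snd (X i)))" for n
    unfolding smoothed_def
  proof (rule sum[rule_format, OF reflect_measurable[OF local_sup_measurable]])
    fix w assume w: "w \<in> space intensity - hit_ball (real R)"
    have n1: "1 / real (Suc n) \<le> 1" by simp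
    have "norm (q n) \<le> norm (y n) + dist (q n) (y n)"
      unfolding dist_norm by (metis add.commute norm_triangle_sub)
    moreover have "norm (y n) \<le> b" using b qy(1) by blast
    ultimately have qn: "norm (q n) \<le> b + 1" using qy(2)[of n] n1 by linarith
    have "ennreal (g (snd w) z) \<le> 0" if "z \<in> ball (q n - fst w) (1 / real (Suc n))" for z
    proof -
      have "dist (- fst w) z \<le> dist (- fst w) (q n - fst w) + dist (q n - fst w) z" by (rule dist_triangle)
      also have "dist (- fst w) (q n - fst w) = norm (q n)" by (simp add: dist_norm)
      also have "norm (q n) + dist (q n - fst w) z < real R"
        using that n1 qn R unfolding mem_ball by linarith
      finally have "\<not> 0 < g (snd w) z" using w by (auto simp: hit_ball_def space_intensity)
      then show ?thesis by (simp add: ennreal_eq_0_iff)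
    qed
    then have "local_sup (1 / real (Suc n)) (q n - fst w, snd w) \<le> 0"
      unfolding local_sup_def fst_conv snd_conv by (rule SUP_least)
    then show "local_sup (1 / real (Suc n)) (q n - fst w, snd w) = 0" by simp
  qed
  obtain l r where l: "l \<in> K" "strict_mono (r :: nat \<Rightarrow> nat)" "(y \<circ> r) \<longlonglongrightarrow> l"
    using K qy(1) unfolding compact_def by metis
  let ?S = "\<Sum>i\<in>J. g (snd (X i)) (l - fst (X i))"
  have "u \<le> ?S"
  proof (rule field_le_epsilon)
    fix e :: real assume e: "0 < e"
    define \<epsilon> where "\<epsilon> = e / (card J + 1)"
    have \<epsilon>: "\<epsilon> > 0" using e by (simp add: \<epsilon>_def)
    have "\<forall>i\<in>J. \<exists>\<delta>>0. \<forall>z. dist (l - fst (X i)) z < \<delta> \<longrightarrow> g (snd (X i)) z < g (snd (X i)) (l - fst (X i)) + \<epsilon>"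
    proof
      fix i assume "i \<in> J"
      then have "snd (X i) \<in> space Q" using J(2) by blast
      from g_usc[OF this \<epsilon>, of "l - fst (X i)"]
      show "\<exists>\<delta>>0. \<forall>z. dist (l - fst (X i)) z < \<delta> \<longrightarrow> g (snd (X i)) z < g (snd (X i)) (l - fst (X i)) + \<epsilon>" by metis
    qed
    then obtain d where d: "\<And>i. i \<in> J \<Longrightarrow> d i > 0"
      "\<And>i z. i \<in> J \<Longrightarrow> dist (l - fst (X i)) z < d i \<Longrightarrow> g (snd (X i)) z < g (snd (X i)) (l - fst (X i)) + \<epsilon>" by metis
    define \<delta> where "\<delta> = Min (insert 1 (d ` J))"
    have \<delta>: "\<delta> > 0" "\<And>i. i \<in> J \<Longrightarrow> \<delta> \<le> d i" using J(1) d(1) by (auto simp: \<delta>_def)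
    obtain N where N: "\<And>n. n \<ge> N \<Longrightarrow> dist (y (r n)) l < \<delta> / 3"
      using l(3) \<delta>(1) unfolding lim_sequentially by (metis comp_apply divide_pos_pos zero_less_numeral)
    obtain n0 :: nat where n0: "1 / real (Suc n0) < \<delta> / 3" using nat_approx_posE[of "\<delta> / 3"] \<delta>(1) by auto
    define n where "n = max N n0"
    define s where "s = 1 / real (Suc (r n))"
    have "n0 \<le> r n" using seq_suble[OF l(2), of n] by (simp add: n_def)
    then have "s \<le> 1 / real (Suc n0)" unfolding s_def by (intro divide_left_mono) auto
    then have s: "s < \<delta> / 3" using n0 by linarith
    have yl: "dist (y (r n)) l < \<delta> / 3" by (rule N) (simp add: n_def)
    have qs: "dist (q (r n)) (y (r n)) < s" unfolding s_def by (rule qy(2))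
    have loc: "local_sup s (q (r n) - fst (X i), snd (X i)) \<le> ennreal (g (snd (X i)) (l - fst (X i)) + \<epsilon>)" if i: "i \<in> J" for i
      unfolding local_sup_def fst_conv snd_conv
    proof (rule SUP_least)
      fix z assume z: "z \<in> ball (q (r n) - fst (X i)) s"
      have "dist (l - fst (X i)) z \<le> dist (l - fst (X i)) (q (r n) - fst (X i)) + dist (q (r n) - fst (X i)) z"
        by (rule dist_triangle)
      also have "dist (l - fst (X i)) (q (r n) - fst (X i)) = dist l (q (r n))" by (simp add: dist_norm)
      also have "dist l (q (r n)) \<le> dist (y (r n)) l + dist (q (r n)) (y (r n))"
        by (metis dist_commute dist_triangle)
      finally have "dist (l - fst (X i)) z < d i" using z s yl qs \<delta>(2)[OF i] unfolding mem_ball by linarith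
      from d(2)[OF i this] show "ennreal (g (snd (X i)) z) \<le> ennreal (g (snd (X i)) (l - fst (X i)) + \<epsilon>)"
        by (intro ennreal_leI) simp
    qed
    have "ennreal u \<le> (\<Sum>i\<in>J. local_sup s (q (r n) - fst (X i), snd (X i)))"
      using qy(3)[of "r n"] unfolding sm s_def .
    also have "\<dots> \<le> (\<Sum>i\<in>J. ennreal (g (snd (X i)) (l - fst (X i)) + \<epsilon>))" by (intro sum_mono loc)
    also have "\<dots> = ennreal (\<Sum>i\<in>J. g (snd (X i)) (l - fst (X i)) + \<epsilon>)"
      by (rule sum_ennreal) (use J(2) g_nonneg \<epsilon> in \<open>auto intro: add_nonneg_nonneg less_imp_le\<close>)
    finally have "ennreal u \<le> ennreal (\<Sum>i\<in>J. g (snd (X i)) (l - fst (X i)) + \<epsilon>)" .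
    moreover have "0 \<le> (\<Sum>i\<in>J. g (snd (X i)) (l - fst (X i)) + \<epsilon>)"
      using J(2) g_nonneg \<epsilon> by (intro sum_nonneg add_nonneg_nonneg) auto
    ultimately have "u \<le> (\<Sum>i\<in>J. g (snd (X i)) (l - fst (X i)) + \<epsilon>)"
      by (simp only: ennreal_le_iff)
    also have "\<dots> = ?S + card J * \<epsilon>" by (simp add: sum.distrib)
    also have "card J * \<epsilon> \<le> e" using e by (simp add: \<epsilon>_def field_simps)
    finally show "u \<le> ?S + e" by simp
  qed
  moreover have "norm l < real R" using b l(1) R by fastforce
  ultimately have "ennreal u \<le> shot_noise g \<mu> l" using J(4) by (simp add: ennreal_leI)
  then show "excursion_set g u \<mu> \<inter> K \<noteq> {}" using l(1) by (auto simp: excursion_set_def)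
qed

lemma excursion_hits_sets:
  assumes K: "compact K"
  shows "{\<mu>\<in>space (restrict_space (config intensity) locally_finite). excursion_set g u \<mu> \<inter> K \<noteq> {}}
    \<in> sets (restrict_space (config intensity) locally_finite)"
proof -
  obtain D :: "'a set" where D: "countable D" "\<And>X. open X \<Longrightarrow> X \<noteq> {} \<Longrightarrow> \<exists>d\<in>D. d \<in> X"
    using countable_dense_setE by blast
  define Dn where "Dn n = {q\<in>D. \<exists>y\<in>K. dist q y < 1 / real (Suc n)}" for n
  have ct: "countable (Dn n)" for n using D(1) by (auto simp: Dn_def intro: countable_subset[of _ D])
  have sp: "space (restrict_space (config intensity) locally_finite) = locally_finite"
    using sets.sets_into_space[OF locally_finite_sets] by (auto simp: space_restrict_space)
  note [measurable] = smoothed_measurable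
  have "{\<mu>\<in>space (restrict_space (config intensity) locally_finite). excursion_set g u \<mu> \<inter> K \<noteq> {}}
      = locally_finite \<inter> (\<Inter>n. \<Union>q\<in>Dn n. {\<mu>\<in>space (config intensity). ennreal u \<le> smoothed (1 / real (Suc n)) q \<mu>})"
    unfolding sp using excursion_hits_iff[OF _ K D(2)] sets.sets_into_space[OF locally_finite_sets]
    unfolding Dn_def by (auto; blast)
  also have "\<dots> \<in> sets (config intensity)"
    by (intro sets.Int locally_finite_sets sets.countable_INT sets.countable_UN' ct image_subsetI) (auto intro!: sets.countable_UN' ct)
  finally show ?thesis
    using locally_finite_sets by (subst sets_restrict_space_iff) (auto simp: sp)
qed

lemma excursion_measurable:
  assumes C: "polyconvex C"
  shows "(\<lambda>\<mu>. excursion_set g u \<mu> \<inter> C) \<in> restrict_space (config intensity) locally_finite \<rightarrow>\<^sub>M restrict_space fell_borel {A. polyconvex A}"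
proof (rule measurable_restrict_space2)
  have sp: "space (restrict_space (config intensity) locally_finite) = locally_finite"
    using sets.sets_into_space[OF locally_finite_sets] by (auto simp: space_restrict_space)
  show "(\<lambda>\<mu>. excursion_set g u \<mu> \<inter> C) \<in> space (restrict_space (config intensity) locally_finite) \<rightarrow> {A. polyconvex A}"
    unfolding sp using excursion_polyconvex C by auto
  show "(\<lambda>\<mu>. excursion_set g u \<mu> \<inter> C) \<in> restrict_space (config intensity) locally_finite \<rightarrow>\<^sub>M fell_borel"
  proof (rule measurable_fell_borelI)
    show "closed (excursion_set g u \<mu> \<inter> C)" if "\<mu> \<in> space (restrict_space (config intensity) locally_finite)" for \<mu>
      using excursion_polyconvex[OF _ C] that polyconvex_compact compact_imp_closed unfolding sp by blast
    fix K :: "'a set" assume "compact K"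
    then have "compact (C \<inter> K)" using polyconvex_compact[OF C] compact_Int compact_imp_closed by blast
    from excursion_hits_sets[OF this]
    show "{\<mu>\<in>space (restrict_space (config intensity) locally_finite). excursion_set g u \<mu> \<inter> C \<inter> K \<noteq> {}}
        \<in> sets (restrict_space (config intensity) locally_finite)"
      by (simp only: Int_assoc)
  qed
qed

lemma functional_measurable:
  assumes phi: "\<phi> \<in> borel_measurable (restrict_space fell_borel {A. polyconvex A})" and C: "polyconvex C"
  shows "(\<lambda>\<mu>. if \<mu> \<in> locally_finite then \<phi> (excursion_set g u \<mu> \<inter> C) else 0 :: real) \<in> borel_measurable (config intensity)"
proof -
  have "(\<lambda>\<mu>. \<phi> (excursion_set g u \<mu> \<inter> C)) \<in> borel_measurable (restrict_space (config intensity) locally_finite)"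
    by (rule measurable_compose[OF excursion_measurable[OF C] phi])
  then show ?thesis
    using locally_finite_sets sets.sets_into_space[OF locally_finite_sets]
    by (subst (asm) measurable_restrict_space_iff[where c = 0]) (auto simp: Int_absorb2)
qed

end

section \<open>Unit cubes and the integer lattice\<close>

lemma unit_cube_cbox: "unit_cube = cbox 0 ((\<chi> i. 1) :: real ^ 'n)"
  by (auto simp: unit_cube_def mem_box_cart)

lemma compact_unit_cube: "compact unit_cube" and convex_unit_cube: "convex unit_cube"
  by (simp_all add: unit_cube_cbox)

lemma zero_in_unit_cube: "0 \<in> unit_cube" by (simp add: unit_cube_def)

lemma norm_unit_cube: fixes x :: "real ^ 'n" assumes "x \<in> unit_cube" shows "norm x \<le> CARD('n)"
proof -
  have "norm x \<le> (\<Sum>i\<in>UNIV. \<bar>x $ i\<bar>)" by (rule norm_le_l1_cart)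
  also have "\<dots> \<le> (\<Sum>i\<in>(UNIV :: 'n set). 1)" by (rule sum_mono) (use assms in \<open>auto simp: unit_cube_def\<close>)
  finally show ?thesis by simp
qed

definition upper_face :: "'n \<Rightarrow> (real ^ 'n) set" where
  "upper_face i = {x. x $ i = 1}"

lemma upper_face_closed: "closed (upper_face i)" and upper_face_convex: "convex (upper_face i)"
proof -
  have eq: "upper_face i = {x. axis i 1 \<bullet> x = 1}" by (simp add: upper_face_def inner_axis')
  show "closed (upper_face i)" "convex (upper_face i)"
    unfolding eq by (rule closed_hyperplane, rule convex_hyperplane)
qed

lemma upper_boundary_faces: "upper_boundary = unit_cube \<inter> (\<Union>i\<in>UNIV. upper_face i)"
  by (auto simp: upper_boundary_def unit_cube_def half_open_cube_def upper_face_def)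
    (metis order_le_imp_less_or_eq, metis less_irrefl)

lemma polyconvex_unit_cube: "polyconvex unit_cube"
  by (intro polyconvexI compact_unit_cube convex_unit_cube)

lemma polyconvex_upper_boundary: "polyconvex (upper_boundary :: (real ^ 'n) set)"
proof -
  have "upper_boundary = (\<Union>i\<in>(UNIV :: 'n set). unit_cube \<inter> upper_face i)"
    unfolding upper_boundary_faces by blast
  moreover have "polyconvex (\<Union>i\<in>(UNIV :: 'n set). unit_cube \<inter> upper_face i)"
    by (intro polyconvex_UN polyconvex_Int_closed_convex polyconvex_unit_cube upper_face_closed upper_face_convex) simp
  ultimately show ?thesis by simp
qed

lemma half_open_cube_sets: "(half_open_cube :: (real ^ 'n) set) \<in> sets borel"
proof -
  have "half_open_cube = (unit_cube :: (real ^ 'n) set) - upper_boundary"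
    by (auto simp: upper_boundary_def half_open_cube_def unit_cube_def less_imp_le)
  moreover have "(unit_cube :: (real ^ 'n) set) - upper_boundary \<in> sets borel"
    by (intro sets.Diff borel_closed compact_imp_closed compact_unit_cube polyconvex_compact polyconvex_upper_boundary)
  ultimately show ?thesis by (simp only:)
qed

lemma emeasure_half_open_cube: "emeasure lborel (half_open_cube :: (real ^ 'n) set) = 1"
proof -
  let ?b = "(\<chi> i. 1) :: real ^ 'n"
  have "0 \<in> cbox 0 ?b" by (simp add: mem_box_cart)
  then have "measure lborel (cbox 0 ?b) = 1" using content_cbox_cart[of 0 ?b] by force
  moreover have "emeasure lborel (cbox 0 ?b) = ennreal (measure lborel (cbox 0 ?b))"
    using emeasure_compact_finite[OF compact_cbox[of 0 ?b]]
    by (intro emeasure_eq_ennreal_measure) (simp add: less_top)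
  ultimately have c: "emeasure lborel (cbox 0 ?b) = 1" by simp
  have "emeasure lborel (box 0 ?b) \<le> emeasure lborel (half_open_cube :: (real ^ 'n) set)"
    by (rule emeasure_mono) (auto simp: half_open_cube_def mem_box_cart less_imp_le half_open_cube_sets)
  moreover have "emeasure lborel (box 0 ?b) = emeasure lborel (cbox 0 ?b)"
    by (simp add: emeasure_lborel_box_eq emeasure_lborel_cbox_eq)
  moreover have "emeasure lborel (half_open_cube :: (real ^ 'n) set) \<le> emeasure lborel (cbox 0 ?b)"
    by (rule emeasure_mono) (auto simp: half_open_cube_def mem_box_cart less_imp_le)
  ultimately show ?thesis using c by simp
qed

definition integer_lattice :: "(real ^ 'n) set" where
  "integer_lattice = {z. \<forall>i. z $ i \<in> \<int>}"

definition floor_vec :: "real ^ 'n \<Rightarrow> real ^ 'n" where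
  "floor_vec x = (\<chi> i. of_int \<lfloor>x $ i\<rfloor>)"

lemma floor_vec_lattice: "floor_vec x \<in> integer_lattice"
  by (simp add: floor_vec_def integer_lattice_def)

text \<open>Hence the lattice translates of the half-open cube form a partition of the space.\<close>

lemma half_open_cube_floor:
  assumes "z \<in> integer_lattice" shows "x - z \<in> half_open_cube \<longleftrightarrow> z = floor_vec x"
proof
  assume h: "x - z \<in> half_open_cube"
  show "z = floor_vec x"
  proof (rule iffD2[OF vec_eq_iff], rule allI)
    fix i
    obtain k where k: "z $ i = of_int k" using assms by (auto simp: integer_lattice_def elim: Ints_cases)
    have "0 \<le> x $ i - z $ i" "x $ i - z $ i < 1" using h by (auto simp: half_open_cube_def)
    then have "\<lfloor>x $ i\<rfloor> = k" using k by (simp add: floor_eq_iff)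
    then show "z $ i = floor_vec x $ i" using k by (simp add: floor_vec_def)
  qed
next
  assume "z = floor_vec x"
  then show "x - z \<in> half_open_cube"
    by (auto simp: half_open_cube_def floor_vec_def) linarith
qed

lemma mem_translate: "x \<in> (+) z ` A \<longleftrightarrow> x - (z :: 'a :: ab_group_add) \<in> A"
  by (auto intro!: image_eqI[of _ _ "x - z"])

lemma mem_translate_minus: "x \<in> (\<lambda>y. y - (z :: 'a :: ab_group_add)) ` A \<longleftrightarrow> x + z \<in> A"
  by (auto intro!: image_eqI[of _ _ "x + z"])

lemma emeasure_lattice_cubes:
  assumes F: "finite F" "F \<subseteq> (integer_lattice :: (real ^ 'n) set)"
  shows "emeasure lborel (\<Union>z\<in>F. (+) z ` half_open_cube) = of_nat (card F)"
    and "(\<Union>z\<in>F. (+) z ` half_open_cube) \<in> sets borel"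
proof -
  have pre: "(+) z ` half_open_cube = (\<lambda>x. - z + x) -` half_open_cube" for z :: "real ^ 'n"
    by (rule set_eqI) (simp add: mem_translate)
  have s: "(+) z ` half_open_cube \<in> sets borel" for z :: "real ^ 'n"
  proof -
    have "(\<lambda>x. - z + x) -` half_open_cube \<inter> space borel \<in> sets borel"
      by (rule measurable_sets[OF _ half_open_cube_sets]) simp
    then show ?thesis unfolding pre by (simp only: space_borel Int_UNIV_right)
  qed
  then show "(\<Union>z\<in>F. (+) z ` half_open_cube) \<in> sets borel" using F by auto
  have one: "emeasure lborel ((+) z ` half_open_cube) = 1" for z :: "real ^ 'n"
  proof -
    have "emeasure lborel (half_open_cube :: (real ^ 'n) set) = emeasure (distr lborel borel ((+) (- z))) half_open_cube"
      by (simp add: lborel_distr_plus)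
    also have "\<dots> = emeasure lborel ((+) z ` half_open_cube)"
      unfolding pre by (subst emeasure_distr) (auto simp: half_open_cube_sets)
    finally show ?thesis by (simp add: emeasure_half_open_cube)
  qed
  have "disjoint_family_on (\<lambda>z. (+) z ` half_open_cube) F"
    unfolding disjoint_family_on_def
  proof (intro ballI impI)
    fix z z' assume z: "z \<in> F" "z' \<in> F" "z \<noteq> z'"
    have False if "x \<in> (+) z ` half_open_cube" "x \<in> (+) z' ` half_open_cube" for x
    proof -
      have "z = floor_vec x" "z' = floor_vec x"
        using that z F half_open_cube_floor unfolding mem_translate by auto
      then show False using z(3) by simp
    qed
    then show "(+) z ` half_open_cube \<inter> (+) z' ` half_open_cube = {}" by blast
  qed
  then have "(\<Sum>z\<in>F. emeasure lborel ((+) z ` half_open_cube)) = emeasure lborel (\<Union>z\<in>F. (+) z ` half_open_cube)"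
    using s F by (intro sum_emeasure) auto
  then show "emeasure lborel (\<Union>z\<in>F. (+) z ` half_open_cube) = of_nat (card F)"
    by (simp add: one)
qed

lemma card_lattice_cubes_le:
  assumes F: "finite F" "F \<subseteq> integer_lattice" and S: "compact S" "\<And>z. z \<in> F \<Longrightarrow> (+) z ` unit_cube \<subseteq> S"
  shows "card F \<le> measure lborel S"
proof -
  have "half_open_cube \<subseteq> (unit_cube :: (real ^ 'n) set)" by (auto simp: half_open_cube_def unit_cube_def less_imp_le)
  then have "(\<Union>z\<in>F. (+) z ` half_open_cube) \<subseteq> S" using S(2) by blast
  then have "emeasure lborel (\<Union>z\<in>F. (+) z ` half_open_cube) \<le> emeasure lborel S"
    by (rule emeasure_mono) (use S in \<open>simp add: compact_imp_closed borel_closed\<close>)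
  also have "\<dots> = ennreal (measure lborel S)"
    using emeasure_compact_finite[OF S(1)] by (intro emeasure_eq_ennreal_measure) (simp add: less_top)
  finally show ?thesis
    unfolding emeasure_lattice_cubes(1)[OF F] by (simp add: ennreal_of_nat_eq_real_of_nat)
qed

lemma card_lattice_cubes_ge:
  assumes F: "finite F" "F \<subseteq> integer_lattice" and S: "compact S" "S \<subseteq> (\<Union>z\<in>F. (+) z ` half_open_cube)"
  shows "measure lborel S \<le> card F"
proof -
  have "ennreal (measure lborel S) = emeasure lborel S"
    using emeasure_compact_finite[OF S(1)] by (intro emeasure_eq_ennreal_measure[symmetric]) (simp add: less_top)
  also have "\<dots> \<le> emeasure lborel (\<Union>z\<in>F. (+) z ` half_open_cube)"
    by (rule emeasure_mono[OF S(2)]) (simp add: emeasure_lattice_cubes(2)[OF F])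
  finally show ?thesis
    unfolding emeasure_lattice_cubes(1)[OF F] by (simp add: ennreal_of_nat_eq_real_of_nat)
qed

section \<open>Decomposition of additive functionals into half-open cubes\<close>

lemma geometric_functional_add:
  "geometric_functional \<phi> \<Longrightarrow> polyconvex A \<Longrightarrow> polyconvex B \<Longrightarrow> \<phi> (A \<union> B) = \<phi> A + \<phi> B - \<phi> (A \<inter> B)"
  and geometric_functional_empty: "geometric_functional \<phi> \<Longrightarrow> \<phi> {} = 0"
  and geometric_functional_translate: "geometric_functional \<phi> \<Longrightarrow> polyconvex A \<Longrightarrow> \<phi> ((\<lambda>y. y + z) ` A) = \<phi> A"
  and geometric_functional_measurable:
    "geometric_functional \<phi> \<Longrightarrow> \<phi> \<in> borel_measurable (restrict_space fell_borel {A. polyconvex A})"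
  unfolding geometric_functional_def by blast+

lemma on_half_open_cube_translate:
  assumes phi: "geometric_functional \<phi>" and A: "polyconvex A"
  shows "on_half_open_cube \<phi> ((\<lambda>y. y - z) ` A) = \<phi> (A \<inter> (+) z ` unit_cube) - \<phi> (A \<inter> (+) z ` upper_boundary)"
proof -
  have "\<phi> ((\<lambda>y. y - z) ` A \<inter> B) = \<phi> (A \<inter> (+) z ` B)" if B: "polyconvex B" for B
  proof -
    have "polyconvex ((\<lambda>y. y - z) ` A \<inter> B)"
      using polyconvex_Int[OF polyconvex_translation[OF A, of "- z"] B] by (simp add: image_def)
    then have "\<phi> ((\<lambda>y. y - z) ` A \<inter> B) = \<phi> ((\<lambda>y. y + z) ` ((\<lambda>y. y - z) ` A \<inter> B))"
      by (rule geometric_functional_translate[OF phi, symmetric])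
    also have "(\<lambda>y. y + z) ` ((\<lambda>y. y - z) ` A \<inter> B) = A \<inter> (+) z ` B"
    proof (rule set_eqI)
      fix x
      have "x \<in> (\<lambda>y. y + z) ` ((\<lambda>y. y - z) ` A \<inter> B) \<longleftrightarrow> x - z \<in> (\<lambda>y. y - z) ` A \<inter> B"
        using mem_translate[of x z "(\<lambda>y. y - z) ` A \<inter> B"] by (simp add: add.commute)
      then show "x \<in> (\<lambda>y. y + z) ` ((\<lambda>y. y - z) ` A \<inter> B) \<longleftrightarrow> x \<in> A \<inter> (+) z ` B"
        by (simp add: mem_translate mem_translate_minus)
    qed
    finally show ?thesis .
  qed
  then show ?thesis
    unfolding on_half_open_cube_def using polyconvex_unit_cube polyconvex_upper_boundary by metis
qed

text \<open>The indicator of \<open>A\<close> is the sum over \<open>z\<close> of the indicators of \<open>A\<close> in the closed cubes minus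
  those of \<open>A\<close> in their upper boundaries, since the half-open cubes are disjoint and cover \<open>A\<close>. By
  \<open>valuation_linear_relation\<close> the same relation holds for the values of \<open>\<phi>\<close>.\<close>

lemma functional_lattice_decomposition:
  fixes \<phi> :: "(real ^ 'n) set \<Rightarrow> real"
  assumes phi: "geometric_functional \<phi>" and A: "polyconvex A"
    and F: "finite F" "F \<subseteq> integer_lattice" "A \<subseteq> (\<Union>z\<in>F. (+) z ` half_open_cube)"
  shows "\<phi> A = (\<Sum>z\<in>F. on_half_open_cube \<phi> ((\<lambda>y. y - z) ` A))"
proof -
  \<comment> \<open>\<open>None\<close> is the index of \<open>A\<close> itself; \<open>Some (z, b)\<close> belongs to the closed cube or its upper boundary at \<open>z\<close>\<close>
  define B where "B = (\<lambda>i. case i of None \<Rightarrow> A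
    | Some (z, b) \<Rightarrow> A \<inter> (+) z ` (if b then unit_cube else upper_boundary))"
  define a where "a = (\<lambda>i :: ((real ^ 'n) \<times> bool) option. case i of None \<Rightarrow> - 1
    | Some (z, b) \<Rightarrow> (if b then 1 else - 1 :: real))"
  let ?I = "insert None (Some ` (F \<times> (UNIV :: bool set)))"
  have sum: "(\<Sum>i\<in>?I. a i * f (B i)) = - f A
      + (\<Sum>z\<in>F. f (A \<inter> (+) z ` unit_cube) - f (A \<inter> (+) z ` upper_boundary))" for f :: "(real ^ 'n) set \<Rightarrow> real"
  proof -
    have "(\<Sum>i\<in>?I. a i * f (B i)) = a None * f (B None) + (\<Sum>i\<in>Some ` (F \<times> (UNIV :: bool set)). a i * f (B i))"
      using F(1) by (subst sum.insert) auto
    also have "(\<Sum>i\<in>Some ` (F \<times> (UNIV :: bool set)). a i * f (B i))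
        = (\<Sum>p\<in>F \<times> (UNIV :: bool set). a (Some p) * f (B (Some p)))"
      by (subst sum.reindex) auto
    also have "\<dots> = (\<Sum>z\<in>F. \<Sum>b\<in>(UNIV :: bool set). a (Some (z, b)) * f (B (Some (z, b))))"
      by (subst sum.cartesian_product) (simp add: case_prod_unfold)
    also have "\<dots> = (\<Sum>z\<in>F. f (A \<inter> (+) z ` unit_cube) - f (A \<inter> (+) z ` upper_boundary))"
      by (simp add: UNIV_bool a_def B_def)
    finally show ?thesis by (simp add: a_def B_def)
  qed
  have "(\<Sum>i\<in>?I. a i * \<phi> (B i)) = 0"
  proof (rule valuation_linear_relation[where L = "{A. polyconvex A}"])
    show "finite ?I" using F(1) by simp
    show "B i \<in> {A. polyconvex A}" for i
      using A polyconvex_unit_cube polyconvex_upper_boundary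
      by (auto simp: B_def split: option.splits intro!: polyconvex_Int polyconvex_translation)
    fix x
    have ind: "indicator (A \<inter> (+) z ` unit_cube) x - indicator (A \<inter> (+) z ` upper_boundary) x
        = (if z = floor_vec x then indicator A x else (0 :: real))" if "z \<in> F" for z
    proof -
      have "x - z \<in> half_open_cube \<longleftrightarrow> z = floor_vec x" using half_open_cube_floor that F(2) by blast
      moreover have "half_open_cube \<subseteq> (unit_cube :: (real ^ 'n) set)"
        by (auto simp: half_open_cube_def unit_cube_def less_imp_le)
      ultimately show ?thesis
        by (auto simp: indicator_def mem_translate upper_boundary_def)
    qed
    have "(\<Sum>z\<in>F. indicator (A \<inter> (+) z ` unit_cube) x - indicator (A \<inter> (+) z ` upper_boundary) x)
        = (\<Sum>z\<in>F. if z = floor_vec x then indicator A x else (0 :: real))"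
      by (rule sum.cong[OF refl ind])
    also have "\<dots> = indicator A x"
    proof (cases "x \<in> A")
      case True
      then obtain z where z: "z \<in> F" "x - z \<in> half_open_cube" using F(3) unfolding mem_translate[symmetric] by blast
      then have "z = floor_vec x" using half_open_cube_floor F(2) by blast
      then show ?thesis using z(1) F(1) by simp
    qed (simp add: F(1))
    finally show "(\<Sum>i\<in>?I. a i * indicator (B i) x) = 0"
      using sum[of "\<lambda>S. indicator S x"] by simp
  qed (use phi in \<open>auto intro: polyconvex_Un polyconvex_Int geometric_functional_add geometric_functional_empty\<close>)
  then have "\<phi> A = (\<Sum>z\<in>F. \<phi> (A \<inter> (+) z ` unit_cube) - \<phi> (A \<inter> (+) z ` upper_boundary))"
    using sum[of \<phi>] by simp
  then show ?thesis using on_half_open_cube_translate[OF phi A] by simp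
qed

text \<open>Used for the upper boundary of the cube, which is a union of facets and not convex. One more
  set \<open>F j\<close> turns a bound \<open>\<beta>\<close> into \<open>b + 2 * \<beta>\<close>.\<close>

lemma valuation_Union_bound:
  fixes \<phi> :: "'a::euclidean_space set \<Rightarrow> real"
  assumes empty: "\<phi> {} = 0"
    and add: "\<And>A B. polyconvex A \<Longrightarrow> polyconvex B \<Longrightarrow> \<phi> (A \<union> B) = \<phi> A + \<phi> B - \<phi> (A \<inter> B)"
    and Z: "\<And>C. polyconvex C \<Longrightarrow> polyconvex (Z \<inter> C)"
    and b: "\<And>C. compact C \<Longrightarrow> convex C \<Longrightarrow> C \<subseteq> C0 \<Longrightarrow> \<bar>\<phi> (Z \<inter> C)\<bar> \<le> b"
    and "finite J" "\<And>j. j \<in> J \<Longrightarrow> closed (F j) \<and> convex (F j)" "compact D" "convex D" "D \<subseteq> C0"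
  shows "\<bar>\<phi> (Z \<inter> (D \<inter> (\<Union>j\<in>J. F j)))\<bar> \<le> (2 ^ card J - 1) * b"
  using assms(5-)
proof (induction J arbitrary: D rule: finite_induct)
  case empty
  then show ?case by (simp add: assms(1))
next
  case (insert j J)
  let ?U = "\<Union>j\<in>J. F j"
  have Fj: "closed (F j)" "convex (F j)" using insert.prems(1)[of j] by auto
  have F: "closed (F i) \<and> convex (F i)" if "i \<in> J" for i using insert.prems(1) that by blast
  have DF: "compact (D \<inter> F j)" "convex (D \<inter> F j)" "D \<inter> F j \<subseteq> C0"
    using Fj insert.prems by (auto intro: compact_Int_closed convex_Int)
  have pU: "polyconvex (C \<inter> ?U)" if "compact C" "convex C" for C
  proof -
    have "C \<inter> ?U = (\<Union>i\<in>J. C \<inter> F i)" by blast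
    moreover have "polyconvex (\<Union>i\<in>J. C \<inter> F i)"
      by (rule polyconvex_UN[OF insert.hyps(1)], rule polyconvex_Int_closed_convex[OF polyconvexI[OF that]]) (use F in auto)
    ultimately show ?thesis by simp
  qed
  have "\<phi> ((Z \<inter> (D \<inter> F j)) \<union> (Z \<inter> (D \<inter> ?U)))
      = \<phi> (Z \<inter> (D \<inter> F j)) + \<phi> (Z \<inter> (D \<inter> ?U)) - \<phi> ((Z \<inter> (D \<inter> F j)) \<inter> (Z \<inter> (D \<inter> ?U)))"
    by (rule add) (intro Z polyconvexI DF pU insert.prems)+
  moreover have "(Z \<inter> (D \<inter> F j)) \<union> (Z \<inter> (D \<inter> ?U)) = Z \<inter> (D \<inter> (\<Union>i\<in>insert j J. F i))" by blast
  moreover have "(Z \<inter> (D \<inter> F j)) \<inter> (Z \<inter> (D \<inter> ?U)) = Z \<inter> (D \<inter> F j \<inter> ?U)" by blast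
  ultimately have "\<phi> (Z \<inter> (D \<inter> (\<Union>i\<in>insert j J. F i)))
      = \<phi> (Z \<inter> (D \<inter> F j)) + \<phi> (Z \<inter> (D \<inter> ?U)) - \<phi> (Z \<inter> (D \<inter> F j \<inter> ?U))" by simp
  moreover have "\<bar>\<phi> (Z \<inter> (D \<inter> F j))\<bar> \<le> b" by (rule b[OF DF])
  moreover have "\<bar>\<phi> (Z \<inter> (D \<inter> ?U))\<bar> \<le> (2 ^ card J - 1) * b"
    by (rule insert.IH[OF F insert.prems(2-4)])
  moreover have "\<bar>\<phi> (Z \<inter> (D \<inter> F j \<inter> ?U))\<bar> \<le> (2 ^ card J - 1) * b"
    by (rule insert.IH[OF F DF])
  ultimately have "\<bar>\<phi> (Z \<inter> (D \<inter> (\<Union>i\<in>insert j J. F i)))\<bar> \<le> b + 2 * ((2 ^ card J - 1) * b)" by linarith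
  also have "\<dots> = (2 ^ card (insert j J) - 1) * b" using insert.hyps by (simp add: algebra_simps)
  finally show ?case .
qed

lemma on_half_open_cube_bound:
  fixes \<phi> :: "(real ^ 'n) set \<Rightarrow> real"
  assumes phi: "geometric_functional \<phi>"
    and Z: "\<And>C. polyconvex C \<Longrightarrow> polyconvex (Z \<inter> C)"
    and b: "\<And>C. compact C \<Longrightarrow> convex C \<Longrightarrow> C \<subseteq> unit_cube \<Longrightarrow> \<bar>\<phi> (Z \<inter> C)\<bar> \<le> b"
    and D: "closed D" "convex D"
  shows "\<bar>on_half_open_cube \<phi> (Z \<inter> D)\<bar> \<le> 2 ^ CARD('n) * b"
proof -
  have D': "compact (D \<inter> unit_cube)" "convex (D \<inter> unit_cube)" "D \<inter> unit_cube \<subseteq> unit_cube"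
    using D compact_unit_cube convex_unit_cube by (auto intro: closed_Int_compact convex_Int)
  have "\<bar>\<phi> (Z \<inter> (D \<inter> unit_cube))\<bar> \<le> b" by (rule b[OF D'])
  moreover have "\<bar>\<phi> (Z \<inter> (D \<inter> unit_cube \<inter> (\<Union>i\<in>UNIV. upper_face i)))\<bar> \<le> (2 ^ CARD('n) - 1) * b"
    by (rule valuation_Union_bound[where ?C0.0 = unit_cube])
      (auto intro: geometric_functional_empty[OF phi] geometric_functional_add[OF phi] Z b D' upper_face_closed upper_face_convex)
  moreover have "on_half_open_cube \<phi> (Z \<inter> D)
      = \<phi> (Z \<inter> (D \<inter> unit_cube)) - \<phi> (Z \<inter> (D \<inter> unit_cube \<inter> (\<Union>i\<in>UNIV. upper_face i)))"
    unfolding on_half_open_cube_def upper_boundary_faces by (simp only: Int_assoc)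
  ultimately have "\<bar>on_half_open_cube \<phi> (Z \<inter> D)\<bar> \<le> b + (2 ^ CARD('n) - 1) * b" by linarith
  then show ?thesis by (simp add: algebra_simps)
qed

section \<open>Counting lattice cubes in a large window\<close>

definition cubes_hitting :: "(real ^ 'n) set \<Rightarrow> (real ^ 'n) set" where
  "cubes_hitting S = {z\<in>integer_lattice. (+) z ` unit_cube \<inter> S \<noteq> {}}"

definition cubes_inside :: "(real ^ 'n) set \<Rightarrow> (real ^ 'n) set" where
  "cubes_inside S = {z\<in>integer_lattice. (+) z ` unit_cube \<subseteq> S}"

lemma cube_diameter:
  fixes x y z :: "real ^ 'n"
  assumes "x \<in> (+) z ` unit_cube" "y \<in> (+) z ` unit_cube" shows "dist x y \<le> 2 * CARD('n)"
proof -
  have "dist x y \<le> norm (x - z) + norm (y - z)"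
    using norm_triangle_ineq4[of "x - z" "y - z"] by (simp add: dist_norm)
  then show ?thesis using norm_unit_cube[of "x - z"] norm_unit_cube[of "y - z"] assms
    by (simp add: mem_translate)
qed

lemma cubes_inside_subset: "cubes_inside S \<subseteq> cubes_hitting S"
  unfolding cubes_inside_def cubes_hitting_def using zero_in_unit_cube by auto

lemma finite_cubes_hitting:
  fixes S :: "(real ^ 'n) set" assumes S: "compact S" shows "finite (cubes_hitting S)"
proof (rule ccontr)
  assume inf: "infinite (cubes_hitting S)"
  let ?P = "parallel_body S (2 * CARD('n))"
  obtain n :: nat where n: "measure lborel ?P < real n" using reals_Archimedean2 by blast
  obtain F where F: "finite F" "card F = n" "F \<subseteq> cubes_hitting S"
    using infinite_arbitrarily_large[OF inf, of n] by blast
  have "card F \<le> measure lborel ?P"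
  proof (rule card_lattice_cubes_le[OF F(1)])
    show "F \<subseteq> integer_lattice" using F(3) by (auto simp: cubes_hitting_def)
    show "compact ?P" by (rule parallel_body_compact[OF S])
    fix z assume "z \<in> F"
    then obtain s where s: "s \<in> (+) z ` unit_cube" "s \<in> S" using F(3) unfolding cubes_hitting_def by blast
    show "(+) z ` unit_cube \<subseteq> ?P"
      using cube_diameter[OF s(1)] s(2) unfolding parallel_body_def by auto
  qed
  then show False using n F(2) by simp
qed

lemma cubes_hitting_cover: "S \<subseteq> (\<Union>z\<in>cubes_hitting S. (+) z ` half_open_cube)"
proof
  fix x assume x: "x \<in> S"
  have h: "x - floor_vec x \<in> half_open_cube" using half_open_cube_floor[OF floor_vec_lattice] by blast
  then have "x - floor_vec x \<in> unit_cube" by (auto simp: half_open_cube_def unit_cube_def less_imp_le)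
  then have "floor_vec x \<in> cubes_hitting S"
    unfolding cubes_hitting_def using x floor_vec_lattice mem_translate[of x "floor_vec x"] by blast
  then show "x \<in> (\<Union>z\<in>cubes_hitting S. (+) z ` half_open_cube)" using h by (auto simp: mem_translate)
qed

text \<open>The half-open cubes are disjoint with volume 1; those inside \<open>S\<close> have total volume at most
  that of \<open>S\<close>, and those that meet \<open>S\<close> cover it.\<close>

lemma cubes_inside_volume:
  fixes S :: "(real ^ 'n) set" assumes S: "compact S"
  shows "\<bar>card (cubes_inside S) - measure lborel S\<bar> \<le> card (cubes_hitting S - cubes_inside S)"
proof -
  have fin: "finite (cubes_hitting S)" "finite (cubes_inside S)"
    using finite_cubes_hitting[OF S] cubes_inside_subset finite_subset by blast+
  have "measure lborel S \<le> card (cubes_hitting S)"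
    by (rule card_lattice_cubes_ge[OF fin(1) _ S cubes_hitting_cover]) (auto simp: cubes_hitting_def)
  moreover have "card (cubes_inside S) \<le> measure lborel S"
    by (rule card_lattice_cubes_le[OF fin(2) _ S]) (auto simp: cubes_inside_def)
  moreover have "card (cubes_hitting S) = card (cubes_inside S) + card (cubes_hitting S - cubes_inside S)"
    using card_Diff_subset[OF fin(2) cubes_inside_subset] card_mono[OF fin(1) cubes_inside_subset] by simp
  ultimately show ?thesis by simp
qed

lemma measure_scaleR_image:
  fixes S :: "'a::euclidean_space set"
  assumes "compact S" "0 \<le> r" shows "measure lborel ((*\<^sub>R) r ` S) = r ^ DIM('a) * measure lborel S"
proof -
  have c: "compact ((*\<^sub>R) r ` S)" using assms by (intro compact_scaling)
  have leb: "measure lebesgue T = measure lborel T" if "compact T" for T :: "'a set"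
    using that by (intro measure_completion) (simp add: compact_imp_closed borel_closed)
  show ?thesis
    using measure_lebesgue_affine[of r 0 S] assms leb[OF c] leb[OF assms(1)] by simp
qed

text \<open>A cube is connected; if it meets both the window and its complement, it meets the frontier,
  and so it lies in a neighbourhood of it whose width bounds the diameter of the cube. In the
  coordinates of \<open>W\<close> this width is divided by \<open>r\<close>.\<close>

lemma boundary_cubes_card:
  fixes W :: "(real ^ 'n) set"
  assumes W: "compact W" and r: "0 < r"
  shows "card (cubes_hitting (window W r) - cubes_inside (window W r))
    \<le> r ^ CARD('n) * measure lborel (parallel_body (frontier W) (2 * CARD('n) / r))"
proof -
  let ?W = "window W r" and ?N = "parallel_body (frontier W) (2 * CARD('n) / r)"
  have cW: "compact ?W" unfolding window_def using compact_scaling[OF W] by simp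
  have cN: "compact ?N" by (intro parallel_body_compact compact_frontier W)
  have "card (cubes_hitting ?W - cubes_inside ?W) \<le> measure lborel ((*\<^sub>R) r ` ?N)"
  proof (rule card_lattice_cubes_le)
    show "finite (cubes_hitting ?W - cubes_inside ?W)" using finite_cubes_hitting[OF cW] by simp
    show "cubes_hitting ?W - cubes_inside ?W \<subseteq> integer_lattice" by (auto simp: cubes_hitting_def)
    show "compact ((*\<^sub>R) r ` ?N)" by (rule compact_scaling[OF cN])
    fix z assume z: "z \<in> cubes_hitting ?W - cubes_inside ?W"
    let ?T = "(+) z ` unit_cube" and ?S = "(*\<^sub>R) (1 / r) ` (+) z ` unit_cube"
    obtain p q where p: "p \<in> ?T" "p \<in> ?W" and q: "q \<in> ?T" "q \<notin> ?W"
      using z unfolding cubes_hitting_def cubes_inside_def by blast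
    have "(1 / r) *\<^sub>R p \<in> W" using p(2) r by (auto simp: window_def)
    then have 1: "?S \<inter> W \<noteq> {}" using p(1) by blast
    have "(1 / r) *\<^sub>R q \<notin> W"
    proof
      assume "(1 / r) *\<^sub>R q \<in> W"
      then have "r *\<^sub>R ((1 / r) *\<^sub>R q) \<in> ?W" unfolding window_def by blast
      then show False using q(2) r by simp
    qed
    then have 2: "?S - W \<noteq> {}" using q(1) by blast
    have "connected ?S"
      by (intro convex_connected convex_scaling convex_translation convex_unit_cube)
    from connected_Int_frontier[OF this 1 2]
    obtain f0 where f0: "f0 \<in> ?T" "(1 / r) *\<^sub>R f0 \<in> frontier W" by blast
    show "?T \<subseteq> (*\<^sub>R) r ` ?N"
    proof
      fix y assume y: "y \<in> ?T"
      have "dist ((1 / r) *\<^sub>R f0) ((1 / r) *\<^sub>R y) = dist f0 y / r"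
        using r by (simp add: dist_norm scaleR_diff_right[symmetric])
      also have "\<dots> \<le> 2 * CARD('n) / r" using cube_diameter[OF f0(1) y] r by (intro divide_right_mono) auto
      finally have "(1 / r) *\<^sub>R y \<in> ?N" unfolding parallel_body_def using f0(2) by auto
      moreover have "y = r *\<^sub>R ((1 / r) *\<^sub>R y)" using r by simp
      ultimately show "y \<in> (*\<^sub>R) r ` ?N" by blast
    qed
  qed
  also have "\<dots> = r ^ CARD('n) * measure lborel ?N"
    using measure_scaleR_image[OF cN, of r] r by simp
  finally show ?thesis .
qed

text \<open>The neighbourhoods decrease to the frontier, which is compact, and the frontier of a convex
  set has measure zero.\<close>

lemma frontier_parallel_volume_tendsto_0:
  fixes W :: "'a::euclidean_space set"
  assumes W: "compact W" "convex W"
  shows "((\<lambda>r. measure lborel (parallel_body (frontier W) (c / r))) \<longlongrightarrow> 0) at_top"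
proof -
  let ?N = "\<lambda>s. parallel_body (frontier W) s"
  have cN: "compact (?N s)" for s by (intro parallel_body_compact compact_frontier W)
  have bN: "?N s \<in> sets lborel" for s using cN by (simp add: compact_imp_closed borel_closed)
  have fN: "emeasure lborel (?N s) \<noteq> \<infinity>" for s using emeasure_compact_finite[OF cN[of s]] by (simp add: less_top)
  have mono: "?N s \<subseteq> ?N t" if "s \<le> t" for s t using that unfolding parallel_body_def by fastforce
  have "(\<lambda>n. measure lborel (?N (1 / Suc n))) \<longlonglongrightarrow> measure lborel (\<Inter>n. ?N (1 / Suc n))"
  proof (rule Lim_measure_decseq)
    show "range (\<lambda>n. ?N (1 / Suc n)) \<subseteq> sets lborel" using bN by auto
    show "decseq (\<lambda>n. ?N (1 / Suc n))" unfolding decseq_def by (intro allI impI mono) (simp add: frac_le)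
    show "emeasure lborel (?N (1 / Suc n)) \<noteq> \<infinity>" for n by (rule fN)
  qed
  also have "(\<Inter>n. ?N (1 / Suc n)) = frontier W"
  proof
    show "frontier W \<subseteq> (\<Inter>n. ?N (1 / Suc n))"
    proof (intro INT_greatest subsetI)
      fix n x assume "x \<in> frontier W"
      then show "x \<in> ?N (1 / Suc n)" unfolding parallel_body_def by (intro UN_I[of x]) auto
    qed
    show "(\<Inter>n. ?N (1 / Suc n)) \<subseteq> frontier W"
    proof
      fix x assume x: "x \<in> (\<Inter>n. ?N (1 / Suc n))"
      have "\<exists>y\<in>frontier W. dist y x < e" if "e > 0" for e
      proof -
        obtain n :: nat where n: "1 / Suc n < e" using nat_approx_posE[OF \<open>e > 0\<close>] by auto
        have "x \<in> ?N (1 / Suc n)" using x by blast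
        then obtain y where y: "y \<in> frontier W" "dist y x \<le> 1 / Suc n" unfolding parallel_body_def by auto
        then show ?thesis using n by (intro bexI[of _ y]) auto
      qed
      then have "x \<in> closure (frontier W)" unfolding closure_approachable by blast
      then show "x \<in> frontier W" by simp
    qed
  qed
  also have "measure lborel (frontier W) = 0"
  proof -
    have "measure lebesgue (frontier W) = 0"
      using negligible_convex_frontier[OF W(2)] by (rule negligible_imp_measure0)
    then show ?thesis by (subst (asm) measure_completion) (simp_all add: borel_closed)
  qed
  finally have lim: "(\<lambda>n. measure lborel (?N (1 / Suc n))) \<longlonglongrightarrow> 0" .
  show ?thesis
  proof (rule tendstoI)
    fix e :: real assume "0 < e"
    then obtain n where n: "measure lborel (?N (1 / Suc n)) < e"
      using lim[THEN tendstoD, of e] by (auto simp: eventually_sequentially dist_real_def)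
    have "\<forall>\<^sub>F r in at_top. r > max 0 (c * Suc n)" by (rule eventually_gt_at_top)
    then show "\<forall>\<^sub>F r in at_top. dist (measure lborel (?N (c / r))) 0 < e"
    proof eventually_elim
      case (elim r)
      then have "c / r \<le> 1 / Suc n" by (simp add: field_simps)
      then have "measure lborel (?N (c / r)) \<le> measure lborel (?N (1 / Suc n))"
        by (intro measure_mono_fmeasurable mono) (use bN fN in \<open>auto simp: fmeasurable_def less_top\<close>)
      then show ?case using n by (simp add: dist_real_def)
    qed
  qed
qed

section \<open>Expectations with respect to the completed probability\<close>

text \<open>The functional is unconstrained off the polyconvex sets, so that in general only a
  modification of it is measurable with respect to the original sigma-algebra.\<close>

lemma borel_measurable_completion_AE:
  fixes f h :: "'w \<Rightarrow> real"
  assumes f: "f \<in> borel_measurable M" and ae: "AE x in M. h x = f x"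
  shows "h \<in> borel_measurable (completion M)"
proof (rule measurableI)
  fix S :: "real set" assume S: "S \<in> sets borel"
  obtain N where N: "{x\<in>space M. h x \<noteq> f x} \<subseteq> N" "emeasure M N = 0" "N \<in> sets M"
    using AE_E[OF ae] by auto
  then have null: "N \<in> null_sets M" by auto
  have eq: "h -` S \<inter> space M = ((f -` S \<inter> space M) - N) \<union> ((h -` S \<inter> space M) \<inter> N)" using N(1) by auto
  have 1: "(f -` S \<inter> space M) - N \<in> sets (completion M)"
    using measurable_sets[OF f S] N(3) by blast
  have 2: "(h -` S \<inter> space M) \<inter> N \<in> sets (completion M)"
    by (rule sets_completionI_sub[OF null]) blast
  show "h -` S \<inter> space (completion M) \<in> sets (completion M)"
    unfolding space_completion by (subst eq) (rule sets.Un[OF 1 2])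
qed simp

lemma expect_AE_eq:
  fixes f h :: "'w \<Rightarrow> real"
  assumes f: "integrable M f" and ae: "AE x in M. h x = f x"
  shows "integrable (completion M) h" "expect M h = (\<integral>x. f x \<partial>M)"
proof -
  have m: "f \<in> borel_measurable M" using f by auto
  have cm: "f \<in> borel_measurable (completion M)" by (rule measurable_completion[OF m])
  have h: "h \<in> borel_measurable (completion M)" by (rule borel_measurable_completion_AE[OF m ae])
  have ae': "AE x in completion M. h x = f x" by (rule AE_completion[OF ae])
  show "integrable (completion M) h"
    using integrable_cong_AE[OF h cm ae'] integrable_completion[OF m] f by simp
  show "expect M h = (\<integral>x. f x \<partial>M)"
    unfolding expect_def using integral_cong_AE[OF h cm ae'] integral_completion[OF m] by simp
qed

section \<open>Stationarity\<close>

context shot_noise_model begin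

definition shift :: "'a \<Rightarrow> 'a \<times> 'm \<Rightarrow> 'a \<times> 'm" where
  "shift z w = (fst w - z, snd w)"

lemma shift_measurable: "shift z \<in> intensity \<rightarrow>\<^sub>M intensity"
proof -
  have "shift z \<in> borel \<Otimes>\<^sub>M Q \<rightarrow>\<^sub>M borel \<Otimes>\<^sub>M Q" unfolding shift_def by measurable
  then show ?thesis by (simp only: measurable_cong_sets[OF sets_intensity sets_intensity])
qed

lemma shift_preserves_intensity:
  assumes B: "B \<in> sets intensity"
  shows "emeasure intensity (shift z -` B \<inter> space intensity) = emeasure intensity B"
proof -
  have SB: "shift z -` B \<inter> space intensity \<in> sets intensity" by (rule measurable_sets[OF shift_measurable B])
  have "emeasure lborel ((\<lambda>x. (x, m)) -` (shift z -` B \<inter> space intensity)) = emeasure lborel ((\<lambda>x. (x, m)) -` B)"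
    if m: "m \<in> space Q" for m
  proof -
    have sec: "(\<lambda>x. (x, m)) -` B \<in> sets borel"
      using B unfolding sets_intensity by (rule sets_Pair2)
    have "(\<lambda>x. (x, m)) -` (shift z -` B \<inter> space intensity) = (\<lambda>x. - z + x) -` ((\<lambda>x. (x, m)) -` B)"
      using m by (auto simp: shift_def space_intensity)
    moreover have "emeasure lborel ((\<lambda>x. (x, m)) -` B) = emeasure (distr lborel borel ((+) (- z))) ((\<lambda>x. (x, m)) -` B)"
      by (simp only: lborel_distr_plus)
    moreover have "\<dots> = emeasure lborel ((\<lambda>x. - z + x) -` ((\<lambda>x. (x, m)) -` B))"
      by (subst emeasure_distr[OF _ sec]) auto
    ultimately show ?thesis by simp
  qed
  then show ?thesis
    unfolding emeasure_intensity[OF SB] emeasure_intensity[OF B] by (intro nn_integral_cong) simp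
qed

lemma poisson_process_shift:
  assumes "prob_space P" "poisson_process P intensity \<eta>"
  shows "poisson_process P intensity (\<lambda>\<omega>. push (shift z) (\<eta> \<omega>))"
  by (rule poisson_process_push[OF assms shift_measurable shift_preserves_intensity])

text \<open>Moving all germs by \<open>- z\<close> moves the excursion set by \<open>- z\<close>; together with
  \<open>poisson_process_shift\<close> this is the stationarity of the excursion set.\<close>

lemma excursion_push_shift:
  assumes mu: "point_measure_on intensity \<mu>"
  shows "excursion_set g u (push (shift z) \<mu>) = (\<lambda>y. y - z) ` excursion_set g u \<mu>"
proof -
  have eq: "sets \<mu> = sets intensity" by (rule point_measure_on_sets[OF mu])
  have T: "shift z \<in> \<mu> \<rightarrow>\<^sub>M \<mu>" using shift_measurable by (simp only: measurable_cong_sets[OF eq eq])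
  have sn: "shot_noise g (push (shift z) \<mu>) y = shot_noise g \<mu> (y + z)" for y
  proof -
    have m: "(\<lambda>w. ennreal (g (snd w) (y - fst w))) \<in> borel_measurable \<mu>"
      using shot_noise_integrand_measurable by (simp only: measurable_cong_sets[OF eq refl])
    have "shot_noise g (push (shift z) \<mu>) y = (\<integral>\<^sup>+w. ennreal (g (snd (shift z w)) (y - fst (shift z w))) \<partial>\<mu>)"
      unfolding shot_noise_alt push_def by (rule nn_integral_distr[OF T]) (use m in simp)
    also have "\<dots> = shot_noise g \<mu> (y + z)"
      unfolding shot_noise_alt by (simp add: shift_def algebra_simps)
    finally show ?thesis .
  qed
  show ?thesis
    by (rule set_eqI) (simp add: mem_translate_minus excursion_set_def sn)
qed

end

section \<open>Asymptotics of the mean values\<close>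

locale excursion_functional = shot_noise_model Q \<gamma> u g
  for Q :: "'m measure" and \<gamma> u and g :: "'m \<Rightarrow> real ^ 'n \<Rightarrow> real" +
  fixes P :: "'w measure" and \<eta> :: "'w \<Rightarrow> ((real ^ 'n) \<times> 'm) measure" and \<phi> :: "(real ^ 'n) set \<Rightarrow> real"
  assumes P: "prob_space P" and eta: "poisson_process P intensity \<eta>" and phi: "geometric_functional \<phi>"
begin

sublocale P: prob_space P by (rule P)

text \<open>Some bound of \<open>\<phi>\<close> on the convex bodies in the unit cube; the definition of a geometric
  functional provides one.\<close>

definition cube_sup where "cube_sup = (SOME M. \<forall>A. compact A \<and> convex A \<and> A \<subseteq> unit_cube \<longrightarrow> \<bar>\<phi> A\<bar> \<le> M)"

lemma phi_bound: "compact A \<Longrightarrow> convex A \<Longrightarrow> A \<subseteq> unit_cube \<Longrightarrow> \<bar>\<phi> A\<bar> \<le> cube_sup"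
proof -
  have "\<exists>M. \<forall>A. compact A \<and> convex A \<and> A \<subseteq> unit_cube \<longrightarrow> \<bar>\<phi> A\<bar> \<le> M"
    using phi unfolding geometric_functional_def by blast
  from someI_ex[OF this] show "compact A \<Longrightarrow> convex A \<Longrightarrow> A \<subseteq> unit_cube \<Longrightarrow> \<bar>\<phi> A\<bar> \<le> cube_sup"
    unfolding cube_sup_def by blast
qed

definition cube_radius where "cube_radius = CARD('n) + 1"

lemma unit_cube_ball: "(unit_cube :: (real ^ 'n) set) \<subseteq> ball 0 (real cube_radius)"
proof
  fix x :: "real ^ 'n" assume "x \<in> unit_cube"
  from norm_unit_cube[OF this] show "x \<in> ball 0 (real cube_radius)" by (simp add: cube_radius_def)
qed

text \<open>The contribution of the half-open unit cube, after the excursion set is restricted to \<open>D\<close>.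
  For translated windows \<open>D\<close> this covers all cubes that meet the window, and \<open>D = UNIV\<close> gives the
  limit.\<close>

definition cell :: "(real ^ 'n) set \<Rightarrow> ((real ^ 'n) \<times> 'm) measure \<Rightarrow> real" where
  "cell D \<mu> = on_half_open_cube \<phi> (excursion_set g u \<mu> \<inter> D)"

lemma cell_bound:
  assumes mu: "\<mu> \<in> locally_finite" and D: "closed D" "convex D"
  shows "\<bar>cell D \<mu>\<bar> \<le> 2 ^ CARD('n) * (weight cube_radius \<mu> * cube_sup)"
  unfolding cell_def
proof (rule on_half_open_cube_bound[OF phi _ _ D])
  show "polyconvex (excursion_set g u \<mu> \<inter> C)" if "polyconvex C" for C
    by (rule excursion_polyconvex[OF mu that])
  show "\<bar>\<phi> (excursion_set g u \<mu> \<inter> C)\<bar> \<le> weight cube_radius \<mu> * cube_sup"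
    if "compact C" "convex C" "C \<subseteq> unit_cube" for C
    by (rule valuation_excursion_bound[OF mu geometric_functional_add[OF phi] phi_bound unit_cube_ball that])
qed

lemma cell_measurable:
  assumes D: "closed D" "convex D"
  shows "(\<lambda>\<mu>. if \<mu> \<in> locally_finite then cell D \<mu> else 0) \<in> borel_measurable (config intensity)"
proof -
  have p: "polyconvex (unit_cube \<inter> D)" "polyconvex (upper_boundary \<inter> D)"
    by (intro polyconvex_Int_closed_convex polyconvex_unit_cube polyconvex_upper_boundary D)+
  note m = functional_measurable[OF geometric_functional_measurable[OF phi]]
  have "(\<lambda>\<mu>. (if \<mu> \<in> locally_finite then \<phi> (excursion_set g u \<mu> \<inter> (unit_cube \<inter> D)) else 0)
      - (if \<mu> \<in> locally_finite then \<phi> (excursion_set g u \<mu> \<inter> (upper_boundary \<inter> D)) else 0)) \<in> borel_measurable (config intensity)"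
    by (intro borel_measurable_diff m p)
  moreover have "(\<lambda>\<mu>. (if \<mu> \<in> locally_finite then \<phi> (excursion_set g u \<mu> \<inter> (unit_cube \<inter> D)) else 0)
      - (if \<mu> \<in> locally_finite then \<phi> (excursion_set g u \<mu> \<inter> (upper_boundary \<inter> D)) else 0))
      = (\<lambda>\<mu>. if \<mu> \<in> locally_finite then cell D \<mu> else 0)"
    by (simp add: cell_def on_half_open_cube_def fun_eq_iff Int_assoc Int_commute[of D])
  ultimately show ?thesis by simp
qed

definition mean_cell_bound where "mean_cell_bound = (\<integral>\<omega>. 2 ^ CARD('n) * (weight cube_radius (\<eta> \<omega>) * cube_sup) \<partial>P)"

text \<open>The process \<open>\<zeta>\<close> is later a translate of \<open>\<eta>\<close>. As both have the same law, neither the mean nor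
  its bound depends on the translation.\<close>

lemma cell_expectation:
  assumes z: "poisson_process P intensity \<zeta>" and D: "closed D" "convex D"
  shows "integrable (completion P) (\<lambda>\<omega>. cell D (\<zeta> \<omega>))"
    and "expect P (\<lambda>\<omega>. cell D (\<zeta> \<omega>)) = expect P (\<lambda>\<omega>. cell D (\<eta> \<omega>))"
    and "\<bar>expect P (\<lambda>\<omega>. cell D (\<zeta> \<omega>))\<bar> \<le> mean_cell_bound"
proof -
  define \<Psi> where "\<Psi> \<mu> = (if \<mu> \<in> locally_finite then cell D \<mu> else 0)" for \<mu>
  have \<Psi>: "\<Psi> \<in> borel_measurable (config intensity)" unfolding \<Psi>_def by (rule cell_measurable[OF D])
  have wi: "integrable P (\<lambda>\<omega>. 2 ^ CARD('n) * (weight cube_radius (\<xi> \<omega>) * cube_sup))" if "poisson_process P intensity \<xi>" for \<xi>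
    by (intro integrable_mult_right integrable_mult_left integrable_weight[OF P that])
  have bd: "\<bar>\<Psi> \<mu>\<bar> \<le> 2 ^ CARD('n) * (weight cube_radius \<mu> * cube_sup)" for \<mu>
  proof -
    have "0 \<le> cube_sup" using phi_bound[of "{}"] by simp
    then show ?thesis using cell_bound[OF _ D, of \<mu>] by (auto simp: \<Psi>_def weight_def)
  qed
  have int: "integrable P (\<lambda>\<omega>. \<Psi> (\<xi> \<omega>))" if "poisson_process P intensity \<xi>" for \<xi>
    by (rule Bochner_Integration.integrable_bound[OF wi[OF that]])
      (use measurable_compose[OF poisson_process_measurable[OF that] \<Psi>] order_trans[OF bd abs_ge_self] in auto)
  have ae: "AE \<omega> in P. cell D (\<xi> \<omega>) = \<Psi> (\<xi> \<omega>)" if "poisson_process P intensity \<xi>" for \<xi>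
    using AE_locally_finite[OF P that] by eventually_elim (simp add: \<Psi>_def)
  have law: "(\<integral>\<omega>. f (\<zeta> \<omega>) \<partial>P) = (\<integral>\<omega>. f (\<eta> \<omega>) \<partial>P)" if f: "f \<in> borel_measurable (config intensity)"
    for f :: "((real ^ 'n) \<times> 'm) measure \<Rightarrow> real"
    using integral_distr[OF poisson_process_measurable[OF z] f] integral_distr[OF poisson_process_measurable[OF eta] f]
      poisson_process_law_unique[OF P z eta] by simp
  show "integrable (completion P) (\<lambda>\<omega>. cell D (\<zeta> \<omega>))" by (rule expect_AE_eq(1)[OF int[OF z] ae[OF z]])
  have ez: "expect P (\<lambda>\<omega>. cell D (\<zeta> \<omega>)) = (\<integral>\<omega>. \<Psi> (\<zeta> \<omega>) \<partial>P)" by (rule expect_AE_eq(2)[OF int[OF z] ae[OF z]])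
  moreover have "expect P (\<lambda>\<omega>. cell D (\<eta> \<omega>)) = (\<integral>\<omega>. \<Psi> (\<eta> \<omega>) \<partial>P)" by (rule expect_AE_eq(2)[OF int[OF eta] ae[OF eta]])
  ultimately show "expect P (\<lambda>\<omega>. cell D (\<zeta> \<omega>)) = expect P (\<lambda>\<omega>. cell D (\<eta> \<omega>))" using law[OF \<Psi>] by simp
  have "\<bar>\<integral>\<omega>. \<Psi> (\<zeta> \<omega>) \<partial>P\<bar> \<le> (\<integral>\<omega>. \<bar>\<Psi> (\<zeta> \<omega>)\<bar> \<partial>P)" by (rule integral_abs_bound)
  also have "\<dots> \<le> (\<integral>\<omega>. 2 ^ CARD('n) * (weight cube_radius (\<zeta> \<omega>) * cube_sup) \<partial>P)"
    by (rule integral_mono[OF integrable_abs[OF int[OF z]] wi[OF z] bd])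
  also have "\<dots> = mean_cell_bound"
    unfolding mean_cell_bound_def by (rule law) (intro borel_measurable_times borel_measurable_const weight_measurable)
  finally show "\<bar>expect P (\<lambda>\<omega>. cell D (\<zeta> \<omega>))\<bar> \<le> mean_cell_bound" by (simp add: ez)
qed

lemma translated_cell:
  assumes "\<omega> \<in> space P"
  shows "on_half_open_cube \<phi> ((\<lambda>y. y - z) ` (excursion_set g u (\<eta> \<omega>) \<inter> D))
    = cell ((\<lambda>y. y - z) ` D) (push (shift z) (\<eta> \<omega>))"
proof -
  have "point_measure_on intensity (\<eta> \<omega>)" using eta assms by (auto simp: poisson_process_def)
  then show ?thesis
    unfolding cell_def excursion_push_shift[OF \<open>point_measure_on intensity (\<eta> \<omega>)\<close>]
    by (subst image_Int) (auto simp: inj_on_def)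
qed

lemma window_expectation:
  fixes C :: "(real ^ 'n) set"
  assumes C: "compact C" "convex C"
  defines "c \<equiv> (\<lambda>z. expect P (\<lambda>\<omega>. cell ((\<lambda>y. y - z) ` C) (push (shift z) (\<eta> \<omega>))))"
  shows "integrable (completion P) (\<lambda>\<omega>. \<phi> (excursion_set g u (\<eta> \<omega>) \<inter> C))"
    and "expect P (\<lambda>\<omega>. \<phi> (excursion_set g u (\<eta> \<omega>) \<inter> C)) = (\<Sum>z\<in>cubes_hitting C. c z)"
proof -
  let ?X = "\<lambda>\<omega>. \<phi> (excursion_set g u (\<eta> \<omega>) \<inter> C)"
  let ?Y = "\<lambda>z \<omega>. cell ((\<lambda>y. y - z) ` C) (push (shift z) (\<eta> \<omega>))"
  have fin: "finite (cubes_hitting C)" by (rule finite_cubes_hitting[OF C(1)])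
  have pC: "polyconvex C" by (rule polyconvexI[OF C])
  have cl: "closed ((\<lambda>y. y - z) ` C)" "convex ((\<lambda>y. y - z) ` C)" for z
    using C by (auto intro: compact_imp_closed compact_translation_subtract convex_translation_subtract)
  have Yi: "integrable (completion P) (?Y z)" for z
    by (rule cell_expectation(1)[OF poisson_process_shift[OF P eta] cl])
  have ae: "AE \<omega> in P. ?X \<omega> = (\<Sum>z\<in>cubes_hitting C. ?Y z \<omega>)"
    using AE_locally_finite[OF P eta] AE_space
  proof eventually_elim
    case (elim \<omega>)
    have "?X \<omega> = (\<Sum>z\<in>cubes_hitting C. on_half_open_cube \<phi> ((\<lambda>y. y - z) ` (excursion_set g u (\<eta> \<omega>) \<inter> C)))"
      by (rule functional_lattice_decomposition[OF phi excursion_polyconvex[OF elim(1) pC] fin])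
        (use cubes_hitting_cover[of C] in \<open>auto simp: cubes_hitting_def\<close>)
    then show ?case by (simp add: translated_cell[OF elim(2)])
  qed
  have "(\<lambda>\<omega>. if \<eta> \<omega> \<in> locally_finite then \<phi> (excursion_set g u (\<eta> \<omega>) \<inter> C) else 0) \<in> borel_measurable P"
    by (rule measurable_compose[OF poisson_process_measurable[OF eta]
          functional_measurable[OF geometric_functional_measurable[OF phi] pC]])
  moreover have "AE \<omega> in P. ?X \<omega> = (if \<eta> \<omega> \<in> locally_finite then \<phi> (excursion_set g u (\<eta> \<omega>) \<inter> C) else 0)"
    using AE_locally_finite[OF P eta] by eventually_elim simp
  ultimately have Xm: "?X \<in> borel_measurable (completion P)" by (rule borel_measurable_completion_AE)
  have si: "integrable (completion P) (\<lambda>\<omega>. \<Sum>z\<in>cubes_hitting C. ?Y z \<omega>)"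
    by (intro Bochner_Integration.integrable_sum Yi)
  then have sm: "(\<lambda>\<omega>. \<Sum>z\<in>cubes_hitting C. ?Y z \<omega>) \<in> borel_measurable (completion P)" by (rule borel_measurable_integrable)
  note ae' = AE_completion[OF ae]
  show "integrable (completion P) ?X" using integrable_cong_AE[OF Xm sm ae'] si by simp
  have "expect P ?X = (\<integral>\<omega>. (\<Sum>z\<in>cubes_hitting C. ?Y z \<omega>) \<partial>completion P)"
    unfolding expect_def by (rule integral_cong_AE[OF Xm sm ae'])
  also have "\<dots> = (\<Sum>z\<in>cubes_hitting C. c z)"
    unfolding c_def expect_def by (rule Bochner_Integration.integral_sum) (rule Yi)
  finally show "expect P ?X = (\<Sum>z\<in>cubes_hitting C. c z)" .
qed

lemma on_half_open_cube_expectation: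
  "integrable (completion P) (\<lambda>\<omega>. on_half_open_cube \<phi> (excursion_set g u (\<eta> \<omega>)))"
  using cell_expectation(1)[OF eta closed_UNIV convex_UNIV] by (simp add: cell_def)

text \<open>The cubes inside contribute \<open>e\<close> each, and their number differs from the volume by at most
  the number of boundary cubes; each of the latter contributes at most \<open>mean_cell_bound\<close>.\<close>

lemma window_expectation_estimate:
  fixes C :: "(real ^ 'n) set"
  assumes C: "compact C" "convex C"
  defines "e \<equiv> expect P (\<lambda>\<omega>. on_half_open_cube \<phi> (excursion_set g u (\<eta> \<omega>)))"
  shows "\<bar>expect P (\<lambda>\<omega>. \<phi> (excursion_set g u (\<eta> \<omega>) \<inter> C)) - e * measure lborel C\<bar>
    \<le> (mean_cell_bound + \<bar>e\<bar>) * card (cubes_hitting C - cubes_inside C)"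
proof -
  define c where "c = (\<lambda>z. expect P (\<lambda>\<omega>. cell ((\<lambda>y. y - z) ` C) (push (shift z) (\<eta> \<omega>))))"
  let ?H = "cubes_hitting C" and ?I = "cubes_inside C"
  have fin: "finite ?H" by (rule finite_cubes_hitting[OF C(1)])
  have inside: "c z = e" if z: "z \<in> ?I" for z
  proof -
    have "unit_cube \<subseteq> (\<lambda>y. y - z) ` C"
    proof
      fix x assume "x \<in> (unit_cube :: (real ^ 'n) set)"
      then have "z + x \<in> C" using z by (auto simp: cubes_inside_def)
      then show "x \<in> (\<lambda>y. y - z) ` C" by (simp add: mem_translate_minus add.commute)
    qed
    then have "(\<lambda>y. y - z) ` C \<inter> unit_cube = unit_cube" "(\<lambda>y. y - z) ` C \<inter> upper_boundary = upper_boundary"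
      by (auto simp: upper_boundary_def)
    then have "cell ((\<lambda>y. y - z) ` C) \<mu> = cell UNIV \<mu>" for \<mu>
      by (simp add: cell_def on_half_open_cube_def Int_assoc)
    then have "c z = expect P (\<lambda>\<omega>. cell UNIV (push (shift z) (\<eta> \<omega>)))" by (simp add: c_def)
    also have "\<dots> = expect P (\<lambda>\<omega>. cell UNIV (\<eta> \<omega>))"
      by (rule cell_expectation(2)[OF poisson_process_shift[OF P eta] closed_UNIV convex_UNIV])
    finally show ?thesis by (simp add: e_def cell_def)
  qed
  have cl: "closed ((\<lambda>y. y - z) ` C)" "convex ((\<lambda>y. y - z) ` C)" for z
    using C by (auto intro: compact_imp_closed compact_translation_subtract convex_translation_subtract)
  have cb: "\<bar>c z\<bar> \<le> mean_cell_bound" for z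
    unfolding c_def by (rule cell_expectation(3)[OF poisson_process_shift[OF P eta] cl])
  have "expect P (\<lambda>\<omega>. \<phi> (excursion_set g u (\<eta> \<omega>) \<inter> C)) = (\<Sum>z\<in>?H. c z)"
    using window_expectation(2)[OF C] by (simp add: c_def)
  also have "\<dots> = (\<Sum>z\<in>?H - ?I. c z) + (\<Sum>z\<in>?I. c z)"
    by (rule sum.subset_diff[OF cubes_inside_subset fin])
  also have "(\<Sum>z\<in>?I. c z) = card ?I * e" using inside by simp
  finally have E: "expect P (\<lambda>\<omega>. \<phi> (excursion_set g u (\<eta> \<omega>) \<inter> C)) - e * measure lborel C
      = (\<Sum>z\<in>?H - ?I. c z) + e * (card ?I - measure lborel C)" by (simp add: algebra_simps)
  have "\<bar>\<Sum>z\<in>?H - ?I. c z\<bar> \<le> (\<Sum>z\<in>?H - ?I. \<bar>c z\<bar>)" by (rule sum_abs)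
  also have "\<dots> \<le> (\<Sum>z\<in>?H - ?I. mean_cell_bound)" by (rule sum_mono) (rule cb)
  also have "\<dots> = mean_cell_bound * card (?H - ?I)" by simp
  finally have "\<bar>\<Sum>z\<in>?H - ?I. c z\<bar> \<le> mean_cell_bound * card (?H - ?I)" .
  moreover have "\<bar>e * (card ?I - measure lborel C)\<bar> \<le> \<bar>e\<bar> * card (?H - ?I)"
    unfolding abs_mult using cubes_inside_volume[OF C(1)] by (intro mult_left_mono) auto
  ultimately show ?thesis unfolding E by (simp add: distrib_right)
qed

lemma mean_value_limit:
  fixes W :: "(real ^ 'n) set"
  assumes W: "compact W" "convex W" "measure lborel W > 0"
  shows "((\<lambda>r. expect P (\<lambda>\<omega>. \<phi> (excursion_set g u (\<eta> \<omega>) \<inter> window W r)) / intrinsic_volume (CARD('n)) (window W r))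
    \<longlongrightarrow> expect P (\<lambda>\<omega>. on_half_open_cube \<phi> (excursion_set g u (\<eta> \<omega>)))) at_top"
proof -
  define e where "e = expect P (\<lambda>\<omega>. on_half_open_cube \<phi> (excursion_set g u (\<eta> \<omega>)))"
  define E where "E r = expect P (\<lambda>\<omega>. \<phi> (excursion_set g u (\<eta> \<omega>) \<inter> window W r))" for r
  define v where "v r = measure lborel (parallel_body (frontier W) (2 * CARD('n) / r))" for r :: real
  let ?V = "\<lambda>r. intrinsic_volume (CARD('n)) (window W r)"
  have "W \<noteq> {}" using W(3) by auto
  have cw: "compact (window W r)" "convex (window W r)" for r
    unfolding window_def using W compact_scaling convex_scaling by blast+
  have dev: "\<bar>E r / ?V r - e\<bar> \<le> (mean_cell_bound + \<bar>e\<bar>) * v r / measure lborel W" if r: "0 < r" for r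
  proof -
    have V: "?V r = r ^ CARD('n) * measure lborel W"
      using measure_parallel_body_intrinsic_volumes(2)[OF cw[of r], of 0] \<open>W \<noteq> {}\<close>
        measure_scaleR_image[OF W(1), of r] r by (simp add: window_def)
    then have Vpos: "?V r > 0" using W(3) r by simp
    have b0: "0 \<le> mean_cell_bound + \<bar>e\<bar>" using cell_expectation(3)[OF eta closed_UNIV convex_UNIV] by linarith
    have "\<bar>E r - e * ?V r\<bar> \<le> (mean_cell_bound + \<bar>e\<bar>) * card (cubes_hitting (window W r) - cubes_inside (window W r))"
      using window_expectation_estimate[OF cw[of r]] V measure_scaleR_image[OF W(1), of r] r
      by (simp add: E_def e_def window_def)
    also have "\<dots> \<le> (mean_cell_bound + \<bar>e\<bar>) * (r ^ CARD('n) * v r)"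
      unfolding v_def by (rule mult_left_mono[OF boundary_cubes_card[OF W(1) r] b0])
    finally have "\<bar>E r - e * ?V r\<bar> / ?V r \<le> (mean_cell_bound + \<bar>e\<bar>) * (r ^ CARD('n) * v r) / ?V r"
      using Vpos by (intro divide_right_mono) auto
    also have "\<dots> = (mean_cell_bound + \<bar>e\<bar>) * v r / measure lborel W" using r W(3) by (simp add: V)
    finally have "\<bar>(E r - e * ?V r) / ?V r\<bar> \<le> (mean_cell_bound + \<bar>e\<bar>) * v r / measure lborel W"
      using Vpos by (simp add: abs_divide)
    moreover have "(E r - e * ?V r) / ?V r = E r / ?V r - e" using Vpos by (simp add: field_simps)
    ultimately show ?thesis by simp
  qed
  have ev: "\<forall>\<^sub>F r in at_top. norm (E r / ?V r - e) \<le> (mean_cell_bound + \<bar>e\<bar>) * v r / measure lborel W"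
    using eventually_gt_at_top[of "0::real"] by eventually_elim (use dev in simp)
  have "((\<lambda>r. (mean_cell_bound + \<bar>e\<bar>) * v r / measure lborel W) \<longlongrightarrow> (mean_cell_bound + \<bar>e\<bar>) * 0 / measure lborel W) at_top"
    unfolding v_def by (intro tendsto_intros frontier_parallel_volume_tendsto_0 W) (use W(3) in simp)
  then have "((\<lambda>r. (mean_cell_bound + \<bar>e\<bar>) * v r / measure lborel W) \<longlongrightarrow> 0) at_top" by simp
  from Lim_null_comparison[OF ev this] have "((\<lambda>r. E r / ?V r - e) \<longlongrightarrow> 0) at_top" .
  then show ?thesis unfolding E_def e_def by (rule LIM_zero_cancel)
qed

end

theorem theorem3p1:
  fixes P :: "'w measure" and Q :: "'m measure"
    and \<gamma> u :: real
    and \<eta> :: "'w \<Rightarrow> ((real ^ 'n) \<times> 'm) measure"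
    and g :: "'m \<Rightarrow> real ^ 'n \<Rightarrow> real"
    and \<phi> :: "(real ^ 'n) set \<Rightarrow> real"
    and W :: "(real ^ 'n) set"
  assumes "prob_space P" and "prob_space Q"
    and "\<gamma> > 0"
    and "poisson_process P (scale_measure (ennreal \<gamma>) lborel \<Otimes>\<^sub>M Q) \<eta>"
    and "g \<in> Q \<rightarrow>\<^sub>M L1_tilde_borel"
    and "\<And>m x. m \<in> space Q \<Longrightarrow> 0 \<le> g m x"
    and "\<And>m. m \<in> space Q \<Longrightarrow> grain g m \<noteq> {}"
    and "\<And>m. m \<in> space Q \<Longrightarrow> concave_on (grain g m) (g m)"
    and "\<And>m. m \<in> space Q \<Longrightarrow> measure lborel (grain g m) > 0"
    and "compact W" and "convex W" and "measure lborel W > 0"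
    and "mono_on {1..} (window W)"
    and "geometric_functional \<phi>"
    and "u > 0"
    and "\<And>i. i \<in> {1..CARD('n)} \<Longrightarrow> integrable Q (\<lambda>m. intrinsic_volume i (grain g m))"
  shows "(\<forall>r\<ge>1. integrable (completion P) (\<lambda>\<omega>. \<phi> (excursion_set g u (\<eta> \<omega>) \<inter> window W r))) \<and>
    integrable (completion P) (\<lambda>\<omega>. on_half_open_cube \<phi> (excursion_set g u (\<eta> \<omega>))) \<and>
    ((\<lambda>r. expect P (\<lambda>\<omega>. \<phi> (excursion_set g u (\<eta> \<omega>) \<inter> window W r)) /
         intrinsic_volume (CARD('n)) (window W r))
      \<longlongrightarrow> expect P (\<lambda>\<omega>. on_half_open_cube \<phi> (excursion_set g u (\<eta> \<omega>)))) at_top"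
proof -
  interpret shot_noise_model Q \<gamma> u g
  proof (rule shot_noise_model.intro)
    show "integrable Q (\<lambda>m. intrinsic_volume i (grain g m))" if "i \<in> {1..DIM(real ^ 'n)}" for i
      using that assms(16)[of i] by simp
  qed (fact assms)+
  interpret excursion_functional Q \<gamma> u g P \<eta> \<phi>
  proof (rule excursion_functional.intro)
    show "shot_noise_model Q g" by (rule shot_noise_model_axioms)
    show "excursion_functional_axioms Q \<gamma> P \<eta> \<phi>"
      by (rule excursion_functional_axioms.intro) (fact assms assms(4)[folded intensity_def])+
  qed
  show ?thesis
  proof (intro conjI allI impI)
    fix r :: real
    have "compact (window W r)" "convex (window W r)"
      unfolding window_def using assms compact_scaling convex_scaling by blast+
    then show "integrable (completion P) (\<lambda>\<omega>. \<phi> (excursion_set g u (\<eta> \<omega>) \<inter> window W r))"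
      by (rule window_expectation(1))
  qed (rule on_half_open_cube_expectation mean_value_limit assms)+
qed

end
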